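(* Let $\mathcal X$ be a space of homogeneous type with degree $(\alpha_0,n_0,N_0)$, let $\varphi$ be a growth function on $\mathcal X\times[0,\infty)$, and let $\{A_t\}_{t>0}$ satisfy Assumption A. For measurable $E\subset\mathcal X$ and $t>0$ write $\varphi(E,t):=\int_E\varphi(x,t)\,d\mu(x)$; for a ball $B$ write $t_B:=r_B^m$, $r_B$ being the radius of $B$. (i) Assume $\varphi\in\mathbb A_1(\mathcal X)$. Then there exist positive constants $c_1,c_2$ such that, for all $f\in\mathrm{BMO}^\varphi_A(\mathcal X)$, balls $B$ and $\lambda\in(0,\infty)$, $$\varphi\left(\left\{x\in B:\ \frac{|f(x)-A_{t_B}f(x)|}{\varphi(x,\|\chi_B\|_{L^\varphi(\mathcal X)}^{-1})}>\lambda\right\},\|\chi_B\|_{L^\varphi(\mathcal X)}^{-1}\right)\le c_1\exp\left\{-\frac{c_2\lambda}{\|\chi_B\|_{L^\varphi(\mathcal X)}\|f\|_{\mathrm{BMO}^\varphi_A(\mathcal X)}}\right\}.$$ (ii) Assume $\varphi\in\mathbb A_{p_1}(\mathcal X)$ for some $p_1\in(1,\infty)$ and $p(\varphi)\le1+\frac1{[r(\varphi)]'}$, where $1/r(\varphi)+1/[r(\varphi)]'=1$. Then there exist positive constants $b_1,b_2$ such that, for all $f\in\mathrm{BMO}^\varphi_A(\mathcal X)$, balls $B$ and $\lambda\in(0,\infty)$, $$\varphi\left(\left\{x\in B:\ \frac{|f(x)-A_{t_B}f(x)|}{\varphi(x,\|\chi_B\|_{L^\varphi(\mathcal X)}^{-1})}>\lambda\right\},\|\chi_B\|_{L^\varphi(\mathcal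 X)}^{-1}\right)\le b_1\min\left\{1,\ b_2\left[\frac{\lambda\,\varphi(B,\|\chi_B\|_{L^\varphi(\mathcal X)}^{-1})}{\|\chi_B\|_{L^\varphi(\mathcal X)}\|f\|_{\mathrm{BMO}^\varphi_A(\mathcal X)}}\right]^{-p_1'}\right\},$$ where $1/p_1+1/p_1'=1$. (In both parts the right-hand side is read as $0$ if $\|f\|_{\mathrm{BMO}^\varphi_A(\mathcal X)}=0$.)
   Context: **Spaces of homogeneous type.** $(\mathcal X,d,\mu)$: $d:\mathcal X\times\mathcal X\to[0,\infty)$ is a quasi-metric ($d(x,y)=0$ iff $x=y$; $d(x,y)=d(y,x)$; $d(x,y)\le C_1[d(x,z)+d(z,y)]$ for a constant $C_1\in[1,\infty)$), and $\mu$ is a nonnegative Borel measure for which there is $C_2\in[1,\infty)$ with $\mu(B(x,2r))\le C_2\mu(B(x,r))<\infty$ for all balls $B(x,r)=\{y: d(y,x)<r\}$ (balls have positive measure). Consider the conditions: ($D_n$), $n\in(0,\infty)$: $\exists C$ with $\mu(B(x,\lambda r))\le C\lambda^n\mu(B(x,r))$ for all $x\in\mathcal X$, $r>0$, $\lambda\ge1$; ($E_N$), $N\in[0,\infty)$: $\exists C$ with $\mu(B(y,r))\le C[1+d(x,y)/r]^N\mu(B(x,r))$ for all $x,y\in\mathcal X$, $r>0$; ($R_\alpha$), $\alpha\in[0,n]$ with $n$ as in ($D_n$): $\exists C\ge1$ with $C^{-1}\lambda^\alpha\mu(B(x,r))\le\mu(B(x,\lambda r))$ for all $x\in\mathcal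 X$, $r\in(0,2\,\mathrm{diam}(\mathcal X))$, $\lambda\in[1,2\,\mathrm{diam}(\mathcal X)/r)$. Set $n_0=\inf\{n:(D_n)\}$, $N_0=\inf\{N:(E_N)\}$, $\alpha_0=\sup\{\alpha:(R_\alpha)\}$; $(\alpha_0,n_0,N_0)$ is the degree of $\mathcal X$. **Growth functions.** $\varphi:\mathcal X\times[0,\infty)\to[0,\infty)$ is of uniformly upper type $p$ (resp. uniformly lower type $p$) if $\exists C$ with $\varphi(x,st)\le Cs^p\varphi(x,t)$ for all $x\in\mathcal X$, $t\ge0$ and $s\ge1$ (resp. $s\in(0,1)$). For $p\in(1,\infty)$, $\varphi\in\mathbb A_p(\mathcal X)$ means $\sup_{t>0}\sup_{B}\frac1{\mu(B)}\int_B\varphi(x,t)\,d\mu(x)\{\frac1{\mu(B)}\int_B[\varphi(x,t)]^{-1/(p-1)}d\mu(x)\}^{p-1}<\infty$; $\varphi\in\mathbb A_1(\mathcal X)$ means $\sup_{t>0}\sup_B\frac1{\mu(B)}\int_B\varphi(x,t)d\mu(x)\,\{\mathrm{ess\,sup}_{y\in B}[\varphi(y,t)]^{-1}\}<\infty$; $\mathbb A_\infty=\bigcup_{p\in[1,\infty)}\mathbb A_p$. For $q\in(1,\infty)$, $\varphi\in\mathbb{RH}_q(\mathcal X)$ means $\sup_{t>0}\sup_B\{\frac1{\mu(B)}\int_B[\varphi(x,t)]^qd\mu(x)\}^{1/q}\{\frac1{\mu(B)}\int_B\varphi(x,t)d\mu(x)\}^{-1}<\infty$; for $q=\infty$ the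 first factor is replaced by $\mathrm{ess\,sup}_{y\in B}\varphi(y,t)$. (Suprema over all balls $B$.) $\varphi$ is a growth function if: for each $x$, $\varphi(x,\cdot)$ is an Orlicz function (nondecreasing, $\varphi(x,0)=0$, $\varphi(x,t)>0$ for $t>0$, $\lim_{t\to\infty}\varphi(x,t)=\infty$; not necessarily convex); $\varphi(\cdot,t)$ is measurable for each $t$; $\varphi\in\mathbb A_\infty(\mathcal X)$; and $\varphi$ is of uniformly upper type $1$ and of uniformly lower type $p$ for some $p\in(0,1]$. Indices: $i(\varphi)=\sup\{p\in(0,\infty):\varphi$ is of uniformly lower type $p\}$, $p(\varphi)=\inf\{p\in[1,\infty):\varphi\in\mathbb A_p(\mathcal X)\}$, $r(\varphi)=\sup\{q\in(1,\infty]:\varphi\in\mathbb{RH}_q(\mathcal X)\}$, with $(r-1)/r:=1$ if $r=\infty$. $\|f\|_{L^\varphi(\mathcal X)}=\inf\{\lambda>0:\int_{\mathcal X}\varphi(x,|f(x)|/\lambda)\,d\mu(x)\le1\}$; $\chi_B$ is the characteristic function of $B$. **Generalized approximation to the identity.** Fix $M>n_0[1+p(\varphi)/i(\varphi)]-\alpha_0$, a constant $m>0$, and a positive, bounded, decreasing function $g$ on $[0,\infty)$ with $\lim_{r\to\infty}r^Mg(r^m)=0$. The operators are $A_tf(x)=\int_{\mathcal X}a_t(x,y)f(y)\,d\mu(y)$, $t>0$, with $|a_t(x,y)|\le h_t(x,y):=\frac1{\mu(B(x,t^{1/m}))}g\big(\frac{[d(x,y)]^m}{t}\big)$ for all $x,y\in\mathcal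 X$. They act on $f\in\mathcal M(\mathcal X):=\bigcup_{x_0\in\mathcal X}\bigcup_\beta\mathcal M_{(x_0,\beta)}(\mathcal X)$, the union over $0<\beta<M-n_0[1+p(\varphi)/i(\varphi)]+\alpha_0$, where $\mathcal M_{(x_0,\beta)}(\mathcal X)$ is the set of $f\in L^1_{\rm loc}(\mathcal X)$ with $\int_{\mathcal X}\frac{|f(x)|}{[1+d(x_0,x)]^{n_0p(\varphi)/i(\varphi)-\alpha_0+\beta}\,\mu(B(x_0,1+d(x_0,x)))}\,d\mu(x)<\infty$. **Assumption A.** $\{A_t\}_{t>0}$ is a generalized approximation to the identity, that is, $A_tf(x)=\int_{\mathcal X}a_t(x,y)f(y)\,d\mu(y)$ with $|a_t(x,y)|\le\frac1{\mu(B(x,t^{1/m}))}g\big(\frac{[d(x,y)]^m}{t}\big)$ for all $t>0$ and $x,y\in\mathcal X$, where $g$ is positive, bounded, decreasing and $\lim_{r\to\infty}r^Mg(r^m)=0$; $A_0:=I$ (identity), $A_tA_sf=A_{t+s}f$ almost everywhere for all $s,t\in[0,\infty)$ and $f\in\mathcal M(\mathcal X)$, and in addition $M>n_0+\frac{2n_0p(\varphi)}{i(\varphi)}+N_0-\frac{n_0[r(\varphi)-1]}{r(\varphi)}-\alpha_0.$ **Space.** $\mathrm{BMO}^\varphi_A(\mathcal X)$ is the set of $f\in\mathcal M(\mathcal X)$ with $\|f\|_{\mathrm{BMO}^\varphi_A(\mathcal X)}=\sup_B\frac1{\|\chi_B\|_{L^\varphi(\mathcal X)}}\int_B|f(x)-A_{t_B}f(x)|\,d\mu(x)<\infty$,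 the supremum over all balls $B$, with $t_B:=r_B^m$, $r_B$ the radius of $B$. *)

theory Defs
  imports "HOL-Probability.Essential_Supremum"
begin

section \<open>Spaces of homogeneous type\<close>

text \<open>The space is a whole type; a ball is always given by a centre and a positive radius.\<close>

definition qball :: "('a \<Rightarrow> 'a \<Rightarrow> real) \<Rightarrow> 'a \<Rightarrow> real \<Rightarrow> 'a set" where
  "qball d x r = {y. d y x < r}"

definition quasi_metric :: "('a \<Rightarrow> 'a \<Rightarrow> real) \<Rightarrow> bool" where
  "quasi_metric d \<longleftrightarrow>
     (\<forall>x y. 0 \<le> d x y) \<and> (\<forall>x y. d x y = 0 \<longleftrightarrow> x = y) \<and> (\<forall>x y. d x y = d y x) \<and>
     (\<exists>C1\<ge>1. \<forall>x y z. d x y \<le> C1 * (d x z + d z y))"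

definition qopen :: "('a \<Rightarrow> 'a \<Rightarrow> real) \<Rightarrow> 'a set \<Rightarrow> bool" where
  "qopen d U \<longleftrightarrow> (\<forall>x\<in>U. \<exists>r>0. qball d x r \<subseteq> U)"

text \<open>Balls of a quasi-metric need not be open, so that they are Borel has to be required
  separately.\<close>

definition homogeneous_space :: "('a \<Rightarrow> 'a \<Rightarrow> real) \<Rightarrow> 'a measure \<Rightarrow> bool" where
  "homogeneous_space d \<mu> \<longleftrightarrow>
     quasi_metric d \<and>
     space \<mu> = UNIV \<and> sets \<mu> = sigma_sets UNIV {U. qopen d U} \<and>
     (\<forall>x. \<forall>r>0. qball d x r \<in> sets \<mu> \<and> 0 < emeasure \<mu> (qball d x r)) \<and>
     (\<exists>C2\<ge>1. \<forall>x. \<forall>r>0.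
        emeasure \<mu> (qball d x (2 * r)) \<le> ennreal C2 * emeasure \<mu> (qball d x r) \<and>
        emeasure \<mu> (qball d x r) < \<infinity>)"

definition cond_D :: "('a \<Rightarrow> 'a \<Rightarrow> real) \<Rightarrow> 'a measure \<Rightarrow> real \<Rightarrow> bool" where
  "cond_D d \<mu> n \<longleftrightarrow> 0 < n \<and>
     (\<exists>C. \<forall>x. \<forall>r>0. \<forall>l\<ge>1.
        measure \<mu> (qball d x (l * r)) \<le> C * l powr n * measure \<mu> (qball d x r))"

definition cond_E :: "('a \<Rightarrow> 'a \<Rightarrow> real) \<Rightarrow> 'a measure \<Rightarrow> real \<Rightarrow> bool" where
  "cond_E d \<mu> N \<longleftrightarrow> 0 \<le> N \<and>
     (\<exists>C. \<forall>x y. \<forall>r>0.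
        measure \<mu> (qball d y r) \<le> C * (1 + d x y / r) powr N * measure \<mu> (qball d x r))"

definition qdiam :: "('a \<Rightarrow> 'a \<Rightarrow> real) \<Rightarrow> ereal" where
  "qdiam d = (SUP (x, y)\<in>UNIV. ereal (d x y))"

text \<open>The bound \<open>\<alpha> \<le> n\<close> is imposed for every \<open>n\<close> admissible in \<open>cond_D\<close>.  It follows from
  the inequality unless the space is a single point, where the inequality is vacuous.\<close>

definition cond_R :: "('a \<Rightarrow> 'a \<Rightarrow> real) \<Rightarrow> 'a measure \<Rightarrow> real \<Rightarrow> bool" where
  "cond_R d \<mu> \<alpha> \<longleftrightarrow> 0 \<le> \<alpha> \<and> (\<forall>n. cond_D d \<mu> n \<longrightarrow> \<alpha> \<le> n) \<and>
     (\<exists>C\<ge>1. \<forall>x r l. 0 < r \<and> ereal r < 2 * qdiam d \<and> 1 \<le> l \<and> ereal l < 2 * qdiam d / ereal r \<longrightarrow>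
        inverse C * l powr \<alpha> * measure \<mu> (qball d x r) \<le> measure \<mu> (qball d x (l * r)))"

definition deg_n :: "('a \<Rightarrow> 'a \<Rightarrow> real) \<Rightarrow> 'a measure \<Rightarrow> real" where
  "deg_n d \<mu> = Inf {n. cond_D d \<mu> n}"

definition deg_N :: "('a \<Rightarrow> 'a \<Rightarrow> real) \<Rightarrow> 'a measure \<Rightarrow> real" where
  "deg_N d \<mu> = Inf {N. cond_E d \<mu> N}"

definition deg_alpha :: "('a \<Rightarrow> 'a \<Rightarrow> real) \<Rightarrow> 'a measure \<Rightarrow> real" where
  "deg_alpha d \<mu> = Sup {\<alpha>. cond_R d \<mu> \<alpha>}"

section \<open>Growth functions\<close>

text \<open>A function on \<open>X \<times> [0,\<infinity>)\<close> is represented by \<open>\<phi> :: 'a \<Rightarrow> real \<Rightarrow> real\<close>; only its values at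
  nonnegative second arguments matter.\<close>

definition upper_type :: "('a \<Rightarrow> real \<Rightarrow> real) \<Rightarrow> real \<Rightarrow> bool" where
  "upper_type \<phi> p \<longleftrightarrow> (\<exists>C. \<forall>x. \<forall>t\<ge>0. \<forall>s\<ge>1. \<phi> x (s * t) \<le> C * s powr p * \<phi> x t)"

definition lower_type :: "('a \<Rightarrow> real \<Rightarrow> real) \<Rightarrow> real \<Rightarrow> bool" where
  "lower_type \<phi> p \<longleftrightarrow> (\<exists>C. \<forall>x. \<forall>t\<ge>0. \<forall>s\<in>{0<..<1}. \<phi> x (s * t) \<le> C * s powr p * \<phi> x t)"

text \<open>Real powers with positive exponent on \<open>[0,\<infinity>]\<close>.\<close>

definition enn_powr :: "ennreal \<Rightarrow> real \<Rightarrow> ennreal" where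
  "enn_powr x a = (if x = \<infinity> then \<infinity> else ennreal (enn2real x powr a))"

definition average :: "'a measure \<Rightarrow> 'a set \<Rightarrow> ('a \<Rightarrow> ennreal) \<Rightarrow> ennreal" where
  "average \<mu> B F = (\<integral>\<^sup>+x\<in>B. F x \<partial>\<mu>) / emeasure \<mu> B"

definition muckenhoupt :: "('a \<Rightarrow> 'a \<Rightarrow> real) \<Rightarrow> 'a measure \<Rightarrow> real \<Rightarrow> ('a \<Rightarrow> real \<Rightarrow> real) set" where
  "muckenhoupt d \<mu> p = {\<phi>.
     (if p = 1 then
        (SUP t\<in>{0<..}. SUP (x, r)\<in>UNIV \<times> {0<..}.
           average \<mu> (qball d x r) (\<lambda>y. ennreal (\<phi> y t)) *
           esssup (restrict_space \<mu> (qball d x r)) (\<lambda>y. inverse (ennreal (\<phi> y t))))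
      else
        (SUP t\<in>{0<..}. SUP (x, r)\<in>UNIV \<times> {0<..}.
           average \<mu> (qball d x r) (\<lambda>y. ennreal (\<phi> y t)) *
           enn_powr (average \<mu> (qball d x r)
             (\<lambda>y. enn_powr (inverse (ennreal (\<phi> y t))) (1 / (p - 1)))) (p - 1)))
     < \<infinity>}"

definition reverse_holder :: "('a \<Rightarrow> 'a \<Rightarrow> real) \<Rightarrow> 'a measure \<Rightarrow> ereal \<Rightarrow> ('a \<Rightarrow> real \<Rightarrow> real) set" where
  "reverse_holder d \<mu> q = {\<phi>.
     (SUP t\<in>{0<..}. SUP (x, r)\<in>UNIV \<times> {0<..}.
        (if q = \<infinity> then esssup (restrict_space \<mu> (qball d x r)) (\<lambda>y. ennreal (\<phi> y t))
         else enn_powr (average \<mu> (qball d x r)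
           (\<lambda>y. enn_powr (ennreal (\<phi> y t)) (real_of_ereal q))) (1 / real_of_ereal q)) *
        inverse (average \<mu> (qball d x r) (\<lambda>y. ennreal (\<phi> y t))))
     < \<infinity>}"

definition orlicz_function :: "(real \<Rightarrow> real) \<Rightarrow> bool" where
  "orlicz_function \<Phi> \<longleftrightarrow>
     mono_on {0..} \<Phi> \<and> \<Phi> 0 = 0 \<and> (\<forall>t>0. 0 < \<Phi> t) \<and> filterlim \<Phi> at_top at_top"

definition growth_function :: "('a \<Rightarrow> 'a \<Rightarrow> real) \<Rightarrow> 'a measure \<Rightarrow> ('a \<Rightarrow> real \<Rightarrow> real) \<Rightarrow> bool" where
  "growth_function d \<mu> \<phi> \<longleftrightarrow>
     (\<forall>x. orlicz_function (\<phi> x)) \<and>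
     (\<forall>t\<ge>0. (\<lambda>x. \<phi> x t) \<in> borel_measurable \<mu>) \<and>
     \<phi> \<in> (\<Union>p\<in>{1..}. muckenhoupt d \<mu> p) \<and>
     upper_type \<phi> 1 \<and> (\<exists>p\<in>{0<..1}. lower_type \<phi> p)"

definition i_index :: "('a \<Rightarrow> real \<Rightarrow> real) \<Rightarrow> real" where
  "i_index \<phi> = Sup {p. 0 < p \<and> lower_type \<phi> p}"

definition p_index :: "('a \<Rightarrow> 'a \<Rightarrow> real) \<Rightarrow> 'a measure \<Rightarrow> ('a \<Rightarrow> real \<Rightarrow> real) \<Rightarrow> real" where
  "p_index d \<mu> \<phi> = Inf {p. 1 \<le> p \<and> \<phi> \<in> muckenhoupt d \<mu> p}"

definition r_index :: "('a \<Rightarrow> 'a \<Rightarrow> real) \<Rightarrow> 'a measure \<Rightarrow> ('a \<Rightarrow> real \<Rightarrow> real) \<Rightarrow> ereal" where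
  "r_index d \<mu> \<phi> = Sup {q. 1 < q \<and> \<phi> \<in> reverse_holder d \<mu> q}"

text \<open>The solution \<open>r'\<close> of \<open>1/r + 1/r' = 1\<close> for \<open>r \<in> (1,\<infinity>]\<close>.\<close>

definition conj_exponent :: "ereal \<Rightarrow> real" where
  "conj_exponent r = (if r = \<infinity> then 1 else real_of_ereal r / (real_of_ereal r - 1))"

definition luxemburg_norm :: "'a measure \<Rightarrow> ('a \<Rightarrow> real \<Rightarrow> real) \<Rightarrow> ('a \<Rightarrow> complex) \<Rightarrow> ennreal" where
  "luxemburg_norm \<mu> \<phi> f =
     Inf {ennreal l | l. 0 < l \<and> (\<integral>\<^sup>+x. ennreal (\<phi> x (cmod (f x) / l)) \<partial>\<mu>) \<le> 1}"

text \<open>For a growth function the norm of the characteristic function of a ball is positive and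
  finite, hence nothing is lost in passing to a real number.\<close>

definition chi_norm :: "'a measure \<Rightarrow> ('a \<Rightarrow> real \<Rightarrow> real) \<Rightarrow> 'a set \<Rightarrow> real" where
  "chi_norm \<mu> \<phi> B = enn2real (luxemburg_norm \<mu> \<phi> (indicator B))"

definition phi_mass :: "'a measure \<Rightarrow> ('a \<Rightarrow> real \<Rightarrow> real) \<Rightarrow> 'a set \<Rightarrow> real \<Rightarrow> ennreal" where
  "phi_mass \<mu> \<phi> E t = (\<integral>\<^sup>+x\<in>E. ennreal (\<phi> x t) \<partial>\<mu>)"

section \<open>Generalized approximations to the identity\<close>

definition M_class_at :: "('a \<Rightarrow> 'a \<Rightarrow> real) \<Rightarrow> 'a measure \<Rightarrow> ('a \<Rightarrow> real \<Rightarrow> real) \<Rightarrow> 'a \<Rightarrow> real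
    \<Rightarrow> ('a \<Rightarrow> complex) set" where
  "M_class_at d \<mu> \<phi> x0 \<beta> = {f.
     f \<in> borel_measurable \<mu> \<and>
     (\<forall>x. \<forall>r>0. set_integrable \<mu> (qball d x r) f) \<and>
     (\<integral>\<^sup>+x. ennreal (cmod (f x) /
        ((1 + d x0 x) powr (deg_n d \<mu> * p_index d \<mu> \<phi> / i_index \<phi> - deg_alpha d \<mu> + \<beta>) *
         measure \<mu> (qball d x0 (1 + d x0 x)))) \<partial>\<mu>) < \<infinity>}"

definition M_class :: "('a \<Rightarrow> 'a \<Rightarrow> real) \<Rightarrow> 'a measure \<Rightarrow> ('a \<Rightarrow> real \<Rightarrow> real) \<Rightarrow> real
    \<Rightarrow> ('a \<Rightarrow> complex) set" where
  "M_class d \<mu> \<phi> M =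
     (\<Union>x0. \<Union>\<beta>\<in>{0<..<M - deg_n d \<mu> * (1 + p_index d \<mu> \<phi> / i_index \<phi>) + deg_alpha d \<mu>}.
        M_class_at d \<mu> \<phi> x0 \<beta>)"

definition h_kernel :: "('a \<Rightarrow> 'a \<Rightarrow> real) \<Rightarrow> 'a measure \<Rightarrow> real \<Rightarrow> (real \<Rightarrow> real)
    \<Rightarrow> real \<Rightarrow> 'a \<Rightarrow> 'a \<Rightarrow> real" where
  "h_kernel d \<mu> m g t x y =
     1 / measure \<mu> (qball d x (t powr (1 / m))) * g (d x y powr m / t)"

definition A_op :: "'a measure \<Rightarrow> (real \<Rightarrow> 'a \<Rightarrow> 'a \<Rightarrow> complex) \<Rightarrow> real
    \<Rightarrow> ('a \<Rightarrow> complex) \<Rightarrow> 'a \<Rightarrow> complex" where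
  "A_op \<mu> a t f x = (if t = 0 then f x else (\<integral>y. a t x y * f y \<partial>\<mu>))"

text \<open>Measurability of the kernels is what gives the integrals defining the operators, and the
  integrals of their values, a meaning.\<close>

definition approx_identity :: "('a \<Rightarrow> 'a \<Rightarrow> real) \<Rightarrow> 'a measure \<Rightarrow> ('a \<Rightarrow> real \<Rightarrow> real) \<Rightarrow> real \<Rightarrow> real
    \<Rightarrow> (real \<Rightarrow> real) \<Rightarrow> (real \<Rightarrow> 'a \<Rightarrow> 'a \<Rightarrow> complex) \<Rightarrow> bool" where
  "approx_identity d \<mu> \<phi> M m g a \<longleftrightarrow>
     M > deg_n d \<mu> * (1 + p_index d \<mu> \<phi> / i_index \<phi>) - deg_alpha d \<mu> \<and> 0 < m \<and>
     (\<forall>s\<ge>0. 0 < g s) \<and> bounded (g ` {0..}) \<and> antimono_on {0..} g \<and>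
     ((\<lambda>s. s powr M * g (s powr m)) \<longlongrightarrow> 0) at_top \<and>
     (\<forall>t>0. (\<lambda>(x, y). a t x y) \<in> borel_measurable (\<mu> \<Otimes>\<^sub>M \<mu>)) \<and>
     (\<forall>t>0. \<forall>x y. cmod (a t x y) \<le> h_kernel d \<mu> m g t x y)"

definition assumption_A :: "('a \<Rightarrow> 'a \<Rightarrow> real) \<Rightarrow> 'a measure \<Rightarrow> ('a \<Rightarrow> real \<Rightarrow> real) \<Rightarrow> real \<Rightarrow> real
    \<Rightarrow> (real \<Rightarrow> real) \<Rightarrow> (real \<Rightarrow> 'a \<Rightarrow> 'a \<Rightarrow> complex) \<Rightarrow> bool" where
  "assumption_A d \<mu> \<phi> M m g a \<longleftrightarrow>
     approx_identity d \<mu> \<phi> M m g a \<and>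
     (\<forall>s\<ge>0. \<forall>t\<ge>0. \<forall>f\<in>M_class d \<mu> \<phi> M.
        AE x in \<mu>. A_op \<mu> a t (A_op \<mu> a s f) x = A_op \<mu> a (t + s) f x) \<and>
     M > deg_n d \<mu> + 2 * deg_n d \<mu> * p_index d \<mu> \<phi> / i_index \<phi> + deg_N d \<mu>
         - deg_n d \<mu> * (if r_index d \<mu> \<phi> = \<infinity> then 1
             else (real_of_ereal (r_index d \<mu> \<phi>) - 1) / real_of_ereal (r_index d \<mu> \<phi>))
         - deg_alpha d \<mu>"

definition bmo_norm :: "('a \<Rightarrow> 'a \<Rightarrow> real) \<Rightarrow> 'a measure \<Rightarrow> ('a \<Rightarrow> real \<Rightarrow> real) \<Rightarrow> real
    \<Rightarrow> (real \<Rightarrow> 'a \<Rightarrow> 'a \<Rightarrow> complex) \<Rightarrow> ('a \<Rightarrow> complex) \<Rightarrow> ennreal" where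
  "bmo_norm d \<mu> \<phi> m a f =
     (SUP (x, r)\<in>UNIV \<times> {0<..}.
        (\<integral>\<^sup>+y\<in>qball d x r. ennreal (cmod (f y - A_op \<mu> a (r powr m) f y)) \<partial>\<mu>)
        / luxemburg_norm \<mu> \<phi> (indicator (qball d x r)))"

definition bmo_space :: "('a \<Rightarrow> 'a \<Rightarrow> real) \<Rightarrow> 'a measure \<Rightarrow> ('a \<Rightarrow> real \<Rightarrow> real) \<Rightarrow> real \<Rightarrow> real
    \<Rightarrow> (real \<Rightarrow> 'a \<Rightarrow> 'a \<Rightarrow> complex) \<Rightarrow> ('a \<Rightarrow> complex) set" where
  "bmo_space d \<mu> \<phi> M m a = {f \<in> M_class d \<mu> \<phi> M. bmo_norm d \<mu> \<phi> m a f < \<infinity>}"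

definition osc_set :: "('a \<Rightarrow> 'a \<Rightarrow> real) \<Rightarrow> 'a measure \<Rightarrow> ('a \<Rightarrow> real \<Rightarrow> real) \<Rightarrow> real
    \<Rightarrow> (real \<Rightarrow> 'a \<Rightarrow> 'a \<Rightarrow> complex) \<Rightarrow> ('a \<Rightarrow> complex) \<Rightarrow> 'a \<Rightarrow> real \<Rightarrow> real \<Rightarrow> 'a set" where
  "osc_set d \<mu> \<phi> m a f x r l =
     {y \<in> qball d x r. cmod (f y - A_op \<mu> a (r powr m) f y)
        / \<phi> y (inverse (chi_norm \<mu> \<phi> (qball d x r))) > l}"

end

theory Submission
  imports Defs
begin

text \<open>
  Write \<open>w = \<phi>(\<cdot>, t)\<close> and \<open>F\<^sub>r = \<bar>f - A\<^bsub>r\<^sup>m\<^esub> f\<bar>\<close>.  By the upper type of \<open>\<phi>\<close>, \<open>t \<parallel>\<chi>\<^sub>B\<parallel>\<close> is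
  bounded by a multiple of \<open>w(B)\<close> whenever \<open>t \<parallel>\<chi>\<^sub>B\<parallel> \<le> 1\<close>, so on all relevant balls \<open>f\<close> has
  \<open>w\<close>-weighted mean oscillation at most a multiple of \<open>K = \<parallel>f\<parallel> / t\<close>.  Stop at the maximal balls \<open>B\<^sub>i\<close> on
  which the \<open>w\<close>-average of \<open>F\<^sub>R\<close> exceeds \<open>\<beta> K\<close>: off these balls \<open>F\<^sub>R \<le> \<beta> K w\<close> by Lebesgue
  differentiation, their total \<open>w\<close>-mass is at most half of \<open>w(B)\<close>, and on \<open>B\<^sub>i\<close> the semigroup identity
  \<open>A\<^sub>s f - A\<^sub>t f = A\<^sub>s (f - A\<^sub>t f) - A\<^sub>t (f - A\<^sub>s f)\<close> bounds \<open>F\<^sub>R - F\<^bsub>r\<^sub>i\<^esub>\<close> by a multiple of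
  \<open>K (w(B\<^sub>i)/\<mu>(B\<^sub>i) + w(B)/\<mu>(B))\<close>.  Iterating bounds the integral of \<open>F\<^sub>R\<close> over any \<open>E \<subseteq> B\<close>; the
  Muckenhoupt condition turns \<open>w(B) \<mu>(E)/\<mu>(B)\<close> into \<open>s w(B) + C s\<^bsup>1-p\<^esup> w(E)\<close> for every \<open>s > 0\<close>.  With
  \<open>E\<close> the level set at height \<open>\<lambda>\<close> and \<open>s\<close> depending on the generation, \<open>p = 1\<close> gives exponential decay
  and \<open>p > 1\<close> decay of order \<open>p'\<close>.
\<close>

text \<open>Norms of characteristic functions are not additive over disjoint balls, whereas the
  masses of one fixed weight are. Hence t is fixed once, as the reciprocal of the norm of the double
  ball \<open>qball d x (2 * C1 * R)\<close>; by monotonicity of the norm the condition on t then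
  holds for every ball inside it, and the double balls of all selected balls stay inside. The second
  obstacle is that the corrections between generations are averages of w, and for p > 1 an average
  is not dominated by w pointwise. The iteration therefore runs on integrals over an arbitrary
  measurable set E, where a correction enters as an average times \<mu>(E), which is what the
  Muckenhoupt condition controls. The halving of mass makes the terms with s w(B) summable; the
  terms with w(E) have no such gain, so for p > 1 they are made summable by letting s grow with the
  generation. Kernel tails converge because norms grow under dilation with an exponent n p / i,
  which can be taken below the decay order M.\<close>

locale doubling_space =
  fixes d :: "'a \<Rightarrow> 'a \<Rightarrow> real" and \<mu> :: "'a measure" and C1 cD n :: real
  assumes d_nonneg: "0 \<le> d x y"
    and d_eq_0: "d x y = 0 \<longleftrightarrow> x = y"
    and d_sym: "d x y = d y x"
    and C1_ge_1: "1 \<le> C1"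
    and d_triangle: "d x y \<le> C1 * (d x z + d z y)"
    and space_UNIV: "space \<mu> = UNIV"
    and sets_qopen: "sets \<mu> = sigma_sets UNIV {U. qopen d U}"
    and ball_sets: "qball d x r \<in> sets \<mu>"
    and ball_pos: "0 < r \<Longrightarrow> 0 < emeasure \<mu> (qball d x r)"
    and ball_finite: "emeasure \<mu> (qball d x r) < \<infinity>"
    \<comment> \<open>\<open>n\<close> is any exponent admissible in \<open>cond_D\<close>; the
      infimum \<open>deg_n\<close> itself need not be admissible.\<close>
    and cD_pos: "0 < cD" and n_pos: "0 < n"
    and doubling: "0 < r \<Longrightarrow> 1 \<le> l \<Longrightarrow>
      measure \<mu> (qball d x (l * r)) \<le> cD * l powr n * measure \<mu> (qball d x r)"
begin

abbreviation vol :: "'a \<Rightarrow> real \<Rightarrow> real" where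
  "vol x r \<equiv> measure \<mu> (qball d x r)"

lemma qball_mono: "r \<le> s \<Longrightarrow> qball d x r \<subseteq> qball d x s"
  by (auto simp: qball_def)

lemma center_in_qball: "0 < r \<Longrightarrow> x \<in> qball d x r"
  using d_eq_0[of x x] by (simp add: qball_def)

lemma qball_subset_qball:
  assumes "x \<in> qball d y s" "C1 * (r + s) \<le> u"
  shows "qball d x r \<subseteq> qball d y u"
proof
  fix z assume "z \<in> qball d x r"
  then have "d z x + d x y < r + s"
    using assms by (auto simp: qball_def)
  then have "C1 * (d z x + d x y) < C1 * (r + s)"
    using C1_ge_1 by simp
  then show "z \<in> qball d y u"
    using d_triangle[of z y x] assms(2) by (auto simp: qball_def)
qed

lemma measure_ball_pos: "0 < r \<Longrightarrow> 0 < vol x r"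
  using ball_pos[of r x] ball_finite[of x r]
  by (simp add: measure_def enn2real_positive_iff)

lemma emeasure_ball: "emeasure \<mu> (qball d x r) = ennreal (vol x r)"
  using ball_finite[of x r] by (simp add: emeasure_eq_ennreal_measure less_top[symmetric])

lemma UNIV_sets: "UNIV \<in> sets \<mu>"
  using sets.top[of \<mu>] space_UNIV by simp

lemma qopen_sets: "qopen d U \<Longrightarrow> U \<in> sets \<mu>"
  unfolding sets_qopen by (auto intro: sigma_sets.Basic)

text \<open>Needed for the measurability of \<open>A_op\<close> in its free variable, which is an
  integral with a parameter.\<close>

lemma sigma_finite: "sigma_finite_measure \<mu>"
proof
  obtain z :: 'a where True by simp
  have "(\<Union>i. qball d z (real i)) = UNIV"
    using reals_Archimedean2 by (auto simp: qball_def)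
  then show "\<exists>A. countable A \<and> A \<subseteq> sets \<mu> \<and> \<Union> A = space \<mu> \<and> (\<forall>a\<in>A. emeasure \<mu> a \<noteq> \<infinity>)"
    using ball_finite ball_sets space_UNIV
    by (intro exI[of _ "range (\<lambda>i. qball d z (real i))"]) (auto simp: less_top[symmetric])
qed

section \<open>Coverings\<close>

text \<open>The radii are bounded, so all balls lie in one ball of finite measure. Their measures
  are therefore summable, and a summable family has only countably many nonzero terms.\<close>

lemma countable_disjoint_balls:
  assumes "X \<subseteq> qball d z T" "\<And>y. y \<in> X \<Longrightarrow> 0 < r y \<and> r y \<le> R"
    and "disjoint_family_on (\<lambda>y. qball d y (r y)) X"
  shows "countable X"
proof -
  let ?B = "qball d z (C1 * (R + T))"
  let ?m = "\<lambda>y. vol y (r y)"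
  have sub: "qball d y (r y) \<subseteq> ?B" if "y \<in> X" for y
    using that assms(1,2) C1_ge_1 by (intro qball_subset_qball[of _ _ T]) auto
  have "?m summable_on X"
  proof (rule nonneg_bdd_above_summable_on)
    have "sum ?m F \<le> measure \<mu> ?B" if F: "finite F" "F \<subseteq> X" for F
    proof -
      have "sum ?m F = measure \<mu> (\<Union>y\<in>F. qball d y (r y))"
        using F disjoint_family_on_mono[OF F(2) assms(3)] ball_sets ball_finite
        by (intro measure_finite_Union[symmetric]) (auto simp: less_top[symmetric])
      also have "\<dots> \<le> measure \<mu> ?B"
        using F sub ball_sets ball_finite
        by (intro measure_mono_fmeasurable) (auto simp: fmeasurable_def)
      finally show ?thesis .
    qed
    then show "bdd_above (sum ?m ` {F. F \<subseteq> X \<and> finite F})"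
      by (auto simp: bdd_above_def)
  qed simp
  then have "countable {y\<in>X. ?m y \<noteq> 0}"
    by (rule summable_countable_real)
  moreover have "{y\<in>X. ?m y \<noteq> 0} = X"
    using measure_ball_pos assms(2) by (auto simp: less_le)
  ultimately show ?thesis by simp
qed

text \<open>Zorn's lemma is applied to disjoint subfamilies such that every ball meeting the subfamily
  meets a member that is at least as large.\<close>

lemma vitali_selection:
  fixes k :: "'a \<Rightarrow> nat"
  assumes "0 < R"
  shows "\<exists>X\<subseteq>S. disjoint_family_on (\<lambda>y. qball d y (R / 2 ^ k y)) X \<and>
      S \<subseteq> (\<Union>y\<in>X. qball d y (2 * C1 * (R / 2 ^ k y)))"
proof -
  define B where "B = (\<lambda>y. qball d y (R / 2 ^ k y))"
  define good where "good = (\<lambda>X. X \<subseteq> S \<and> disjoint_family_on B X \<and>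
    (\<forall>x\<in>S. (\<exists>y\<in>X. B x \<inter> B y \<noteq> {}) \<longrightarrow> (\<exists>y\<in>X. B x \<inter> B y \<noteq> {} \<and> k y \<le> k x)))"
  have "\<exists>X\<in>Collect good. \<forall>Y\<in>Collect good. X \<subseteq> Y \<longrightarrow> Y = X"
  proof (rule subset_Zorn_nonempty)
    have "good {}"
      by (simp add: good_def disjoint_family_on_def)
    then show "Collect good \<noteq> {}" by blast
    fix \<C> assume \<C>: "\<C> \<noteq> {}" "subset.chain (Collect good) \<C>"
    then have g: "good X" if "X \<in> \<C>" for X
      using that by (auto simp: subset.chain_def)
    have "disjoint_family_on B (\<Union>\<C>)"
      unfolding disjoint_family_on_def
    proof clarify
      fix x y X Y assume xy: "x \<in> X" "X \<in> \<C>" "y \<in> Y" "Y \<in> \<C>" "x \<noteq> y"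
      have "X \<subseteq> Y \<or> Y \<subseteq> X"
        using \<C>(2) xy(2,4) unfolding subset_chain_def by blast
      then obtain Z where "Z \<in> \<C>" "x \<in> Z" "y \<in> Z"
        using xy(1-4) by blast
      with g[OF \<open>Z \<in> \<C>\<close>] xy show "B x \<inter> B y = {}"
        unfolding good_def disjoint_family_on_def by blast
    qed
    moreover have "\<forall>x\<in>S. (\<exists>y\<in>\<Union>\<C>. B x \<inter> B y \<noteq> {}) \<longrightarrow> (\<exists>y\<in>\<Union>\<C>. B x \<inter> B y \<noteq> {} \<and> k y \<le> k x)"
    proof (intro ballI impI)
      fix x assume x: "x \<in> S" "\<exists>y\<in>\<Union>\<C>. B x \<inter> B y \<noteq> {}"
      then obtain X where "X \<in> \<C>" "\<exists>y\<in>X. B x \<inter> B y \<noteq> {}" by blast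
      then show "\<exists>y\<in>\<Union>\<C>. B x \<inter> B y \<noteq> {} \<and> k y \<le> k x"
        using g[OF \<open>X \<in> \<C>\<close>] x(1) unfolding good_def by blast
    qed
    moreover have "\<Union>\<C> \<subseteq> S"
      using g unfolding good_def by blast
    ultimately show "\<Union>\<C> \<in> Collect good"
      by (simp add: good_def)
  qed
  then obtain X where X: "good X" and max: "\<And>Y. good Y \<Longrightarrow> X \<subseteq> Y \<Longrightarrow> Y = X"
    by blast
  have meets: "\<exists>y\<in>X. B x \<inter> B y \<noteq> {}" if "x \<in> S" for x
  proof (rule ccontr)
    define free where "free = (\<lambda>x. x \<in> S \<and> (\<forall>y\<in>X. B x \<inter> B y = {}))"
    assume "\<not> ?thesis"
    then have "free x" using that by (auto simp: free_def)
    \<comment> \<open>Levels are natural numbers, so among the balls that miss \<open>X\<close>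
      there is one of least level, that is, of largest radius. Adding it keeps \<open>good\<close>:
      every other free ball that meets the enlarged family meets this one, which is at least as
      large.\<close>
    define u where "u = arg_min k free"
    have u: "free u" "\<And>v. free v \<Longrightarrow> k u \<le> k v"
      unfolding u_def using \<open>free x\<close> by (auto intro: arg_min_natI arg_min_nat_le)
    have "good (insert u X)"
      unfolding good_def
    proof (intro conjI ballI impI)
      show "insert u X \<subseteq> S" using X u by (auto simp: good_def free_def)
      show "disjoint_family_on B (insert u X)"
        using X u by (auto simp: good_def free_def disjoint_family_on_def)
      fix v assume v: "v \<in> S" "\<exists>y\<in>insert u X. B v \<inter> B y \<noteq> {}"
      show "\<exists>y\<in>insert u X. B v \<inter> B y \<noteq> {} \<and> k y \<le> k v"
      proof (cases "free v")
        case True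
        then show ?thesis using v u by (auto simp: free_def)
      next
        case False
        then show ?thesis using v X by (auto simp: free_def good_def)
      qed
    qed
    then have "u \<in> X" using max by blast
    moreover have "u \<in> B u"
      unfolding B_def using assms by (intro center_in_qball) simp
    ultimately show False using u by (auto simp: free_def)
  qed
  \<comment> \<open>Only the centre \<open>x\<close>, not its whole ball, has to be covered; this is
    why the dilation factor is just \<open>2 * C1\<close>.\<close>
  have "x \<in> (\<Union>y\<in>X. qball d y (2 * C1 * (R / 2 ^ k y)))" if x: "x \<in> S" for x
  proof -
    obtain y where y: "y \<in> X" "B x \<inter> B y \<noteq> {}" "k y \<le> k x"
      using X meets[OF x] x unfolding good_def by blast
    then obtain z where z: "d z x < R / 2 ^ k x" "d z y < R / 2 ^ k y"
      by (auto simp: B_def qball_def)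
    have "R / 2 ^ k x \<le> R / 2 ^ k y"
      using y assms by (intro divide_left_mono power_increasing) auto
    then have "d x z + d z y < 2 * (R / 2 ^ k y)"
      using z d_sym[of x z] by linarith
    then have "C1 * (d x z + d z y) < C1 * (2 * (R / 2 ^ k y))"
      using C1_ge_1 by (intro mult_strict_left_mono) auto
    also have "\<dots> = 2 * C1 * (R / 2 ^ k y)" by simp
    finally have "d x y < 2 * C1 * (R / 2 ^ k y)"
      using d_triangle[of x y z] by linarith
    then show ?thesis using y by (auto simp: qball_def)
  qed
  then show ?thesis
    using X unfolding good_def B_def by blast
qed

text \<open>Removing from each dilated ball those that precede it in an enumeration of
  \<open>X\<close> makes the cover disjoint. Integrals over \<open>S\<close> can then be split
  without an overlap constant, while the undilated balls remain available for packing
  arguments.\<close>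

lemma vitali_partition:
  fixes k :: "'a \<Rightarrow> nat"
  assumes R: "0 < R" and S: "S \<subseteq> qball d z T"
  shows "\<exists>X P. countable X \<and> X \<subseteq> S \<and> disjoint_family_on (\<lambda>y. qball d y (R / 2 ^ k y)) X \<and>
    S \<subseteq> (\<Union>y\<in>X. P y) \<and> disjoint_family_on P X \<and> (\<forall>y. P y \<in> sets \<mu>) \<and>
    (\<forall>y. P y \<subseteq> qball d y (2 * C1 * (R / 2 ^ k y)))"
proof -
  let ?D = "\<lambda>y. qball d y (2 * C1 * (R / 2 ^ k y))"
  obtain X where X: "X \<subseteq> S" "disjoint_family_on (\<lambda>y. qball d y (R / 2 ^ k y)) X"
      "S \<subseteq> (\<Union>y\<in>X. ?D y)"
    using vitali_selection[OF R, of S k] by blast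
  have "R / 2 ^ k y \<le> R" for y
    using R by (simp add: divide_le_eq mult_le_cancel_left1)
  then have cX: "countable X"
    using X S R by (intro countable_disjoint_balls[of X z T "\<lambda>y. R / 2 ^ k y" R]) auto
  define P where "P = (\<lambda>y. ?D y - (\<Union>v\<in>{v\<in>X. to_nat_on X v < to_nat_on X y}. ?D v))"
  show ?thesis
  proof (intro exI conjI)
    show "countable X" "X \<subseteq> S" "disjoint_family_on (\<lambda>y. qball d y (R / 2 ^ k y)) X" by fact+
    show "\<forall>y. P y \<in> sets \<mu>"
      unfolding P_def using cX ball_sets by (intro allI sets.Diff sets.countable_UN') auto
    show "\<forall>y. P y \<subseteq> ?D y"
      by (auto simp: P_def)
    show "disjoint_family_on P X"
      unfolding disjoint_family_on_def
    proof (intro ballI impI)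
      fix u v assume uv: "u \<in> X" "v \<in> X" "u \<noteq> v"
      then have "to_nat_on X u < to_nat_on X v \<or> to_nat_on X v < to_nat_on X u"
        using cX by (metis inj_on_to_nat_on inj_on_contraD linorder_neqE_nat)
      then show "P u \<inter> P v = {}"
        using uv by (auto simp: P_def)
    qed
    show "S \<subseteq> (\<Union>y\<in>X. P y)"
    proof
      fix x assume "x \<in> S"
      define H where "H = (\<lambda>y. y \<in> X \<and> x \<in> ?D y)"
      have "\<exists>y. H y" using X(3) \<open>x \<in> S\<close> by (auto simp: H_def)
      define u where "u = arg_min (to_nat_on X) H"
      have u: "H u" "\<And>v. H v \<Longrightarrow> to_nat_on X u \<le> to_nat_on X v"
        unfolding u_def using \<open>\<exists>y. H y\<close> by (auto intro: arg_min_natI arg_min_nat_le)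
      then have "x \<in> P u"
        by (fastforce simp: P_def H_def not_less[symmetric])
      then show "x \<in> (\<Union>y\<in>X. P y)"
        using u by (auto simp: H_def)
    qed
  qed
qed

lemma emeasure_disjoint_le:
  assumes "countable X" "disjoint_family_on Q X" "\<And>y. y \<in> X \<Longrightarrow> Q y \<in> sets \<nu>"
    and "\<And>y. y \<in> X \<Longrightarrow> Q y \<subseteq> A" "A \<in> sets \<nu>"
  shows "(\<integral>\<^sup>+y. emeasure \<nu> (Q y) \<partial>count_space X) \<le> emeasure \<nu> A"
proof -
  have "(\<integral>\<^sup>+y. emeasure \<nu> (Q y) \<partial>count_space X) = emeasure \<nu> (\<Union>y\<in>X. Q y)"
    using assms by (intro emeasure_UN_countable[symmetric]) auto
  also have "\<dots> \<le> emeasure \<nu> A"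
    using assms by (intro emeasure_mono) auto
  finally show ?thesis .
qed

section \<open>Regularity and differentiation\<close>

text \<open>Balls of a quasi-metric need not be open, but the points having some ball inside the
  given one form an open set: by the quasi-triangle inequality a radius \<open>s\<close> at such a
  point leaves \<open>s / (2 * C1)\<close> for its neighbours.\<close>

lemma qopen_nhd:
  assumes "0 < r"
  shows "\<exists>U. qopen d U \<and> x \<in> U \<and> U \<subseteq> qball d x r"
proof (intro exI conjI)
  let ?U = "{y. \<exists>s>0. qball d y s \<subseteq> qball d x r}"
  show "x \<in> ?U" using assms by blast
  show "?U \<subseteq> qball d x r" using center_in_qball by blast
  show "qopen d ?U"
    unfolding qopen_def
  proof
    fix y assume "y \<in> ?U"
    then obtain s where s: "0 < s" "qball d y s \<subseteq> qball d x r" by blast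
    let ?s = "s / (2 * C1)"
    have "0 < ?s" using s C1_ge_1 by simp
    moreover have "qball d y ?s \<subseteq> ?U"
    proof
      fix z assume "z \<in> qball d y ?s"
      moreover have "C1 * (?s + ?s) \<le> s" using C1_ge_1 by (simp add: field_simps)
      ultimately have "qball d z ?s \<subseteq> qball d x r"
        using qball_subset_qball[of z y ?s ?s s] s(2) by blast
      then show "z \<in> ?U" using \<open>0 < ?s\<close> by blast
    qed
    ultimately show "\<exists>r>0. qball d y r \<subseteq> ?U" by blast
  qed
qed

lemma qopen_Union: "(\<And>U. U \<in> \<U> \<Longrightarrow> qopen d U) \<Longrightarrow> qopen d (\<Union>\<U>)"
  unfolding qopen_def by (meson Union_iff Union_upper order_trans)

lemma qopen_Int: "qopen d U \<Longrightarrow> qopen d V \<Longrightarrow> qopen d (U \<inter> V)"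
  unfolding qopen_def
proof clarify
  fix x assume a: "\<forall>x\<in>U. \<exists>r>0. qball d x r \<subseteq> U" "\<forall>x\<in>V. \<exists>r>0. qball d x r \<subseteq> V" "x \<in> U" "x \<in> V"
  then obtain r s where "0 < r" "qball d x r \<subseteq> U" "0 < s" "qball d x s \<subseteq> V" by blast
  then show "\<exists>r>0. qball d x r \<subseteq> U \<inter> V"
    using qball_mono[of "min r s" r x] qball_mono[of "min r s" s x]
    by (intro exI[of _ "min r s"]) auto
qed

text \<open>Closed sets are G-delta. As balls may fail to be open, \<open>G i\<close> unites the
  open sets contained in balls of radius \<open>1 / real (Suc i)\<close> around points of
  \<open>C\<close>; finite intersections make the sequence decreasing.\<close>

lemma qclosed_nhds:
  assumes "qopen d (- C)"
  obtains U :: "nat \<Rightarrow> 'a set" where "\<And>i. qopen d (U i)" "\<And>i. C \<subseteq> U i" "decseq U" "(\<Inter>i. U i) = C"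
proof -
  define G where "G i = \<Union>{V. qopen d V \<and> (\<exists>x\<in>C. V \<subseteq> qball d x (1 / real (Suc i)))}" for i
  define U where "U i = (\<Inter>j\<le>i. G j)" for i
  have oG: "qopen d (G i)" for i
    unfolding G_def by (rule qopen_Union) auto
  have oU: "qopen d (U i)" for i
    unfolding U_def by (induction i) (auto simp: atMost_Suc oG intro!: qopen_Int)
  have CG: "C \<subseteq> G i" for i
  proof
    fix x assume "x \<in> C"
    obtain V where "qopen d V" "x \<in> V" "V \<subseteq> qball d x (1 / real (Suc i))"
      using qopen_nhd[of "1 / real (Suc i)" x] by auto
    then show "x \<in> G i" using \<open>x \<in> C\<close> by (auto simp: G_def)
  qed
  have "(\<Inter>i. U i) \<subseteq> C"
  proof
    fix y assume y: "y \<in> (\<Inter>i. U i)"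
    show "y \<in> C"
    proof (rule ccontr)
      assume "y \<notin> C"
      then obtain r where r: "0 < r" "qball d y r \<subseteq> - C"
        using assms by (auto simp: qopen_def)
      obtain i where i: "1 / real (Suc i) < r"
        using r(1) nat_approx_posE by blast
      have "y \<in> G i" using y by (auto simp: U_def)
      then obtain x where "x \<in> C" "d y x < 1 / real (Suc i)"
        by (auto simp: G_def qball_def)
      then have "x \<in> qball d y r" using i d_sym[of x y] by (auto simp: qball_def)
      then show False using r \<open>x \<in> C\<close> by blast
    qed
  qed
  moreover have "decseq U"
    unfolding decseq_def U_def by fastforce
  moreover have "C \<subseteq> U i" for i
    using CG by (auto simp: U_def)
  ultimately show ?thesis using oU that by blast
qed

text \<open>The induction over the generated sigma-algebra squeezes \<open>A\<close> between a
  closed and an open set. This two-sided form is stable under complements, which outer approximation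
  alone is not.\<close>

lemma outer_regular:
  assumes \<nu>: "finite_measure \<nu>" "sets \<nu> = sets \<mu>" and A: "A \<in> sets \<mu>" and e: "0 < (e::real)"
  shows "\<exists>U. qopen d U \<and> A \<subseteq> U \<and> emeasure \<nu> (U - A) < e"
proof -
  interpret finite_measure \<nu> by fact
  define reg where "reg = (\<lambda>A. \<forall>e>0. \<exists>C U. qopen d (- C) \<and> qopen d U \<and> C \<subseteq> A \<and> A \<subseteq> U \<and>
    emeasure \<nu> (U - C) < ennreal e)"
  have oS: "U \<in> sets \<nu>" if "qopen d U" for U
    using qopen_sets that \<nu> by auto
  have cS: "C \<in> sets \<nu>" if "qopen d (- C)" for C
    using oS[OF that] UNIV_sets \<nu>(2) sets.Diff[of UNIV \<nu> "- C"] by (simp add: Compl_eq_Diff_UNIV[symmetric])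
  have "A \<in> sigma_sets UNIV {U. qopen d U}"
    using A sets_qopen by simp
  then have "reg A"
  proof (induction rule: sigma_sets.induct)
    case (Basic V)
    show ?case
      unfolding reg_def
    proof (intro allI impI)
      fix e :: real assume e: "0 < e"
      obtain U where U: "\<And>i. qopen d (U i)" "\<And>i. - V \<subseteq> U i" "decseq U" "(\<Inter>i. U i) = - V"
        using qclosed_nhds[of "- V"] Basic by auto
      have "(\<lambda>i. emeasure \<nu> (U i - - V)) \<longlonglongrightarrow> emeasure \<nu> (\<Inter>i. U i - - V)"
      proof (rule Lim_emeasure_decseq)
        show "range (\<lambda>i. U i - - V) \<subseteq> sets \<nu>"
          using U oS cS Basic by auto
        show "decseq (\<lambda>i. U i - - V)"
          using U(3) unfolding decseq_def by blast
      qed simp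
      moreover have "(\<Inter>i. U i - - V) = {}" using U(4) by blast
      ultimately have "(\<lambda>i. emeasure \<nu> (U i - - V)) \<longlonglongrightarrow> 0" by simp
      then have "\<forall>\<^sub>F i in sequentially. emeasure \<nu> (U i - - V) < ennreal e"
        using e by (auto intro: order_tendstoD(2))
      then obtain i where "emeasure \<nu> (U i - - V) < ennreal e"
        by (auto simp: eventually_sequentially)
      moreover have "U i - - V = V - - U i" by blast
      ultimately show "\<exists>C U. qopen d (- C) \<and> qopen d U \<and> C \<subseteq> V \<and> V \<subseteq> U \<and> emeasure \<nu> (U - C) < ennreal e"
        using U Basic by (intro exI[of _ "- U i"] exI[of _ V]) auto
    qed
  next
    case Empty
    have "qopen d {}" "qopen d UNIV" by (auto simp: qopen_def intro: exI[of _ 1])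
    then show ?case unfolding reg_def by (intro allI impI exI[of _ "{}"]) auto
  next
    case (Compl V)
    show ?case
      unfolding reg_def
    proof (intro allI impI)
      fix e :: real assume "0 < e"
      then obtain C U where CU: "qopen d (- C)" "qopen d U" "C \<subseteq> V" "V \<subseteq> U" "emeasure \<nu> (U - C) < ennreal e"
        using Compl unfolding reg_def by blast
      moreover have "- C - - U = U - C" by blast
      ultimately show "\<exists>C U. qopen d (- C) \<and> qopen d U \<and> C \<subseteq> UNIV - V \<and> UNIV - V \<subseteq> U \<and>
          emeasure \<nu> (U - C) < ennreal e"
        by (intro exI[of _ "- U"] exI[of _ "- C"]) auto
    qed
  next
    case (Union V)
    show ?case
      unfolding reg_def
    proof (intro allI impI)
      fix e :: real assume e: "0 < e"
      \<comment> \<open>The errors sum to \<open>e / 2\<close>, which leaves the strict inequality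
        \<open>lt\<close> below.\<close>
      have "\<exists>C U. qopen d (- C) \<and> qopen d U \<and> C \<subseteq> V i \<and> V i \<subseteq> U \<and>
          emeasure \<nu> (U - C) < ennreal (e / 2 * (1/2) ^ Suc i)" for i
        using Union e unfolding reg_def by simp
      then obtain C U where CU: "\<And>i. qopen d (- C i)" "\<And>i. qopen d (U i)" "\<And>i. C i \<subseteq> V i"
          "\<And>i. V i \<subseteq> U i" "\<And>i. emeasure \<nu> (U i - C i) < ennreal (e / 2 * (1/2) ^ Suc i)"
        by metis
      let ?U = "\<Union>i. U i" and ?D = "\<lambda>j. \<Union>i<j. C i"
      have oU: "qopen d ?U" using CU(2) by (auto intro: qopen_Union)
      have cD: "qopen d (- ?D j)" for j
      proof (induction j)
        case 0
        then show ?case by (auto simp: qopen_def intro: exI[of _ 1])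
      next
        case (Suc j)
        then show ?case using CU(1)[of j] qopen_Int by (simp add: lessThan_Suc Int_commute)
      qed
      have mUC: "U i - C j \<in> sets \<nu>" for i j using oS cS CU by auto
      have "emeasure \<nu> (?U - (\<Union>i. C i)) \<le> emeasure \<nu> (\<Union>i. U i - C i)"
        using mUC by (intro emeasure_mono) auto
      also have "\<dots> \<le> (\<Sum>i. emeasure \<nu> (U i - C i))"
        using mUC by (intro emeasure_subadditive_countably) auto
      also have "\<dots> \<le> (\<Sum>i. ennreal (e / 2 * (1/2) ^ Suc i))"
        using CU(5) by (intro suminf_le) (auto intro: less_imp_le)
      also have "\<dots> = ennreal (\<Sum>i. e / 2 * (1/2) ^ Suc i)"
        using e by (intro suminf_ennreal2 summable_mult) (auto intro: summable_mult power_half_series[THEN sums_summable])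
      also have "(\<Sum>i. e / 2 * (1/2::real) ^ Suc i) = e / 2"
        using power_half_series suminf_mult[of "\<lambda>i. (1/2::real) ^ Suc i" "e / 2"]
        by (simp add: sums_iff)
      finally have lt: "emeasure \<nu> (?U - (\<Union>i. C i)) < ennreal e"
        using e by (auto simp: ennreal_lessI intro: le_less_trans)
      \<comment> \<open>A countable union of closed sets need not be closed. Finite unions are, and
        continuity from above for the finite measure \<nu> shows that one of them already
        suffices.\<close>
      have "(\<lambda>j. emeasure \<nu> (?U - ?D j)) \<longlonglongrightarrow> emeasure \<nu> (\<Inter>j. ?U - ?D j)"
      proof (rule Lim_emeasure_decseq)
        show "range (\<lambda>j. ?U - ?D j) \<subseteq> sets \<nu>" using oS[OF oU] cS[OF cD] by auto
        show "decseq (\<lambda>j. ?U - ?D j)" unfolding decseq_def by fastforce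
      qed simp
      moreover have "(\<Inter>j. ?U - ?D j) = ?U - (\<Union>i. C i)" by blast
      ultimately have "(\<lambda>j. emeasure \<nu> (?U - ?D j)) \<longlonglongrightarrow> emeasure \<nu> (?U - (\<Union>i. C i))" by simp
      then have "\<forall>\<^sub>F j in sequentially. emeasure \<nu> (?U - ?D j) < ennreal e"
        using lt by (rule order_tendstoD(2))
      then obtain j where "emeasure \<nu> (?U - ?D j) < ennreal e"
        by (auto simp: eventually_sequentially)
      moreover have "?D j \<subseteq> (\<Union>i. V i)" "(\<Union>i. V i) \<subseteq> ?U" using CU(3,4) by blast+
      ultimately show "\<exists>C U. qopen d (- C) \<and> qopen d U \<and> C \<subseteq> (\<Union>i. V i) \<and> (\<Union>i. V i) \<subseteq> U \<and>
          emeasure \<nu> (U - C) < ennreal e"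
        using oU cD[of j] by blast
    qed
  qed
  then obtain C U where CU: "qopen d (- C)" "qopen d U" "C \<subseteq> A" "A \<subseteq> U" "emeasure \<nu> (U - C) < ennreal e"
    using e unfolding reg_def by blast
  moreover have "emeasure \<nu> (U - A) \<le> emeasure \<nu> (U - C)"
    using CU oS cS by (intro emeasure_mono) auto
  ultimately show ?thesis by (intro exI[of _ U]) auto
qed

lemma ball_radius_bound: "0 < (R::real) \<Longrightarrow> R / 2 ^ k \<le> R"
  by (simp add: divide_le_eq mult_le_cancel_left1)

lemma emeasure_doubling:
  assumes "0 < r" "1 \<le> l"
  shows "emeasure \<mu> (qball d x (l * r)) \<le> ennreal (cD * l powr n) * emeasure \<mu> (qball d x r)"
  using doubling[OF assms, of x] cD_pos
  by (simp add: emeasure_ball ennreal_mult'[symmetric])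

lemma ball_integral_neq_0:
  fixes h :: "'a \<Rightarrow> ennreal"
  assumes "0 < r" "h \<in> borel_measurable \<mu>" "\<And>y. h y \<noteq> 0"
  shows "(\<integral>\<^sup>+y\<in>qball d x r. h y \<partial>\<mu>) \<noteq> 0"
proof
  assume "(\<integral>\<^sup>+y\<in>qball d x r. h y \<partial>\<mu>) = 0"
  moreover have "(\<lambda>y. h y * indicator (qball d x r) y) \<in> borel_measurable \<mu>"
    using assms ball_sets by auto
  ultimately have "AE y in \<mu>. h y * indicator (qball d x r) y = 0"
    by (simp add: nn_integral_0_iff_AE)
  then have "AE y in \<mu>. y \<notin> qball d x r"
    by eventually_elim (use assms(3) in \<open>auto simp: indicator_def split: if_splits\<close>)
  then have "emeasure \<mu> (qball d x r) = 0"
    using ball_sets by (subst (asm) AE_iff_measurable[OF ball_sets]) (auto simp: space_UNIV)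
  then show False using ball_pos[OF assms(1), of x] by simp
qed

text \<open>A one-sided substitute for Lebesgue differentiation that uses neither maximal functions
  nor density of continuous functions. If \<open>H\<close> exceeds \<open>w\<close> by
  \<open>e\<close> on a set \<open>Z\<close>, then on balls centred in \<open>Z\<close> the excess
  over \<open>Z\<close> must be paid for by the mass of \<open>w\<close> outside \<open>Z\<close>.
  By outer regularity these balls can be chosen in an open set in which the part outside
  \<open>Z\<close> is negligible, and a Vitali cover gives \<mu>(Z) = 0.\<close>

lemma ball_domination_AE:
  fixes H w :: "'a \<Rightarrow> real"
  assumes [measurable]: "H \<in> borel_measurable \<mu>" "w \<in> borel_measurable \<mu>" "E \<in> sets \<mu>"
    and w: "\<And>x. 0 \<le> w x" "\<And>x r. (\<integral>\<^sup>+y\<in>qball d x r. ennreal (w y) \<partial>\<mu>) < \<infinity>"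
    and R: "0 < R" and E: "E \<subseteq> qball d z T"
    and le: "\<And>y k. y \<in> E \<Longrightarrow> (\<integral>\<^sup>+v\<in>qball d y (R / 2 ^ k). ennreal (H v) \<partial>\<mu>)
      \<le> (\<integral>\<^sup>+v\<in>qball d y (R / 2 ^ k). ennreal (w v) \<partial>\<mu>)"
  shows "AE y in \<mu>. y \<in> E \<longrightarrow> H y \<le> w y"
proof -
  have null: "emeasure \<mu> {y\<in>E. w y + e \<le> H y} = 0" if e: "0 < e" for e :: real
  proof -
    define Z where "Z = {y\<in>E. w y + e \<le> H y}"
    have "Z = {y\<in>space \<mu>. y \<in> E \<and> w y + e \<le> H y}" by (simp add: Z_def space_UNIV)
    then have Zs[measurable]: "Z \<in> sets \<mu>" by simp
    define W where "W = density \<mu> (\<lambda>y. ennreal (w y))"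
    have W: "emeasure W A = (\<integral>\<^sup>+y\<in>A. ennreal (w y) \<partial>\<mu>)" if "A \<in> sets \<mu>" for A
      unfolding W_def using that by (simp add: emeasure_density)
    define K where "K = qball d z (C1 * (R + T))"
    have [measurable]: "K \<in> sets \<mu>" unfolding K_def by (rule ball_sets)
    \<comment> \<open>The density \<open>w + e\<close> lets one small number control both the weight
      and \<mu> outside \<open>Z\<close>. The cut-off to \<open>K\<close>, which contains all balls
      that will be selected, makes \<nu> finite.\<close>
    define \<nu> where "\<nu> = density \<mu> (\<lambda>y. ennreal (w y + e) * indicator K y)"
    have \<nu>: "emeasure \<nu> A = emeasure W A + ennreal e * emeasure \<mu> A" if A: "A \<in> sets \<mu>" "A \<subseteq> K" for A
    proof -
      have "emeasure \<nu> A = (\<integral>\<^sup>+y. ennreal (w y + e) * indicator K y * indicator A y \<partial>\<mu>)"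
        unfolding \<nu>_def using A by (simp add: emeasure_density)
      also have "\<dots> = (\<integral>\<^sup>+y. ennreal (w y) * indicator A y + ennreal e * indicator A y \<partial>\<mu>)"
        using A e w by (intro nn_integral_cong) (auto simp: indicator_def ennreal_plus)
      also have "\<dots> = emeasure W A + ennreal e * emeasure \<mu> A"
        using A by (simp add: nn_integral_add W nn_integral_cmult_indicator)
      finally show ?thesis .
    qed
    have "emeasure \<nu> (space \<nu>) = (\<integral>\<^sup>+y. ennreal (w y + e) * indicator K y \<partial>\<mu>)"
      unfolding \<nu>_def using UNIV_sets by (subst emeasure_density) (auto simp: space_UNIV)
    also have "\<dots> = emeasure \<nu> K"
      unfolding \<nu>_def by (subst emeasure_density) (auto intro!: nn_integral_cong simp: indicator_def)
    also have "\<dots> < \<infinity>"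
      using w(2) ball_finite unfolding K_def
      by (subst \<nu>) (auto simp: K_def ball_sets W ennreal_mult_less_top)
    finally have fin: "finite_measure \<nu>" by (intro finite_measureI) simp
    have sets\<nu>: "sets \<nu> = sets \<mu>" by (simp add: \<nu>_def)
    define C where "C = cD * (2 * C1) powr n"
    have C: "0 < C" using cD_pos C1_ge_1 by (simp add: C_def)
    have bound: "ennreal e * emeasure \<mu> Z \<le> ennreal C * ennreal \<delta>" if \<delta>: "0 < \<delta>" for \<delta>
    proof -
      obtain U where U: "qopen d U" "Z \<subseteq> U" "emeasure \<nu> (U - Z) < \<delta>"
        using outer_regular[OF fin sets\<nu> Zs \<delta>] by blast
      have "\<exists>k. qball d y (R / 2 ^ k) \<subseteq> U" if "y \<in> Z" for y
      proof -
        have "y \<in> U" using U(2) that by blast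
        then obtain r where r: "0 < r" "qball d y r \<subseteq> U"
          using bspec[OF U(1)[unfolded qopen_def], of y] by metis
        obtain k where "(1/2) ^ k < r / R"
          using real_arch_pow_inv[of "r / R" "1/2"] r R by auto
        then have "R / 2 ^ k \<le> r" using R by (simp add: field_simps)
        then show ?thesis using qball_mono r(2) by blast
      qed
      then obtain k where k: "\<And>y. y \<in> Z \<Longrightarrow> qball d y (R / 2 ^ k y) \<subseteq> U" by metis
      have ZE: "Z \<subseteq> qball d z T" using E by (auto simp: Z_def)
      define b where "b = (\<lambda>y. qball d y (R / 2 ^ k y))"
      obtain X P where X: "countable X" "X \<subseteq> Z" "disjoint_family_on b X"
          "Z \<subseteq> (\<Union>y\<in>X. P y)" "disjoint_family_on P X" "\<forall>y. P y \<in> sets \<mu>"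
          "\<forall>y. P y \<subseteq> qball d y (2 * C1 * (R / 2 ^ k y))"
        using vitali_partition[OF R ZE, of k] unfolding b_def by blast
      have bs[measurable]: "b y \<in> sets \<mu>" for y unfolding b_def by (rule ball_sets)
      have bK: "b y \<subseteq> K" if "y \<in> Z" for y
        unfolding b_def K_def using that ZE ball_radius_bound[OF R, of "k y"] C1_ge_1
        by (intro qball_subset_qball[of _ _ T]) auto
      have main: "ennreal e * emeasure \<mu> (b y) \<le> emeasure \<nu> (b y - Z)" if y: "y \<in> Z" for y
      proof -
        have "ennreal e * emeasure \<mu> (b y \<inter> Z) + emeasure W (b y \<inter> Z)
            = (\<integral>\<^sup>+v. ennreal (w v + e) * indicator (b y \<inter> Z) v \<partial>\<mu>)"
        proof -
          have "(\<integral>\<^sup>+v. ennreal (w v + e) * indicator (b y \<inter> Z) v \<partial>\<mu>) =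
            (\<integral>\<^sup>+v. ennreal (w v) * indicator (b y \<inter> Z) v + ennreal e * indicator (b y \<inter> Z) v \<partial>\<mu>)"
            using e w by (intro nn_integral_cong) (auto simp: indicator_def ennreal_plus)
          also have "\<dots> = ennreal e * emeasure \<mu> (b y \<inter> Z) + emeasure W (b y \<inter> Z)"
            by (simp add: nn_integral_add W nn_integral_cmult_indicator add.commute)
          finally show ?thesis by simp
        qed
        also have "\<dots> \<le> (\<integral>\<^sup>+v\<in>b y. ennreal (H v) \<partial>\<mu>)"
          by (intro nn_integral_mono) (auto simp: indicator_def Z_def intro!: ennreal_leI)
        also have "\<dots> \<le> emeasure W (b y)"
          using le[of y "k y"] y by (simp add: W Z_def b_def ball_sets)
        also have "emeasure W (b y) = emeasure W (b y - Z) + emeasure W (b y \<inter> Z)"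
          by (subst plus_emeasure) (auto simp: W_def Un_commute intro!: arg_cong[where f="emeasure _"])
        finally have "ennreal e * emeasure \<mu> (b y \<inter> Z) + emeasure W (b y \<inter> Z)
            \<le> emeasure W (b y - Z) + emeasure W (b y \<inter> Z)" .
        \<comment> \<open>Finiteness is what allows this mass to be cancelled from both sides in
          \<open>ennreal\<close>.\<close>
        moreover have "emeasure W (b y \<inter> Z) < \<infinity>"
        proof (rule le_less_trans)
          show "emeasure W (b y \<inter> Z) \<le> emeasure W (b y)"
            by (rule emeasure_mono) (auto simp: W_def)
          show "emeasure W (b y) < \<infinity>" using w(2) by (simp add: W) (simp add: b_def)
        qed
        ultimately have 1: "ennreal e * emeasure \<mu> (b y \<inter> Z) \<le> emeasure W (b y - Z)"
          using ennreal_add_left_cancel_le[of "emeasure W (b y \<inter> Z)"]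
          by (simp add: add.commute less_top[symmetric])
        have "emeasure \<mu> (b y) = emeasure \<mu> (b y \<inter> Z) + emeasure \<mu> (b y - Z)"
          by (subst plus_emeasure) (auto intro!: arg_cong[where f="emeasure _"])
        then have "ennreal e * emeasure \<mu> (b y) =
            ennreal e * emeasure \<mu> (b y \<inter> Z) + ennreal e * emeasure \<mu> (b y - Z)"
          by (simp add: distrib_left)
        also have "\<dots> \<le> emeasure \<nu> (b y - Z)"
          using 1 bK[OF y] by (subst \<nu>) (auto intro: add_right_mono)
        finally show ?thesis .
      qed
      have "emeasure \<mu> Z \<le> emeasure \<mu> (\<Union>y\<in>X. P y)"
        using X by (intro emeasure_mono) auto
      also have "\<dots> = (\<integral>\<^sup>+y. emeasure \<mu> (P y) \<partial>count_space X)"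
        using X by (intro emeasure_UN_countable) auto
      also have "\<dots> \<le> (\<integral>\<^sup>+y. ennreal C * emeasure \<mu> (b y) \<partial>count_space X)"
      proof (rule nn_integral_mono)
        fix y
        have "emeasure \<mu> (P y) \<le> emeasure \<mu> (qball d y (2 * C1 * (R / 2 ^ k y)))"
          using X by (intro emeasure_mono ball_sets) auto
        also have "\<dots> \<le> ennreal C * emeasure \<mu> (b y)"
          using emeasure_doubling[of "R / 2 ^ k y" "2 * C1" y] R C1_ge_1 by (simp add: b_def C_def)
        finally show "emeasure \<mu> (P y) \<le> ennreal C * emeasure \<mu> (b y)" .
      qed
      finally have "ennreal e * emeasure \<mu> Z \<le> ennreal e * (\<integral>\<^sup>+y. ennreal C * emeasure \<mu> (b y) \<partial>count_space X)"
        by (rule mult_left_mono) simp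
      also have "\<dots> = ennreal C * (\<integral>\<^sup>+y. ennreal e * emeasure \<mu> (b y) \<partial>count_space X)"
        by (simp add: nn_integral_cmult mult.left_commute)
      also have "\<dots> \<le> ennreal C * (\<integral>\<^sup>+y. emeasure \<nu> (b y - Z) \<partial>count_space X)"
        using X main by (intro mult_left_mono nn_integral_mono) auto
      also have "\<dots> \<le> ennreal C * emeasure \<nu> (U - Z)"
      proof (intro mult_left_mono emeasure_disjoint_le)
        show "disjoint_family_on (\<lambda>y. b y - Z) X"
          using X(3) by (fastforce simp: disjoint_family_on_def)
        show "b y - Z \<subseteq> U - Z" if "y \<in> X" for y
          using k[of y] that X(2) by (auto simp: b_def)
        show "U - Z \<in> sets \<nu>" using qopen_sets[OF U(1)] by (auto simp: sets\<nu>)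
      qed (use X in \<open>auto simp: sets\<nu>\<close>)
      also have "\<dots> \<le> ennreal C * ennreal \<delta>"
        using U by (intro mult_left_mono) auto
      finally show ?thesis .
    qed
    have "ennreal e * emeasure \<mu> Z \<le> 0"
    proof (rule ennreal_le_epsilon)
      fix \<eta> :: real assume "0 < \<eta>"
      then have "ennreal e * emeasure \<mu> Z \<le> ennreal C * ennreal (\<eta> / C)"
        using C by (intro bound) simp
      also have "\<dots> = ennreal \<eta>"
        using C \<open>0 < \<eta>\<close> by (simp add: ennreal_mult'[symmetric])
      finally show "ennreal e * emeasure \<mu> Z \<le> 0 + ennreal \<eta>" by simp
    qed
    then show ?thesis using e by (simp add: Z_def[symmetric])
  qed
  have "AE y in \<mu>. \<forall>j. \<not> (y \<in> E \<and> w y + 1 / real (Suc j) \<le> H y)"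
    unfolding AE_all_countable
  proof
    fix j
    show "AE y in \<mu>. \<not> (y \<in> E \<and> w y + 1 / real (Suc j) \<le> H y)"
      using null[of "1 / real (Suc j)"] by (subst AE_iff_measurable[OF _ refl]) (auto simp: space_UNIV)
  qed
  then show ?thesis
  proof eventually_elim
    case (elim y)
    show ?case
    proof (intro impI leI notI)
      assume "y \<in> E" "w y < H y"
      then have "0 < H y - w y" by simp
      then obtain j where "1 / real (Suc j) < H y - w y" by (rule nat_approx_posE)
      then show False using elim[rule_format, of j] \<open>y \<in> E\<close> by auto
    qed
  qed
qed

end

text \<open>The Muckenhoupt condition enters only through finiteness of masses on balls and
  \<open>mass_compare\<close>; this form has no dual weight, and doubling of the weights follows
  from it.\<close>

locale growth_space = doubling_space +
  fixes \<phi> :: "'a \<Rightarrow> real \<Rightarrow> real" and cU cL iL cA p :: real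
  assumes phi_measurable: "0 \<le> t \<Longrightarrow> (\<lambda>x. \<phi> x t) \<in> borel_measurable \<mu>"
    and phi_zero: "\<phi> x 0 = 0"
    and phi_pos: "0 < t \<Longrightarrow> 0 < \<phi> x t"
    and phi_mono: "0 \<le> s \<Longrightarrow> s \<le> t \<Longrightarrow> \<phi> x s \<le> \<phi> x t"
    and cU_ge_1: "1 \<le> cU" and cL_ge_1: "1 \<le> cL" and iL_pos: "0 < iL" and iL_le_1: "iL \<le> 1"
    and phi_upper: "0 \<le> t \<Longrightarrow> 1 \<le> s \<Longrightarrow> \<phi> x (s * t) \<le> cU * s * \<phi> x t"
    and phi_lower: "0 \<le> t \<Longrightarrow> 0 < s \<Longrightarrow> s \<le> 1 \<Longrightarrow> \<phi> x (s * t) \<le> cL * s powr iL * \<phi> x t"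
    and p_ge_1: "1 \<le> p" and cA_pos: "0 < cA"
    and mass_ball_finite: "0 < t \<Longrightarrow> 0 < r \<Longrightarrow> phi_mass \<mu> \<phi> (qball d x r) t < \<infinity>"
    and mass_compare: "0 < t \<Longrightarrow> 0 < r \<Longrightarrow> E \<in> sets \<mu> \<Longrightarrow> E \<subseteq> qball d x r \<Longrightarrow>
      enn2real (phi_mass \<mu> \<phi> (qball d x r) t) * (measure \<mu> E / vol x r) powr p
      \<le> cA * enn2real (phi_mass \<mu> \<phi> E t)"
begin

section \<open>The weighted measures of a growth function\<close>

definition wt :: "real \<Rightarrow> 'a measure" where
  "wt t = density \<mu> (\<lambda>x. ennreal (\<phi> x t))"

abbreviation W :: "real \<Rightarrow> 'a set \<Rightarrow> real" where
  "W t E \<equiv> measure (wt t) E"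

lemma sets_wt [simp]: "sets (wt t) = sets \<mu>"
  by (simp add: wt_def)

lemma emeasure_wt: "0 \<le> t \<Longrightarrow> E \<in> sets \<mu> \<Longrightarrow> emeasure (wt t) E = phi_mass \<mu> \<phi> E t"
  unfolding wt_def phi_mass_def using phi_measurable[of t] by (subst emeasure_density) auto

lemma emeasure_wt_ball:
  assumes "0 < t" "0 < r" "E \<in> sets \<mu>" "E \<subseteq> qball d x r"
  shows "emeasure (wt t) E = ennreal (W t E)"
proof -
  have "emeasure (wt t) E \<le> emeasure (wt t) (qball d x r)"
    using assms ball_sets by (intro emeasure_mono) auto
  also have "\<dots> < \<infinity>"
    using mass_ball_finite assms ball_sets by (simp add: emeasure_wt)
  finally show ?thesis
    by (simp add: emeasure_eq_ennreal_measure less_top[symmetric])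
qed

lemma W_mono:
  assumes "0 < t" "0 < r" "E \<in> sets \<mu>" "F \<in> sets \<mu>" "E \<subseteq> F" "F \<subseteq> qball d x r"
  shows "W t E \<le> W t F"
proof -
  have "ennreal (W t E) \<le> ennreal (W t F)"
    using assms emeasure_wt_ball[OF assms(1,2,3), of x] emeasure_wt_ball[OF assms(1,2,4), of x]
      emeasure_mono[of E F "wt t"] by auto
  then show ?thesis by simp
qed

lemma W_le:
  assumes "0 < t" "0 < s" "0 < r" "E \<in> sets \<mu>" "E \<subseteq> qball d x r" "0 \<le> c"
    and "\<And>x. \<phi> x s \<le> c * \<phi> x t"
  shows "W s E \<le> c * W t E"
proof -
  have "emeasure (wt s) E = (\<integral>\<^sup>+y\<in>E. ennreal (\<phi> y s) \<partial>\<mu>)"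
    using assms by (simp add: emeasure_wt phi_mass_def)
  also have "\<dots> \<le> (\<integral>\<^sup>+y. ennreal c * (ennreal (\<phi> y t) * indicator E y) \<partial>\<mu>)"
    using assms phi_pos[OF assms(1)]
    by (intro nn_integral_mono) (auto simp: indicator_def ennreal_mult'[symmetric] intro!: ennreal_leI)
  also have "\<dots> = ennreal c * emeasure (wt t) E"
    using assms phi_measurable[of t] by (subst nn_integral_cmult) (auto simp: emeasure_wt phi_mass_def)
  finally show ?thesis
    using assms emeasure_wt_ball[OF assms(1,3,4,5)] emeasure_wt_ball[OF assms(2,3,4,5)]
    by (simp add: ennreal_mult'[symmetric])
qed

lemma W_ball_pos:
  assumes "0 < t" "0 < r"
  shows "0 < W t (qball d x r)"
proof (rule ccontr)
  assume "\<not> ?thesis"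
  then have "W t (qball d x r) = 0" by (simp add: zero_less_measure_iff)
  then have "emeasure (wt t) (qball d x r) = 0"
    using emeasure_wt_ball[OF assms ball_sets, of x r x] by simp
  then have "(\<integral>\<^sup>+y\<in>qball d x r. ennreal (\<phi> y t) \<partial>\<mu>) = 0"
    using assms ball_sets by (simp add: emeasure_wt phi_mass_def)
  moreover have "(\<integral>\<^sup>+y\<in>qball d x r. ennreal (\<phi> y t) \<partial>\<mu>) \<noteq> 0"
    using phi_measurable[of t] phi_pos assms
    by (intro ball_integral_neq_0) (auto simp: ennreal_eq_0_iff not_le)
  ultimately show False by simp
qed

lemma ap:
  assumes "0 < t" "0 < r" "E \<in> sets \<mu>" "E \<subseteq> qball d x r"
  shows "W t (qball d x r) * (measure \<mu> E / vol x r) powr p \<le> cA * W t E"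
  using mass_compare[OF assms] assms ball_sets by (simp add: measure_def emeasure_wt)

definition cW :: real where "cW = cA * cD powr p"

lemma cW_pos: "0 < cW"
  using cA_pos cD_pos by (simp add: cW_def)

text \<open>Apply \<open>ap\<close> with \<open>E\<close> the smaller of the two concentric balls;
  doubling of \<mu> bounds the ratio of volumes, and its exponent \<open>n\<close> is multiplied by
  \<open>p\<close>.\<close>

lemma W_doubling:
  assumes "0 < t" "0 < r" "1 \<le> l"
  shows "W t (qball d x (l * r)) \<le> cW * l powr (n * p) * W t (qball d x r)"
proof -
  let ?b = "vol x r" and ?B = "vol x (l * r)"
  have pos: "0 < ?b" "0 < ?B" using assms measure_ball_pos by auto
  have "qball d x r \<subseteq> qball d x (l * r)"
    using assms by (intro qball_mono) (simp add: mult_le_cancel_right1)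
  then have "W t (qball d x (l * r)) * (?b / ?B) powr p \<le> cA * W t (qball d x r)"
    using assms by (intro ap ball_sets) auto
  then have "W t (qball d x (l * r)) * (?b / ?B) powr p * (?B / ?b) powr p
      \<le> cA * W t (qball d x r) * (?B / ?b) powr p"
    by (intro mult_right_mono) auto
  moreover have "(?b / ?B) powr p * (?B / ?b) powr p = 1"
    using pos by (simp add: powr_mult[symmetric])
  moreover have "cA * W t (qball d x r) * (?B / ?b) powr p
      \<le> cA * W t (qball d x r) * (cD * l powr n) powr p"
    using pos doubling[of r l x] assms cA_pos p_ge_1
    by (intro mult_left_mono powr_mono2) (auto simp: divide_le_eq)
  moreover have "(cD * l powr n) powr p = cD powr p * l powr (n * p)"
    using cD_pos assms by (simp add: powr_mult powr_powr)
  ultimately show ?thesis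
    by (simp add: cW_def mult.assoc mult.commute mult.left_commute)
qed

abbreviation mean :: "real \<Rightarrow> 'a \<Rightarrow> real \<Rightarrow> real" where
  "mean t x r \<equiv> W t (qball d x r) / vol x r"

section \<open>Norms of characteristic functions of balls\<close>

definition N :: "'a \<Rightarrow> real \<Rightarrow> real" where
  "N x r = chi_norm \<mu> \<phi> (qball d x r)"

lemma luxemburg_indicator:
  assumes "E \<in> sets \<mu>"
  shows "luxemburg_norm \<mu> \<phi> (indicator E) =
    Inf {ennreal l | l. 0 < l \<and> emeasure (wt (1 / l)) E \<le> 1}"
proof -
  have "(\<integral>\<^sup>+x. ennreal (\<phi> x (cmod (indicator E x) / l)) \<partial>\<mu>) = emeasure (wt (1 / l)) E" if "0 < l" for l
    using assms that
    by (subst emeasure_wt) (auto simp: phi_mass_def phi_zero indicator_def intro!: nn_integral_cong)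
  then show ?thesis
    unfolding luxemburg_norm_def by (metis (mono_tags, lifting))
qed

text \<open>The lower type makes the mass at level \<open>s\<close> tend to 0 with \<open>s\<close>,
  so some \<open>l\<close> is admissible in the infimum; conversely it makes the mass at level
  \<open>1 / l\<close> large for small \<open>l\<close>, which keeps the infimum away from
  0.\<close>

lemma luxemburg_ball:
  assumes "0 < r"
  shows "luxemburg_norm \<mu> \<phi> (indicator (qball d x r)) = ennreal (N x r) \<and> 0 < N x r"
proof -
  let ?B = "qball d x r" and ?L = "luxemburg_norm \<mu> \<phi> (indicator (qball d x r))"
  let ?S = "{ennreal l | l. 0 < l \<and> emeasure (wt (1 / l)) ?B \<le> 1}"
  have L: "?L = Inf ?S" by (rule luxemburg_indicator[OF ball_sets])
  let ?w = "W 1 ?B"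
  have w: "0 < ?w" using W_ball_pos assms by simp
  have fin: "?L < \<infinity>"
  proof -
    \<comment> \<open>Solves \<open>cL * s powr iL * ?w = 1\<close>, truncated at 1 because the
      lower type applies only to factors up to 1.\<close>
    define s where "s = min 1 ((1 / (cL * ?w)) powr (1 / iL))"
    have s: "0 < s" "s \<le> 1" using w cL_ge_1 by (auto simp: s_def)
    have "s powr iL \<le> ((1 / (cL * ?w)) powr (1 / iL)) powr iL"
      using s iL_pos by (intro powr_mono2) (auto simp: s_def)
    also have "\<dots> = 1 / (cL * ?w)"
      using iL_pos w cL_ge_1 by (simp add: powr_powr)
    finally have "cL * s powr iL * ?w \<le> 1"
      using w cL_ge_1 by (simp add: field_simps)
    moreover have "W s ?B \<le> cL * s powr iL * ?w"
      using s assms cL_ge_1 phi_lower[of 1 s] by (intro W_le[where x=x and r=r]) (auto simp: ball_sets)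
    ultimately have "emeasure (wt s) ?B \<le> 1"
      using emeasure_wt_ball[of s r ?B x] s assms ball_sets by simp
    then have "ennreal (1 / s) \<in> ?S" using s by (auto intro!: exI[of _ "1 / s"])
    then have "?L \<le> ennreal (1 / s)" unfolding L by (rule Inf_lower)
    then show ?thesis by (rule le_less_trans) simp
  qed
  have pos: "0 < ?L"
  proof -
    define e where "e = min 1 ((?w / cL) powr (1 / iL))"
    have e: "0 < e" using w cL_ge_1 by (simp add: e_def)
    have "ennreal e \<le> Inf ?S"
    proof (rule Inf_greatest, clarify)
      fix l :: real assume l: "0 < l" "emeasure (wt (1 / l)) ?B \<le> 1"
      show "ennreal e \<le> ennreal l"
      proof (cases "l \<le> 1")
        case True
        have "?w \<le> cL * l powr iL * W (1 / l) ?B"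
          using l True assms cL_ge_1 phi_lower[of "1 / l" l]
          by (intro W_le[where x=x and r=r]) (auto simp: ball_sets)
        also have "W (1 / l) ?B \<le> 1"
          using l emeasure_wt_ball[of "1 / l" r ?B x] assms ball_sets by simp
        finally have "?w \<le> cL * l powr iL" using cL_ge_1 by (simp add: mult_left_mono)
        then have "?w / cL \<le> l powr iL" using cL_ge_1 by (simp add: field_simps)
        then have "(?w / cL) powr (1 / iL) \<le> (l powr iL) powr (1 / iL)"
          using w cL_ge_1 iL_pos by (intro powr_mono2) auto
        also have "\<dots> = l" using l iL_pos by (simp add: powr_powr)
        finally show ?thesis by (auto simp: e_def intro!: ennreal_leI)
      qed (auto simp: e_def intro!: ennreal_leI)
    qed
    then show ?thesis unfolding L using e by (meson ennreal_less_zero_iff less_le_trans)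
  qed
  have "?L = ennreal (N x r)"
    unfolding N_def chi_norm_def using fin by (simp add: ennreal_enn2real_if less_top[symmetric])
  with pos show ?thesis by auto
qed

lemmas N_pos = luxemburg_ball[THEN conjunct2]
lemmas luxemburg_N = luxemburg_ball[THEN conjunct1]

lemma N_mono:
  assumes "0 < r" "0 < s" "qball d x r \<subseteq> qball d y s"
  shows "N x r \<le> N y s"
proof -
  have "emeasure (wt t) (qball d x r) \<le> emeasure (wt t) (qball d y s)" for t
    using assms by (intro emeasure_mono) (auto simp: ball_sets)
  then have "luxemburg_norm \<mu> \<phi> (indicator (qball d x r)) \<le> luxemburg_norm \<mu> \<phi> (indicator (qball d y s))"
    unfolding luxemburg_indicator[OF ball_sets] by (intro Inf_superset_mono) (blast intro: order_trans)
  then show ?thesis using luxemburg_N assms N_pos[OF assms(2), of y] by simp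
qed

text \<open>The functions \<phi>(x, .) need not be continuous, so the infimum defining the norm
  cannot be expected to give mass exactly 1. An admissible \<open>l\<close> below twice the norm and
  the inadmissible half of the norm give mass 1 up to factors that the upper type supplies.\<close>

lemma W_norm:
  assumes "0 < r"
  shows "W (1 / N x r) (qball d x r) \<le> 2 * cU" "1 / (2 * cU) \<le> W (1 / N x r) (qball d x r)"
proof -
  let ?B = "qball d x r" and ?N = "N x r"
  let ?S = "{ennreal l | l. 0 < l \<and> emeasure (wt (1 / l)) ?B \<le> 1}"
  have N: "0 < ?N" "Inf ?S = ennreal ?N"
    using luxemburg_ball[OF assms] luxemburg_indicator[OF ball_sets] by auto
  have "Inf ?S < ennreal (2 * ?N)" using N by (simp add: ennreal_lessI)
  then obtain l where l: "0 < l" "emeasure (wt (1 / l)) ?B \<le> 1" "l < 2 * ?N"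
    unfolding Inf_less_iff by (auto simp: ennreal_less_iff)
  have "ennreal ?N \<le> ennreal l"
    unfolding N(2)[symmetric] using l by (intro Inf_lower) auto
  then have Nl: "?N \<le> l" using l by simp
  have "W (1 / ?N) ?B \<le> cU * (l / ?N) * W (1 / l) ?B"
    using l N Nl cU_ge_1 phi_upper[of "1 / l" "l / ?N"] assms
    by (intro W_le[where x=x and r=r]) (auto simp: ball_sets)
  also have "\<dots> \<le> cU * 2 * 1"
    using l N Nl cU_ge_1 emeasure_wt_ball[of "1 / l" r ?B x] assms ball_sets
    by (intro mult_mono) (auto simp: field_simps)
  finally show "W (1 / ?N) ?B \<le> 2 * cU" by simp
  have "\<not> emeasure (wt (1 / (?N / 2))) ?B \<le> 1"
  proof
    assume "emeasure (wt (1 / (?N / 2))) ?B \<le> 1"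
    then have "ennreal (?N / 2) \<in> ?S" using N(1) by (auto intro!: exI[of _ "?N / 2"])
    then have "Inf ?S \<le> ennreal (?N / 2)" by (rule Inf_lower)
    then show False using N by simp
  qed
  then have "1 \<le> W (2 / ?N) ?B"
    using emeasure_wt_ball[of "2 / ?N" r ?B x] assms ball_sets N by simp
  also have "\<dots> \<le> cU * 2 * W (1 / ?N) ?B"
    using N cU_ge_1 phi_upper[of "1 / ?N" 2] assms
    by (intro W_le[where x=x and r=r]) (auto simp: ball_sets)
  finally show "1 / (2 * cU) \<le> W (1 / ?N) ?B"
    using cU_ge_1 by (simp add: field_simps)
qed

text \<open>Passing from level \<open>t\<close> up to \<open>1 / N x r\<close> costs the factor
  \<open>1 / (t * N x r)\<close> by upper type 1, while the mass at the upper level is bounded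
  below. The condition \<open>t * N x r \<le> 1\<close> puts the two levels in this order. The point
  is to replace norms by masses of a single measure.\<close>

lemma norm_le_mass:
  assumes "0 < t" "0 < r" "t * N x r \<le> 1"
  shows "t * N x r \<le> 2 * cU\<^sup>2 * W t (qball d x r)"
proof -
  let ?N = "N x r"
  have N: "0 < ?N" using N_pos assms by simp
  have "1 / (2 * cU) \<le> W (1 / ?N) (qball d x r)" by (rule W_norm[OF assms(2)])
  also have "\<dots> \<le> cU * (1 / (t * ?N)) * W t (qball d x r)"
    using N cU_ge_1 phi_upper[of t "1 / (t * ?N)"] assms
    by (intro W_le[where x=x and r=r]) (auto simp: ball_sets)
  finally show ?thesis
    using cU_ge_1 N assms by (simp add: field_simps power2_eq_square)
qed

definition q :: real where "q = n * p / iL"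

definition cN :: real where "cN = (4 * cU\<^sup>2 * cL * cW) powr (1 / iL)"

lemma np_le_q: "n * p \<le> q"
  using iL_pos iL_le_1 n_pos p_ge_1 by (simp add: q_def field_simps)

lemma q_pos: "0 < q"
  using np_le_q n_pos p_ge_1 by (auto intro: less_le_trans[of _ "n * p"])

lemma cN_pos: "0 < cN"
  using cU_ge_1 cL_ge_1 cW_pos by (simp add: cN_def)

text \<open>At the level belonging to the large ball, passing to the small ball costs
  \<open>l powr (n * p)\<close>, whereas the lower type gains the power \<open>iL\<close> of the
  ratio of the norms. Solving for the ratio takes an \<open>iL\<close>-th root; hence the exponent
  \<open>q\<close>.\<close>

lemma N_doubling:
  assumes "0 < r" "1 \<le> l"
  shows "N x (l * r) \<le> cN * l powr q * N x r"
proof -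
  let ?N = "N x r" and ?M = "N x (l * r)"
  have N: "0 < ?N" "0 < ?M" using N_pos assms by auto
  have NM: "?N \<le> ?M"
    using assms by (intro N_mono qball_mono) (auto simp: mult_le_cancel_right1)
  have "1 / (2 * cU) \<le> W (1 / ?M) (qball d x (l * r))" using assms by (intro W_norm) simp
  also have "\<dots> \<le> cW * l powr (n * p) * W (1 / ?M) (qball d x r)"
    using assms N by (intro W_doubling) auto
  also have "W (1 / ?M) (qball d x r) \<le> cL * (?N / ?M) powr iL * W (1 / ?N) (qball d x r)"
    using N NM cL_ge_1 phi_lower[of "1 / ?N" "?N / ?M"] assms
    by (intro W_le[where x=x and r=r]) (auto simp: ball_sets)
  also have "W (1 / ?N) (qball d x r) \<le> 2 * cU" using assms by (intro W_norm)
  finally have "1 / (2 * cU) \<le> cW * l powr (n * p) * (cL * (?N / ?M) powr iL * (2 * cU))"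
    using cW_pos cL_ge_1 by (simp add: mult_left_mono)
  then have "(?M / ?N) powr iL \<le> (4 * cU\<^sup>2 * cL * cW) * l powr (n * p)"
    using N cU_ge_1 by (simp add: powr_divide field_simps power2_eq_square)
  then have "((?M / ?N) powr iL) powr (1 / iL) \<le> ((4 * cU\<^sup>2 * cL * cW) * l powr (n * p)) powr (1 / iL)"
    using iL_pos by (intro powr_mono2) auto
  moreover have "((?M / ?N) powr iL) powr (1 / iL) = ?M / ?N"
    using iL_pos N by (simp add: powr_powr)
  moreover have "((4 * cU\<^sup>2 * cL * cW) * l powr (n * p)) powr (1 / iL) = cN * l powr q"
    using cU_ge_1 cL_ge_1 cW_pos by (simp add: powr_mult powr_powr cN_def q_def)
  ultimately show ?thesis using N by (simp add: field_simps)
qed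

end

section \<open>Kernel estimates\<close>

lemma power_powr_commute: "(z ^ k) powr c = (z powr c) ^ k" for z c :: real
  by (induction k) (simp_all add: powr_mult)

text \<open>\<open>q < M\<close> says that kernels decay faster than norms of dilated balls grow.
  One constant \<open>cg\<close> covers both the boundedness of \<open>g\<close> and its
  decay.\<close>

locale kernel_space = growth_space +
  fixes m M cg :: real and g :: "real \<Rightarrow> real" and a :: "real \<Rightarrow> 'a \<Rightarrow> 'a \<Rightarrow> complex"
  assumes m_pos: "0 < m" and q_less_M: "q < M" and cg_pos: "0 < cg"
    and g_nonneg: "0 \<le> s \<Longrightarrow> 0 \<le> g s"
    and g_bounded: "0 \<le> s \<Longrightarrow> g s \<le> cg"
    and g_decay: "0 < s \<Longrightarrow> s powr M * g (s powr m) \<le> cg"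
    and a_measurable: "0 < t \<Longrightarrow> (\<lambda>(x, y). a t x y) \<in> borel_measurable (\<mu> \<Otimes>\<^sub>M \<mu>)"
    and a_bound: "0 < t \<Longrightarrow> cmod (a t x y) \<le> h_kernel d \<mu> m g t x y"
begin

text \<open>Constant of \<open>oscillation_large_ball\<close>: it collects
  \<open>norm_le_mass\<close>, the doubling of weights from the packed balls to the covering ones,
  and \<open>W_norm\<close> and \<open>N_doubling\<close> for the enlarged ball.\<close>

definition c3 :: real where
  "c3 = 4 * cU ^ 3 * cW * (2 * C1) powr (n * p) * (cN * (2 * C1) powr q)"

text \<open>Sum of the geometric series of ratio \<open>2 powr (q - M)\<close> over the dyadic balls
  in \<open>kernel_integral_le\<close>.\<close>

definition c4 :: real where "c4 = cg * 2 powr M / (1 - 2 powr (q - M))"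

lemma c3_pos: "0 < c3"
  using cU_ge_1 cW_pos C1_ge_1 cN_pos by (simp add: c3_def)

lemma M_pos: "0 < M"
  using q_pos q_less_M by simp

lemma c4_pos: "0 < c4"
proof -
  have "(2::real) powr (q - M) < 1"
    using q_less_M powr_less_one by simp
  then show ?thesis using cg_pos by (simp add: c4_def)
qed

lemma h_kernel_nonneg: "0 \<le> h_kernel d \<mu> m g t x y" if "0 < t"
  using that g_nonneg[of "d x y powr m / t"] by (simp add: h_kernel_def)

text \<open>It is enough to keep one term of the series, the one for the least dyadic ball that
  contains \<open>z\<close>.\<close>

lemma kernel_dyadic:
  assumes r: "0 < r"
  shows "ennreal (h_kernel d \<mu> m g (r powr m) y z) \<le>
    (\<Sum>k. ennreal (cg * 2 powr M / vol y r * (2 ^ k) powr (- M))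
      * indicator (qball d y (2 ^ k * r)) z)"
proof -
  let ?V = "vol y r" and ?s = "d y z / r"
  have V: "0 < ?V" using measure_ball_pos[OF r] .
  have s: "0 \<le> ?s" using r d_nonneg by simp
  have h: "h_kernel d \<mu> m g (r powr m) y z = g (?s powr m) / ?V"
    using r m_pos d_nonneg[of y z] by (simp add: h_kernel_def powr_powr powr_divide)
  have "\<exists>k. ?s < 2 ^ k" using real_arch_pow[of 2 ?s] by auto
  then obtain k where k: "?s < 2 ^ k" "\<And>j. j < k \<Longrightarrow> 2 ^ j \<le> ?s"
    using exists_least_iff[of "\<lambda>k. ?s < 2 ^ k"] by (auto simp: not_less)
  \<comment> \<open>In the smallest ball boundedness of \<open>g\<close> is used. Otherwise the
    distance is at least the previous dyadic radius, and stepping back one level produces the factor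
    \<open>2 powr M\<close>.\<close>
  have "g (?s powr m) \<le> cg * 2 powr M * (2 ^ k) powr (- M)"
  proof (cases k)
    case 0
    have "g (?s powr m) \<le> cg" by (rule g_bounded) simp
    also have "\<dots> \<le> cg * 2 powr M"
      using cg_pos M_pos by (simp add: ge_one_powr_ge_zero)
    finally show ?thesis using 0 by simp
  next
    case (Suc j)
    then have j: "2 ^ j \<le> ?s" using k by simp
    then have s0: "0 < ?s" by (meson less_le_trans zero_less_numeral zero_less_power)
    have "g (u powr m) \<le> cg * u powr (- M)" if "0 < u" for u
      using g_decay[OF that] that by (simp add: powr_minus field_simps)
    from this[OF s0] have "g (?s powr m) \<le> cg * ?s powr (- M)" .
    also have "\<dots> \<le> cg * (2 ^ j) powr (- M)"
      using cg_pos M_pos j by (intro mult_left_mono powr_mono2') auto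
    also have "(2 ^ j :: real) powr (- M) = 2 powr M * (2 ^ k) powr (- M)"
      using Suc by (simp add: powr_mult powr_minus)
    finally show ?thesis by simp
  qed
  then have "h_kernel d \<mu> m g (r powr m) y z \<le> cg * 2 powr M / ?V * (2 ^ k) powr (- M)"
    unfolding h using V by (simp add: divide_right_mono)
  moreover have "z \<in> qball d y (2 ^ k * r)"
    using k(1) r d_sym[of y z] by (simp add: qball_def field_simps)
  moreover have le_suminf: "u k \<le> suminf u" for u :: "nat \<Rightarrow> ennreal"
    using sum_le_suminf[of u "{k}"] by simp
  ultimately have "ennreal (h_kernel d \<mu> m g (r powr m) y z) \<le>
      ennreal (cg * 2 powr M / ?V * (2 ^ k) powr (- M)) * indicator (qball d y (2 ^ k * r)) z"
    by (simp add: ennreal_leI)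
  also have "\<dots> \<le> (\<Sum>k. ennreal (cg * 2 powr M / ?V * (2 ^ k) powr (- M))
      * indicator (qball d y (2 ^ k * r)) z)"
    by (rule le_suminf)
  finally show ?thesis .
qed

text \<open>The decay of order \<open>M\<close> outweighs the assumed growth of order
  \<open>q\<close> of the integrals over dyadic balls, and the remaining series is
  geometric.\<close>

lemma kernel_integral_le:
  fixes H :: "'a \<Rightarrow> ennreal"
  assumes r: "0 < r" and Y: "0 \<le> Y" and [measurable]: "H \<in> borel_measurable \<mu>"
    and le: "\<And>k. (\<integral>\<^sup>+z\<in>qball d y (2 ^ k * r). H z \<partial>\<mu>) \<le> ennreal (Y * (2 ^ k) powr q)"
  shows "(\<integral>\<^sup>+z. ennreal (h_kernel d \<mu> m g (r powr m) y z) * H z \<partial>\<mu>)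
    \<le> ennreal (c4 * Y / vol y r)"
proof -
  let ?V = "vol y r"
  define c where "c = cg * 2 powr M / ?V"
  define \<theta> where "\<theta> = (2::real) powr (q - M)"
  have c: "0 < c" using measure_ball_pos[OF r, of y] cg_pos by (simp add: c_def)
  have \<theta>: "0 < \<theta>" "\<theta> < 1" using q_less_M powr_less_one by (auto simp: \<theta>_def)
  have [measurable]: "qball d y s \<in> sets \<mu>" for s by (rule ball_sets)
  have "(\<integral>\<^sup>+z. ennreal (h_kernel d \<mu> m g (r powr m) y z) * H z \<partial>\<mu>)
      \<le> (\<integral>\<^sup>+z. (\<Sum>k. ennreal (c * (2 ^ k) powr (- M)) * (H z * indicator (qball d y (2 ^ k * r)) z)) \<partial>\<mu>)"
  proof (rule nn_integral_mono)
    fix z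
    have "ennreal (h_kernel d \<mu> m g (r powr m) y z) * H z \<le>
      (\<Sum>k. ennreal (c * (2 ^ k) powr (- M)) * indicator (qball d y (2 ^ k * r)) z) * H z"
      unfolding c_def by (intro mult_right_mono kernel_dyadic r) simp
    also have "\<dots> = (\<Sum>k. ennreal (c * (2 ^ k) powr (- M)) * (H z * indicator (qball d y (2 ^ k * r)) z))"
      by (subst ennreal_suminf_multc[symmetric]) (simp add: mult_ac)
    finally show "ennreal (h_kernel d \<mu> m g (r powr m) y z) * H z \<le> \<dots>" .
  qed
  also have "\<dots> = (\<Sum>k. ennreal (c * (2 ^ k) powr (- M)) * (\<integral>\<^sup>+z\<in>qball d y (2 ^ k * r). H z \<partial>\<mu>))"
    by (subst nn_integral_suminf) (auto simp: nn_integral_cmult)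
  also have "\<dots> \<le> (\<Sum>k. ennreal (c * Y * \<theta> ^ k))"
  proof (rule suminf_le)
    fix k
    have "ennreal (c * (2 ^ k) powr (- M)) * (\<integral>\<^sup>+z\<in>qball d y (2 ^ k * r). H z \<partial>\<mu>)
        \<le> ennreal (c * (2 ^ k) powr (- M)) * ennreal (Y * (2 ^ k) powr q)"
      by (intro mult_left_mono le) simp
    also have "\<dots> = ennreal (c * Y * ((2 ^ k) powr q * (2 ^ k) powr (- M)))"
      using c Y by (simp add: ennreal_mult'[symmetric] mult_ac)
    also have "(2 ^ k :: real) powr q * (2 ^ k) powr (- M) = \<theta> ^ k"
      by (simp add: \<theta>_def powr_add[symmetric] power_powr_commute[symmetric])
    finally show "ennreal (c * (2 ^ k) powr (- M)) * (\<integral>\<^sup>+z\<in>qball d y (2 ^ k * r). H z \<partial>\<mu>)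
        \<le> ennreal (c * Y * \<theta> ^ k)" .
  qed auto
  also have "\<dots> = ennreal (\<Sum>k. c * Y * \<theta> ^ k)"
    using c Y \<theta> by (intro suminf_ennreal2 summable_mult summable_geometric) auto
  also have "(\<Sum>k. c * Y * \<theta> ^ k) = c * Y / (1 - \<theta>)"
    using \<theta> by (subst suminf_mult) (auto simp: summable_geometric suminf_geometric)
  also have "\<dots> = c4 * Y / ?V"
    by (simp add: c4_def c_def \<theta>_def field_simps)
  finally show ?thesis .
qed

end

section \<open>Functions of bounded oscillation\<close>

text \<open>\<open>b\<close> is any positive upper bound for the norm of \<open>f\<close>, so a
  function of norm 0 is included, with \<open>b = 1\<close>. The kernel integrals of
  \<open>f\<close> converge at every point, although the semigroup law holds only almost
  everywhere.\<close>

locale bmo_function = kernel_space +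
  fixes f :: "'a \<Rightarrow> complex" and b :: real
  assumes f_measurable: "f \<in> borel_measurable \<mu>"
    and b_pos: "0 < b"
    and oscillation: "0 < r \<Longrightarrow>
      (\<integral>\<^sup>+y\<in>qball d x r. ennreal (cmod (f y - A_op \<mu> a (r powr m) f y)) \<partial>\<mu>) \<le> ennreal (b * N x r)"
    and semigroup: "0 < s \<Longrightarrow> 0 < t \<Longrightarrow> AE x in \<mu>. A_op \<mu> a t (A_op \<mu> a s f) x = A_op \<mu> a (t + s) f x"
    and f_integrable: "0 < t \<Longrightarrow> integrable \<mu> (\<lambda>y. a t x y * f y)"
begin

lemma b_nonneg: "0 \<le> b"
  using b_pos by simp

definition D :: "real \<Rightarrow> 'a \<Rightarrow> real" where
  "D r y = cmod (f y - A_op \<mu> a (r powr m) f y)"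

lemma A_op_measurable: "0 < t \<Longrightarrow> A_op \<mu> a t f \<in> borel_measurable \<mu>"
proof -
  assume t: "0 < t"
  interpret sigma_finite_measure \<mu> by (rule sigma_finite)
  have [measurable]: "case_prod (a t) \<in> borel_measurable (\<mu> \<Otimes>\<^sub>M \<mu>)"
    using a_measurable[OF t] by simp
  have [measurable]: "f \<in> borel_measurable \<mu>" by (rule f_measurable)
  have "(\<lambda>x. \<integral>y. a t x y * f y \<partial>\<mu>) \<in> borel_measurable \<mu>"
    by (rule borel_measurable_lebesgue_integral) measurable
  then show ?thesis using t by (simp add: A_op_def[abs_def])
qed

abbreviation osc :: "real \<Rightarrow> 'a set \<Rightarrow> ennreal" where
  "osc r A \<equiv> \<integral>\<^sup>+v\<in>A. ennreal (D r v) \<partial>\<mu>"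

lemma D_measurable: "0 < r \<Longrightarrow> D r \<in> borel_measurable \<mu>"
  using A_op_measurable[of "r powr m"] f_measurable by (simp add: D_def[abs_def])

lemma D_oscillation: "0 < r \<Longrightarrow> (\<integral>\<^sup>+y\<in>qball d x r. ennreal (D r y) \<partial>\<mu>) \<le> ennreal (b * N x r)"
  unfolding D_def by (rule oscillation)

lemma D_integral_UN:
  assumes "0 < r" "countable X" "disjoint_family_on Q X" "\<And>y. y \<in> X \<Longrightarrow> Q y \<in> sets \<mu>"
  shows "osc r (\<Union>y\<in>X. Q y)
    = (\<integral>\<^sup>+y. osc r (Q y) \<partial>count_space X)"
proof -
  let ?\<kappa> = "density \<mu> (\<lambda>v. ennreal (D r v))"
  have e: "emeasure ?\<kappa> A = osc r A" if "A \<in> sets \<mu>" for A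
    using that D_measurable[OF assms(1)] by (subst emeasure_density) auto
  have "emeasure ?\<kappa> (\<Union>y\<in>X. Q y) = (\<integral>\<^sup>+y. emeasure ?\<kappa> (Q y) \<partial>count_space X)"
    using assms by (intro emeasure_UN_countable) auto
  then show ?thesis
    using assms by (subst (asm) e) (auto simp: e intro!: nn_integral_cong cong: nn_integral_cong_simp)
qed

lemma D_integral_mono:
  "A \<subseteq> A' \<Longrightarrow> osc r A \<le> osc r A'"
  by (intro nn_integral_mono) (auto simp: indicator_def)

text \<open>The large ball is covered by balls of radius \<open>r\<close>.  With the weight taken at the level of the
  large ball, their norms are dominated by the masses of disjoint balls, so no factor counting the
  small balls is lost.\<close>

lemma oscillation_large_ball:
  assumes r: "0 < r" "r \<le> R"
  shows "osc r (qball d x R) \<le> ennreal (c3 * b * N x R)"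
proof -
  have R: "0 < R" using r by simp
  \<comment> \<open>Dilating the selected balls by \<open>2 * C1\<close> gives balls of radius
    exactly \<open>r\<close>, the only radius for which the hypothesis controls
    \<open>D r\<close>.\<close>
  define r' where "r' = r / (2 * C1)"
  have r': "0 < r'" "2 * C1 * (r' / 2 ^ 0) = r" using r C1_ge_1 by (auto simp: r'_def)
  define B' where "B' = qball d x (2 * C1 * R)"
  define N' where "N' = N x (2 * C1 * R)"
  have N': "0 < N'" unfolding N'_def using R C1_ge_1 by (intro N_pos) auto
  \<comment> \<open>With this level every small ball inside the enlarged ball \<open>B'\<close>
    satisfies the hypothesis of \<open>norm_le_mass\<close>.\<close>
  define t where "t = 1 / N'"
  have t: "0 < t" using N' by (simp add: t_def)
  obtain X P where X: "countable X" "X \<subseteq> qball d x R" "disjoint_family_on (\<lambda>y. qball d y (r' / 2 ^ 0)) X"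
      "qball d x R \<subseteq> (\<Union>y\<in>X. P y)" "disjoint_family_on P X" "\<forall>y. P y \<in> sets \<mu>"
      "\<forall>y. P y \<subseteq> qball d y (2 * C1 * (r' / 2 ^ 0))"
    using vitali_partition[OF r'(1) subset_refl, of x R "\<lambda>_. 0"] by blast
  define c where "c = 2 * cU\<^sup>2 * cW * (2 * C1) powr (n * p)"
  have c: "0 < c" using cU_ge_1 cW_pos C1_ge_1 by (simp add: c_def)
  have sub: "qball d y r \<subseteq> B'" if "y \<in> X" for y
    unfolding B'_def using that X(2) r C1_ge_1 by (intro qball_subset_qball[of _ _ R]) auto
  have sub': "qball d y r' \<subseteq> B'" if "y \<in> X" for y
    using sub[OF that] qball_mono[of r' r y] r C1_ge_1 by (auto simp: r'_def divide_le_eq mult_le_cancel_left1)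
  have Ny: "N y r \<le> c * N' * W t (qball d y r')" if y: "y \<in> X" for y
  proof -
    have "N y r \<le> N'"
      unfolding N'_def using sub[OF y] r R C1_ge_1 by (intro N_mono) (auto simp: B'_def)
    then have "t * N y r \<le> 2 * cU\<^sup>2 * W t (qball d y r)"
      using N' t r by (intro norm_le_mass) (auto simp: t_def)
    also have "W t (qball d y r) \<le> cW * (2 * C1) powr (n * p) * W t (qball d y r')"
      using W_doubling[OF t r'(1), of "2 * C1" y] C1_ge_1 r' by simp
    finally have "t * N y r \<le> c * W t (qball d y r')"
      using cU_ge_1 by (simp add: c_def mult_left_mono)
    then show ?thesis using N' by (simp add: t_def field_simps)
  qed
  have "osc r (qball d x R) \<le> osc r (\<Union>y\<in>X. P y)"
    using X by (intro D_integral_mono)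
  also have "\<dots> = (\<integral>\<^sup>+y. osc r (P y) \<partial>count_space X)"
    using X r by (intro D_integral_UN) auto
  also have "\<dots> \<le> (\<integral>\<^sup>+y. ennreal (b * c * N') * emeasure (wt t) (qball d y r') \<partial>count_space X)"
  proof (rule nn_integral_mono)
    fix y assume "y \<in> space (count_space X)"
    then have y: "y \<in> X" by simp
    have "osc r (P y) \<le> osc r (qball d y r)"
      using X(7) r' by (intro D_integral_mono) simp
    also have "\<dots> \<le> ennreal (b * N y r)" by (rule D_oscillation[OF r(1)])
    also have "\<dots> \<le> ennreal (b * (c * N' * W t (qball d y r')))"
      using Ny[OF y] b_nonneg by (intro ennreal_leI mult_left_mono)
    also have "\<dots> = ennreal (b * c * N') * emeasure (wt t) (qball d y r')"
      using b_nonneg c N' emeasure_wt_ball[OF t r'(1) ball_sets subset_refl, of y]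
      by (simp add: ennreal_mult'[symmetric] mult_ac)
    finally show "osc r (P y) \<le> ennreal (b * c * N') * emeasure (wt t) (qball d y r')" .
  qed
  also have "\<dots> = ennreal (b * c * N') * (\<integral>\<^sup>+y. emeasure (wt t) (qball d y r') \<partial>count_space X)"
    by (simp add: nn_integral_cmult)
  also have "\<dots> \<le> ennreal (b * c * N') * emeasure (wt t) B'"
    using X sub' by (intro mult_left_mono emeasure_disjoint_le) (auto simp: ball_sets B'_def)
  also have "emeasure (wt t) B' = ennreal (W t B')"
    unfolding B'_def using t R C1_ge_1 by (intro emeasure_wt_ball[OF _ _ ball_sets subset_refl]) auto
  also have "W t B' \<le> 2 * cU"
    unfolding t_def N'_def B'_def using R C1_ge_1 by (intro W_norm) auto
  then have "ennreal (b * c * N') * ennreal (W t B') \<le> ennreal (b * c * N') * ennreal (2 * cU)"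
    by (intro mult_left_mono ennreal_leI) auto
  also have "\<dots> = ennreal (b * c * N' * (2 * cU))"
    using b_nonneg c N' cU_ge_1 by (simp add: ennreal_mult'[symmetric])
  also have "\<dots> \<le> ennreal (b * c * (cN * (2 * C1) powr q * N x R) * (2 * cU))"
    using N_doubling[OF R, of "2 * C1" x] C1_ge_1 b_nonneg c cU_ge_1
    by (intro ennreal_leI mult_right_mono mult_left_mono) (auto simp: N'_def)
  also have "b * c * (cN * (2 * C1) powr q * N x R) * (2 * cU) = c3 * b * N x R"
    by (simp add: c_def c3_def power2_eq_square power3_eq_cube)
  finally show ?thesis .
qed

text \<open>A majorant of the operator at scale \<open>r\<close> applied to f minus its average at
  scale \<open>R\<close>. It is an integral in \<open>ennreal\<close> and may be infinite.\<close>

definition J :: "real \<Rightarrow> real \<Rightarrow> 'a \<Rightarrow> ennreal" where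
  "J r R y = (\<integral>\<^sup>+z. ennreal (h_kernel d \<mu> m g (r powr m) y z) * ennreal (D R z) \<partial>\<mu>)"

text \<open>The integral of a non-integrable function is 0 by convention, so linearity has to be
  justified for \<open>F\<close>, the average of \<open>f\<close> at scale \<open>R\<close>.
  Finiteness of \<open>J\<close> makes the kernel times \<open>f - F\<close> integrable; the kernel
  times \<open>f\<close> is integrable by assumption, and the difference handles
  \<open>F\<close>.\<close>

lemma A_op_difference:
  assumes "0 < r" "0 < R" "J r R y < \<infinity>"
  shows "ennreal (cmod (A_op \<mu> a (r powr m) f y - A_op \<mu> a (r powr m) (A_op \<mu> a (R powr m) f) y)) \<le> J r R y"
proof -
  define t where "t = r powr m"
  define F where "F = A_op \<mu> a (R powr m) f"
  have t: "0 < t" using assms by (simp add: t_def)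
  have [measurable]: "f \<in> borel_measurable \<mu>" "F \<in> borel_measurable \<mu>"
    using f_measurable A_op_measurable[of "R powr m"] assms by (auto simp: F_def)
  have [measurable]: "(\<lambda>z. a t y z) \<in> borel_measurable \<mu>"
    using measurable_Pair2[OF a_measurable[OF t], of y] by (simp add: space_UNIV)
  have le: "(\<integral>\<^sup>+z. ennreal (norm (a t y z * (f z - F z))) \<partial>\<mu>) \<le> J r R y"
    unfolding J_def
  proof (rule nn_integral_mono)
    fix z
    show "ennreal (norm (a t y z * (f z - F z))) \<le> ennreal (h_kernel d \<mu> m g (r powr m) y z) * ennreal (D R z)"
      using a_bound[OF t, of y z] h_kernel_nonneg[OF t, of y z]
      by (simp add: norm_mult D_def F_def t_def ennreal_mult'[symmetric] mult_right_mono ennreal_leI)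
  qed
  have int: "integrable \<mu> (\<lambda>z. a t y z * (f z - F z))"
    using le assms(3) by (intro integrableI_bounded) auto
  have "integrable \<mu> (\<lambda>z. a t y z * f z - a t y z * (f z - F z))"
    by (intro Bochner_Integration.integrable_diff int f_integrable t)
  then have intF: "integrable \<mu> (\<lambda>z. a t y z * F z)"
    by (simp add: algebra_simps)
  have "A_op \<mu> a t f y - A_op \<mu> a t F y = (\<integral>z. a t y z * (f z - F z) \<partial>\<mu>)"
    using t f_integrable[OF t, of y] intF
    by (simp add: A_op_def right_diff_distrib)
  then have "ennreal (cmod (A_op \<mu> a t f y - A_op \<mu> a t F y)) \<le> (\<integral>\<^sup>+z. ennreal (norm (a t y z * (f z - F z))) \<partial>\<mu>)"
    using integral_norm_bound_ennreal[OF int] by simp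
  with le show ?thesis by (simp add: t_def F_def)
qed

text \<open>Almost everywhere both compositions of the two operators are the operator at time
  \<open>r powr m + R powr m\<close>, so they cancel when the semigroup identity of the overview is
  subtracted from f - A_R f. Each remaining difference is an operator applied to an
  oscillation.\<close>

lemma D_compare:
  assumes "0 < r" "0 < R"
  shows "AE y in \<mu>. ennreal (D R y) \<le> ennreal (D r y) + J r R y + J R r y"
proof -
  let ?A = "\<lambda>r. A_op \<mu> a (r powr m)"
  have "AE y in \<mu>. ?A r (?A R f) y = A_op \<mu> a (r powr m + R powr m) f y"
    "AE y in \<mu>. ?A R (?A r f) y = A_op \<mu> a (R powr m + r powr m) f y"
    using assms by (auto intro!: semigroup)
  then show ?thesis
  proof eventually_elim
    case (elim y)
    show ?case
    proof (cases "J r R y < \<infinity> \<and> J R r y < \<infinity>")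
      case True
      have eq: "?A r (?A R f) y = ?A R (?A r f) y" using elim by (simp add: add.commute)
      have "f y - ?A R f y = (f y - ?A r f y) + (?A r f y - ?A r (?A R f) y) - (?A R f y - ?A R (?A r f) y)"
        by (simp add: eq)
      then have "D R y \<le> D r y + cmod (?A r f y - ?A r (?A R f) y) + cmod (?A R f y - ?A R (?A r f) y)"
        unfolding D_def by (smt (verit) norm_triangle_ineq norm_triangle_ineq4)
      then have "ennreal (D R y) \<le> ennreal (D r y) + ennreal (cmod (?A r f y - ?A r (?A R f) y))
          + ennreal (cmod (?A R f y - ?A R (?A r f) y))"
        by (simp add: D_def ennreal_plus[symmetric] ennreal_leI del: ennreal_plus)
      also have "\<dots> \<le> ennreal (D r y) + J r R y + J R r y"
        using assms True by (intro add_mono A_op_difference) auto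
      finally show ?thesis .
    next
      \<comment> \<open>The right-hand side is infinite.\<close>
      case False
      then show ?thesis by (auto simp: not_less top_unique)
    qed
  qed
qed

end

section \<open>The stopping-time step\<close>

context kernel_space
begin

text \<open>\<open>L\<close> exceeds the factor \<open>4 * C1\<^sup>2\<close> lost in the ball
  inclusions, and it is a power of 2 so that dilation by \<open>L\<close> moves a radius
  \<open>R / 2 ^ j\<close> exactly \<open>k0\<close> levels up the dyadic scale.\<close>

definition k0 :: nat where "k0 = (SOME k. 4 * C1\<^sup>2 \<le> 2 ^ k)"

definition L :: real where "L = 2 ^ k0"

definition c2 :: real where "c2 = 2 * cU\<^sup>2"

text \<open>The first summand prevents stopping within the first \<open>k0\<close> levels
  (\<open>large_scales_good\<close>); the second is twice the constant of the packing estimate and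
  so forces the total mass of the stopping balls down to half.\<close>

definition \<beta> :: real where
  "\<beta> = c3 * c2 * cW * (L * L) powr (n * p) + 2 * (c3 * c2 * cW * cW * (L * L) powr (n * p))"

text \<open>Constant of \<open>J_inner\<close>, the kernel at the scale of a stopping ball;
  \<open>c5b\<close> belongs to \<open>J_outer\<close>, the kernel at the scale of the initial
  ball.\<close>

definition c5a :: real where
  "c5a = c4 * ((\<beta> * cW + c3 * cN * c2 * cW) * L powr q) * (cD * L powr n)"

definition c5b :: real where
  "c5b = c4 * (c3 * cN * (cN * (2 * C1) powr q * (c2 * cW * (2 * C1) powr (n * p)))) * (cD * L powr n)"

definition c5 :: real where "c5 = c5a + c5b"

lemma L_bound: "4 * C1\<^sup>2 \<le> L"
proof -
  have "\<exists>k. 4 * C1\<^sup>2 \<le> (2::real) ^ k"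
    using real_arch_pow[of 2 "4 * C1\<^sup>2"] by (auto intro: less_imp_le)
  then show ?thesis unfolding L_def k0_def by (rule someI_ex)
qed

lemma C1_sq: "C1 \<le> C1\<^sup>2" "1 \<le> C1\<^sup>2"
proof -
  show "C1 \<le> C1\<^sup>2"
    using C1_ge_1 mult_left_mono[of 1 C1 C1] by (simp add: power2_eq_square)
  then show "1 \<le> C1\<^sup>2" using C1_ge_1 by linarith
qed

lemma L_ge: "2 * C1 \<le> L" "1 \<le> L" "4 \<le> L" "C1 * (1 + 2 * C1) \<le> L"
proof -
  have "C1 * (1 + 2 * C1) = C1 + 2 * C1\<^sup>2" by (simp add: power2_eq_square algebra_simps)
  then show "2 * C1 \<le> L" "1 \<le> L" "4 \<le> L" "C1 * (1 + 2 * C1) \<le> L"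
    using L_bound C1_sq C1_ge_1 by linarith+
qed

lemma k0_pos: "0 < k0"
  using L_ge(3) by (cases k0) (auto simp: L_def)

lemma c2_pos: "0 < c2"
  using cU_ge_1 by (simp add: c2_def)

lemma \<beta>_pos: "0 < \<beta>"
  using c2_pos c3_pos cW_pos L_ge by (simp add: \<beta>_def add_pos_pos)

lemma c5_pos: "0 \<le> c5a" "0 \<le> c5b" "0 \<le> c5"
  using c2_pos c3_pos c4_pos cW_pos cN_pos cD_pos \<beta>_pos
  by (simp_all add: c5a_def c5b_def c5_def)

lemma inverse_measure_le:
  assumes "0 < r" "qball d x r \<subseteq> qball d z (L * r)"
  shows "1 / vol z r \<le> cD * L powr n / vol x r"
proof -
  have "vol x r \<le> vol z (L * r)"
    using assms ball_sets ball_finite by (intro measure_mono_fmeasurable) (auto simp: fmeasurable_def)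
  also have "\<dots> \<le> cD * L powr n * vol z r"
    using assms L_ge by (intro doubling) auto
  finally show ?thesis
    using measure_ball_pos[OF assms(1)] by (simp add: field_simps)
qed

end

context bmo_function
begin

context
  fixes t R :: real and x :: 'a
  assumes t: "0 < t" and R: "0 < R" and adm: "t * N x (2 * C1 * R) \<le> 1"
begin

text \<open>The condition \<open>adm\<close> on the double ball passes to all balls inside it
  because norms are monotone; \<open>norm_le_mass\<close> then turns the oscillation bound into one
  by the fixed weight.\<close>

lemma adm_mass:
  assumes "0 < s" "qball d y s \<subseteq> qball d x (2 * C1 * R)"
  shows "b * N y s \<le> b / t * (c2 * W t (qball d y s))"
proof -
  have "N y s \<le> N x (2 * C1 * R)"
    using assms R C1_ge_1 by (intro N_mono) auto
  then have "t * N y s \<le> t * N x (2 * C1 * R)" using t by (intro mult_left_mono) auto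
  then have "t * N y s \<le> 1" using adm by linarith
  then have "t * N y s \<le> c2 * W t (qball d y s)"
    using assms(1) t unfolding c2_def by (intro norm_le_mass)
  then have "b / t * (t * N y s) \<le> b / t * (c2 * W t (qball d y s))"
    using b_pos t by (intro mult_left_mono) auto
  then show ?thesis using t by simp
qed

lemma W_double_ball: "W t (qball d x (2 * C1 * R)) \<le> cW * (2 * C1) powr (n * p) * W t (qball d x R)"
  using C1_ge_1 t R by (intro W_doubling) auto

lemma integral_double_ball:
  "osc R (qball d x (2 * C1 * R))
    \<le> ennreal (c3 * (b / t * (c2 * W t (qball d x (2 * C1 * R)))))"
proof -
  have "osc R (qball d x (2 * C1 * R)) \<le> ennreal (c3 * b * N x (2 * C1 * R))"
    using R C1_ge_1 by (intro oscillation_large_ball) (auto simp: mult_le_cancel_right1)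
  also have "\<dots> \<le> ennreal (c3 * (b / t * (c2 * W t (qball d x (2 * C1 * R)))))"
    unfolding mult.assoc[of c3]
    using R C1_ge_1 c3_pos by (intro ennreal_leI mult_left_mono adm_mass) auto
  finally show ?thesis .
qed

lemma sub_double: "y \<in> qball d x R \<Longrightarrow> s \<le> R \<Longrightarrow> qball d y s \<subseteq> qball d x (2 * C1 * R)"
  using C1_ge_1 R by (intro qball_subset_qball[of _ _ R]) auto

text \<open>At these scales the small ball and the double ball of \<open>B\<close> have comparable
  masses, with dilation factor at most \<open>L * L\<close>. Consequently a stopping ball lies more
  than \<open>k0\<close> levels down, and its double ball still fits into the double ball of
  \<open>B\<close>.\<close>

lemma large_scales_good:
  assumes y: "y \<in> qball d x R" and k: "k \<le> k0"
  shows "osc R (qball d y (R / 2 ^ k))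
    \<le> ennreal (\<beta> * (b / t) * W t (qball d y (R / 2 ^ k)))"
proof -
  let ?r = "R / 2 ^ k"
  have kL: "(2::real) ^ k \<le> L" unfolding L_def using k by (intro power_increasing) auto
  have "osc R (qball d y ?r) \<le> osc R (qball d x (2 * C1 * R))"
    by (intro D_integral_mono sub_double y ball_radius_bound R)
  also note integral_double_ball
  also have "ennreal (c3 * (b / t * (c2 * W t (qball d x (2 * C1 * R)))))
      \<le> ennreal (\<beta> * (b / t) * W t (qball d y ?r))"
  proof (rule ennreal_leI)
    have "x \<in> qball d y R" using y d_sym[of x y] by (simp add: qball_def)
    then have "qball d x (2 * C1 * R) \<subseteq> qball d y (L * R)"
      using L_ge(4) R by (intro qball_subset_qball[of _ _ R])
        (auto simp: algebra_simps dest!: mult_right_mono[of _ L R])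
    then have "W t (qball d x (2 * C1 * R)) \<le> W t (qball d y (L * R))"
      using t R L_ge by (intro W_mono[where x=y and r="L * R"]) (auto simp: ball_sets)
    also have "L * R = (L * 2 ^ k) * ?r" by simp
    also have "W t (qball d y ((L * 2 ^ k) * ?r)) \<le> cW * (L * 2 ^ k) powr (n * p) * W t (qball d y ?r)"
    proof (intro W_doubling t)
      have "1 * 1 \<le> L * 2 ^ k" using L_ge by (intro mult_mono) auto
      then show "1 \<le> L * 2 ^ k" by simp
    qed (use R in simp)
    also have "\<dots> \<le> cW * (L * L) powr (n * p) * W t (qball d y ?r)"
      using kL L_ge cW_pos n_pos p_ge_1 by (intro mult_right_mono mult_left_mono powr_mono2) auto
    finally have "c3 * (b / t * (c2 * W t (qball d x (2 * C1 * R))))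
        \<le> c3 * (b / t * (c2 * (cW * (L * L) powr (n * p) * W t (qball d y ?r))))"
      using c3_pos c2_pos b_pos t by (intro mult_left_mono) auto
    also have "\<dots> = (c3 * c2 * cW * (L * L) powr (n * p)) * (b / t) * W t (qball d y ?r)"
      by (simp add: mult_ac)
    also have "\<dots> \<le> \<beta> * (b / t) * W t (qball d y ?r)"
      using c3_pos c2_pos cW_pos b_pos t by (intro mult_right_mono) (auto simp: \<beta>_def)
    finally show "c3 * (b / t * (c2 * W t (qball d x (2 * C1 * R)))) \<le> \<beta> * (b / t) * W t (qball d y ?r)" .
  qed
  finally show ?thesis .
qed

text \<open>All dyadic balls met by the kernel at scale \<open>R\<close> have radius at least
  \<open>\<rho>\<close>, so \<open>oscillation_large_ball\<close> applies to each of them, and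
  \<open>N_doubling\<close> gives growth of order \<open>q\<close>.\<close>

lemma J_outer:
  assumes \<rho>: "0 < \<rho>" "\<rho> \<le> R" and z: "z \<in> qball d x (2 * C1 * R)"
  shows "J R \<rho> z \<le> ennreal (c5b * (b / t) * (mean t x R))"
proof -
  let ?Y = "c3 * cN * (b * N z R)"
  have Y: "0 \<le> ?Y" using c3_pos cN_pos b_pos N_pos[OF R, of z] by simp
  have [measurable]: "D \<rho> \<in> borel_measurable \<mu>" using D_measurable \<rho> by simp
  have "J R \<rho> z \<le> ennreal (c4 * ?Y / vol z R)"
    unfolding J_def
  proof (rule kernel_integral_le[OF R Y])
    fix k
    have k: "1 \<le> (2::real) ^ k" by simp
    then have "\<rho> \<le> 2 ^ k * R" using \<rho> R mult_right_mono[of 1 "2 ^ k" R] by linarith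
    then have "osc \<rho> (qball d z (2 ^ k * R)) \<le> ennreal (c3 * b * N z (2 ^ k * R))"
      by (rule oscillation_large_ball[OF \<rho>(1)])
    also have "\<dots> \<le> ennreal (c3 * b * (cN * (2 ^ k) powr q * N z R))"
      using c3_pos b_pos by (intro ennreal_leI mult_left_mono N_doubling R k) auto
    also have "c3 * b * (cN * (2 ^ k) powr q * N z R) = ?Y * (2 ^ k) powr q" by simp
    finally show "osc \<rho> (qball d z (2 ^ k * R)) \<le> ennreal (?Y * (2 ^ k) powr q)" .
  qed simp
  also have "\<dots> \<le> ennreal (c5b * (b / t) * (mean t x R))"
  proof (rule ennreal_leI)
    have sq: "C1 * (R + 2 * C1 * R) = C1 * (1 + 2 * C1) * R" by (simp add: algebra_simps)
    have "C1 * (1 + 2 * C1) \<le> 2 * C1 * (2 * C1)"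
      using C1_ge_1 mult_left_mono[of "1 + 2 * C1" "4 * C1" C1] by simp
    then have "qball d z R \<subseteq> qball d x (2 * C1 * (2 * C1 * R))"
      using z R mult_right_mono[of "C1 * (1 + 2 * C1)" "2 * C1 * (2 * C1)" R] sq
      by (intro qball_subset_qball[of _ _ "2 * C1 * R"]) auto
    then have "N z R \<le> N x (2 * C1 * (2 * C1 * R))" using R C1_ge_1 by (intro N_mono) auto
    also have "\<dots> \<le> cN * (2 * C1) powr q * N x (2 * C1 * R)"
      using R C1_ge_1 by (intro N_doubling) auto
    finally have "b * N z R \<le> cN * (2 * C1) powr q * (b * N x (2 * C1 * R))"
      using b_pos by (simp add: mult.left_commute)
    also have "\<dots> \<le> cN * (2 * C1) powr q * (b / t * (c2 * W t (qball d x (2 * C1 * R))))"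
      using R C1_ge_1 cN_pos by (intro mult_left_mono adm_mass) auto
    also have "\<dots> \<le> cN * (2 * C1) powr q * (b / t * (c2 * (cW * (2 * C1) powr (n * p) * W t (qball d x R))))"
      using cN_pos b_pos t c2_pos by (intro mult_left_mono W_double_ball) auto
    finally have 1: "b * N z R \<le> \<dots>" .
    have "x \<in> qball d z (2 * C1 * R)" using z d_sym[of x z] by (simp add: qball_def)
    then have "qball d x R \<subseteq> qball d z (L * R)"
      using R sq mult_right_mono[OF L_ge(4), of R] by (intro qball_subset_qball[of _ _ "2 * C1 * R"]) auto
    then have 2: "1 / vol z R \<le> cD * L powr n / vol x R"
      by (rule inverse_measure_le[OF R])
    have "c4 * ?Y / vol z R = (c4 * (c3 * cN)) * (b * N z R) * (1 / vol z R)"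
      by simp
    also have "\<dots> \<le> (c4 * (c3 * cN)) *
        (cN * (2 * C1) powr q * (b / t * (c2 * (cW * (2 * C1) powr (n * p) * W t (qball d x R))))) *
        (cD * L powr n / vol x R)"
      using c4_pos c3_pos cN_pos b_pos t c2_pos cW_pos
      by (intro mult_mono mult_left_mono 1 2) auto
    also have "\<dots> = c5b * (b / t) * (mean t x R)"
      by (simp add: c5b_def)
    finally show "c4 * ?Y / vol z R
        \<le> c5b * (b / t) * (mean t x R)" .
  qed
  finally show ?thesis .
qed

text \<open>The dyadic balls around \<open>z\<close> are enlarged to balls centred at
  \<open>y\<close>. Below scale \<open>R\<close> these are at earlier levels, where the stopping
  rule bounds the integral of \<open>D R\<close>; above scale \<open>R\<close> the oscillation bound
  for large balls takes over.\<close>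

lemma J_inner:
  assumes y: "y \<in> qball d x R"
    and good: "\<And>l. l < j \<Longrightarrow> osc R (qball d y (R / 2 ^ l))
      \<le> ennreal (\<beta> * (b / t) * W t (qball d y (R / 2 ^ l)))"
    and \<rho>: "\<rho> = 2 * C1 * (R / 2 ^ j)" and z: "z \<in> qball d y \<rho>"
  shows "J \<rho> R z \<le> ennreal (c5a * (b / t) * (mean t y \<rho>))"
proof -
  let ?r = "R / 2 ^ j"
  have r: "0 < ?r" using R by simp
  have \<rho>0: "0 < \<rho>" using \<rho> R C1_ge_1 by simp
  have Wr: "W t (qball d y ?r) \<le> W t (qball d y \<rho>)"
  proof (intro W_mono[OF t \<rho>0 ball_sets ball_sets _ subset_refl] qball_mono)
    show "?r \<le> \<rho>" unfolding \<rho> using mult_right_mono[of 1 "2 * C1" ?r] r C1_ge_1 by linarith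
  qed
  define c where "c = \<beta> * cW + c3 * cN * c2 * cW"
  have c: "0 < c" using \<beta>_pos cW_pos c3_pos cN_pos c2_pos by (simp add: c_def add_pos_pos)
  let ?Y = "c * L powr q * (b / t) * W t (qball d y \<rho>)"
  have Y: "0 \<le> ?Y" using c b_pos t by simp
  have [measurable]: "D R \<in> borel_measurable \<mu>" using D_measurable R by simp
  have key: "osc R (qball d z (2 ^ k * \<rho>)) \<le> ennreal (?Y * (2 ^ k) powr q)" for k
  proof -
    define l where "l = L * 2 ^ k"
    have k1: "1 \<le> (2::real) ^ k" by simp
    have "1 * 1 \<le> L * 2 ^ k" using L_ge by (intro mult_mono) auto
    then have l1: "1 \<le> l" by (simp add: l_def)
    have lq: "l powr q = L powr q * (2 ^ k) powr q" using L_ge by (simp add: l_def powr_mult)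
    have "C1 * (2 ^ k * \<rho> + \<rho>) = 2 * C1\<^sup>2 * (2 ^ k + 1) * ?r"
      by (simp add: \<rho> power2_eq_square algebra_simps)
    also have "\<dots> \<le> 2 * C1\<^sup>2 * (2 ^ k + 2 ^ k) * ?r"
      using k1 r by (intro mult_right_mono mult_left_mono add_left_mono) auto
    also have "\<dots> = 4 * C1\<^sup>2 * 2 ^ k * ?r" by simp
    also have "\<dots> \<le> l * ?r"
      unfolding l_def using L_bound r by (intro mult_right_mono) auto
    finally have "qball d z (2 ^ k * \<rho>) \<subseteq> qball d y (l * ?r)"
      by (intro qball_subset_qball[OF z])
    then have "osc R (qball d z (2 ^ k * \<rho>))
        \<le> osc R (qball d y (l * ?r))"
      by (rule D_integral_mono)
    also have "\<dots> \<le> ennreal (c * (b / t) * l powr q * W t (qball d y ?r))"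
    \<comment> \<open>In this case the enlarged ball is the one at level
      \<open>j - (k0 + k)\<close>, strictly earlier than \<open>j\<close> because
      \<open>k0 > 0\<close>. The strictness matters, since the ball at level \<open>j\<close> itself
      may violate the stopping bound.\<close>
    proof (cases "k0 + k \<le> j")
      case True
      have "(2::real) ^ j = 2 ^ (j - (k0 + k)) * (2 ^ k0 * 2 ^ k)"
        using True by (simp add: power_add[symmetric])
      then have eq: "l * ?r = R / 2 ^ (j - (k0 + k))" by (simp add: l_def L_def)
      have "osc R (qball d y (l * ?r)) \<le> ennreal (\<beta> * (b / t) * W t (qball d y (l * ?r)))"
        unfolding eq using k0_pos True by (intro good) auto
      also have "\<dots> \<le> ennreal (\<beta> * (b / t) * (cW * l powr q * W t (qball d y ?r)))"
      proof (intro ennreal_leI mult_left_mono)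
        have "W t (qball d y (l * ?r)) \<le> cW * l powr (n * p) * W t (qball d y ?r)"
          by (intro W_doubling t r l1)
        also have "\<dots> \<le> cW * l powr q * W t (qball d y ?r)"
          using l1 cW_pos np_le_q by (intro mult_right_mono mult_left_mono powr_mono) auto
        finally show "W t (qball d y (l * ?r)) \<le> cW * l powr q * W t (qball d y ?r)" .
      qed (use \<beta>_pos b_pos t in auto)
      also have "\<beta> * (b / t) * (cW * l powr q * W t (qball d y ?r))
          = (\<beta> * cW) * ((b / t) * l powr q * W t (qball d y ?r))" by simp
      also have "\<dots> \<le> c * ((b / t) * l powr q * W t (qball d y ?r))"
        using c3_pos cN_pos c2_pos cW_pos b_pos t by (intro mult_right_mono) (auto simp: c_def)
      finally show ?thesis by (simp add: mult.assoc ennreal_leI)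
    next
      case False
      then have "(2::real) ^ j \<le> 2 ^ (k0 + k)" by (intro power_increasing) auto
      then have l2: "1 \<le> l / 2 ^ j" by (simp add: l_def L_def power_add)
      have eq: "l * ?r = (l / 2 ^ j) * R" by simp
      have "R \<le> (l / 2 ^ j) * R" using mult_right_mono[OF l2, of R] R by simp
      then have "osc R (qball d y (l * ?r)) \<le> ennreal (c3 * b * N y ((l / 2 ^ j) * R))"
        unfolding eq by (rule oscillation_large_ball[OF R])
      also have "\<dots> \<le> ennreal (c3 * b * (cN * (l / 2 ^ j) powr q * N y R))"
        using c3_pos b_pos by (intro ennreal_leI mult_left_mono N_doubling R l2) auto
      also have "\<dots> \<le> ennreal (c * (b / t) * l powr q * W t (qball d y ?r))"
      proof (rule ennreal_leI)
        \<comment> \<open>Returning from radius \<open>R\<close> to the ball at level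
          \<open>j\<close> costs \<open>(2 ^ j) powr q\<close>, which recombines with the growth
          beyond \<open>R\<close> to \<open>l powr q\<close>.\<close>
        have "W t (qball d y (2 ^ j * ?r)) \<le> cW * (2 ^ j) powr (n * p) * W t (qball d y ?r)"
          by (intro W_doubling t r) simp
        also have "\<dots> \<le> cW * (2 ^ j) powr q * W t (qball d y ?r)"
          using cW_pos np_le_q by (intro mult_right_mono mult_left_mono powr_mono) auto
        finally have w: "W t (qball d y R) \<le> cW * (2 ^ j) powr q * W t (qball d y ?r)" by simp
        have "c3 * b * (cN * (l / 2 ^ j) powr q * N y R) = c3 * cN * (l / 2 ^ j) powr q * (b * N y R)" by simp
        also have "\<dots> \<le> c3 * cN * (l / 2 ^ j) powr q * (b / t * (c2 * W t (qball d y R)))"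
          using c3_pos cN_pos R by (intro mult_left_mono adm_mass sub_double y) auto
        also have "\<dots> \<le> c3 * cN * (l / 2 ^ j) powr q * (b / t * (c2 * (cW * (2 ^ j) powr q * W t (qball d y ?r))))"
          using c3_pos cN_pos b_pos t c2_pos by (intro mult_left_mono w) auto
        also have "\<dots> = (c3 * cN * c2 * cW) * ((b / t) * ((l / 2 ^ j) powr q * (2 ^ j) powr q) * W t (qball d y ?r))"
          by simp
        also have "(l / 2 ^ j) powr q * (2 ^ j) powr q = l powr q"
          using l1 by (simp add: powr_mult[symmetric])
        also have "(c3 * cN * c2 * cW) * ((b / t) * l powr q * W t (qball d y ?r))
            \<le> c * ((b / t) * l powr q * W t (qball d y ?r))"
          using \<beta>_pos cW_pos b_pos t by (intro mult_right_mono) (auto simp: c_def)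
        finally show "c3 * b * (cN * (l / 2 ^ j) powr q * N y R) \<le> c * (b / t) * l powr q * W t (qball d y ?r)"
          by (simp add: mult.assoc)
      qed
      finally show ?thesis .
    qed
    also have "\<dots> \<le> ennreal (c * (b / t) * l powr q * W t (qball d y \<rho>))"
      using Wr c b_pos t by (intro ennreal_leI mult_left_mono) auto
    also have "c * (b / t) * l powr q * W t (qball d y \<rho>) = ?Y * (2 ^ k) powr q"
      by (simp add: lq)
    finally show ?thesis .
  qed
  have "J \<rho> R z \<le> ennreal (c4 * ?Y / vol z \<rho>)"
    unfolding J_def by (rule kernel_integral_le[OF \<rho>0 Y _ key]) simp
  also have "\<dots> \<le> ennreal (c5a * (b / t) * (mean t y \<rho>))"
  proof (rule ennreal_leI)
    have "y \<in> qball d z \<rho>" using z d_sym[of y z] by (simp add: qball_def)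
    then have "qball d y \<rho> \<subseteq> qball d z (L * \<rho>)"
      using mult_right_mono[OF L_ge(1), of \<rho>] \<rho>0 by (intro qball_subset_qball[of _ _ \<rho>]) auto
    moreover have "0 \<le> c4 * ?Y"
      by (rule mult_nonneg_nonneg[OF less_imp_le[OF c4_pos] Y])
    ultimately have "c4 * ?Y * (1 / vol z \<rho>) \<le> c4 * ?Y * (cD * L powr n / vol y \<rho>)"
      by (intro mult_left_mono inverse_measure_le \<rho>0)
    then show "c4 * ?Y / vol z \<rho> \<le> c5a * (b / t) * (mean t y \<rho>)"
      by (simp add: c5a_def c_def mult_ac)
  qed
  finally show ?thesis .
qed

end

end

section \<open>Selection of stopping balls and induction over generations\<close>

context bmo_function
begin

text \<open>Stopping takes place only at points of \<open>E\<close>, and the \<open>Q y\<close> cut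
  the stopped part of \<open>E\<close> into disjoint pieces. The mass estimate rests on disjointness
  of the undilated balls; the balls of radius \<open>\<rho> y\<close> are their dilates and contain
  the pieces. The inclusion of the double balls is the admissibility condition for the next
  generation.\<close>

lemma stopping_step:
  fixes t R :: real and x :: 'a
  assumes t: "0 < t" and R: "0 < R" and adm: "t * N x (2 * C1 * R) \<le> 1"
    and E: "E \<in> sets \<mu>" "E \<subseteq> qball d x R"
  shows "\<exists>X \<rho> Q. countable X \<and>
    (\<forall>y\<in>X. 0 < \<rho> y \<and> qball d y (2 * C1 * \<rho> y) \<subseteq> qball d x (2 * C1 * R)) \<and>
    disjoint_family_on Q X \<and> (\<forall>y\<in>X. Q y \<in> sets \<mu> \<and> Q y \<subseteq> E \<and> Q y \<subseteq> qball d y (\<rho> y)) \<and>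
    (\<integral>\<^sup>+y. emeasure (wt t) (qball d y (\<rho> y)) \<partial>count_space X) \<le> ennreal (W t (qball d x R) / 2) \<and>
    osc R (E - (\<Union>y\<in>X. Q y))
      \<le> ennreal (\<beta> * (b / t)) * emeasure (wt t) (E - (\<Union>y\<in>X. Q y)) \<and>
    (\<forall>y\<in>X. AE v in \<mu>. v \<in> qball d y (\<rho> y) \<longrightarrow> ennreal (D R v) \<le> ennreal (D (\<rho> y) v) +
      ennreal (c5 * (b / t) * (mean t y (\<rho> y) +
        mean t x R)))"
proof -
  define bad where "bad y k \<longleftrightarrow> \<not> osc R (qball d y (R / 2 ^ k))
    \<le> ennreal (\<beta> * (b / t) * W t (qball d y (R / 2 ^ k)))" for y k
  define S where "S = {y\<in>E. \<exists>k. bad y k}"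
  define k where "k y = (LEAST k. bad y k)" for y
  define \<rho> where "\<rho> y = 2 * C1 * (R / 2 ^ k y)" for y
  let ?B = "qball d x R"
  have [measurable]: "E \<in> sets \<mu>" "D R \<in> borel_measurable \<mu>" "(\<lambda>v. \<phi> v t) \<in> borel_measurable \<mu>"
    using E R t D_measurable phi_measurable by auto
  have K: "0 < b / t" "0 < b" "0 < t" using b_pos t by auto
  have \<beta>K: "0 \<le> \<beta> * b / t" using b_pos t \<beta>_pos by simp
  have S: "S \<subseteq> ?B" using E by (auto simp: S_def)
  have kbad: "bad y (k y)" if "y \<in> S" for y
    using that unfolding S_def k_def by (auto intro: LeastI)
  have kleast: "\<not> bad y l" if "l < k y" for y l
    using that unfolding k_def by (rule not_less_Least)
  have k0: "k0 < k y" if y: "y \<in> S" for y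
    using kbad[OF y] large_scales_good[OF t R adm, of y "k y"] S y
    by (force simp: bad_def not_less[symmetric])
  \<comment> \<open>Having passed \<open>k0\<close> levels, the radius has shrunk by at least
    \<open>4 * C1\<^sup>2\<close>: one factor \<open>2 * C1\<close> is the Vitali dilation, the
    other is reserved for the double ball.\<close>
  have \<rho>: "0 < \<rho> y" "2 * C1 * \<rho> y \<le> R" if y: "y \<in> S" for y
  proof -
    show "0 < \<rho> y" using R C1_ge_1 by (simp add: \<rho>_def)
    have "L \<le> 2 ^ k y" unfolding L_def using k0[OF y] by (intro power_increasing) auto
    then have "4 * C1\<^sup>2 \<le> 2 ^ k y" using L_bound by linarith
    then have "4 * C1\<^sup>2 * R \<le> R * 2 ^ k y" using R by simp
    then show "2 * C1 * \<rho> y \<le> R" by (simp add: \<rho>_def field_simps power2_eq_square)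
  qed
  have \<rho>R: "\<rho> y \<le> R" if y: "y \<in> S" for y
    using \<rho>[OF y] C1_ge_1 mult_right_mono[of 1 "2 * C1" "\<rho> y"] by linarith
  obtain X P where X: "countable X" "X \<subseteq> S" "disjoint_family_on (\<lambda>y. qball d y (R / 2 ^ k y)) X"
      "S \<subseteq> (\<Union>y\<in>X. P y)" "disjoint_family_on P X" "\<forall>y. P y \<in> sets \<mu>"
      "\<forall>y. P y \<subseteq> qball d y (2 * C1 * (R / 2 ^ k y))"
    using vitali_partition[OF R S, of k] by blast
  define Q where "Q y = E \<inter> P y" for y
  have XB: "y \<in> ?B" if "y \<in> X" for y using that X(2) S by blast
  have UQ: "(\<Union>y\<in>X. Q y) \<in> sets \<mu>"
    using X E unfolding Q_def by (intro sets.countable_UN') auto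
  let ?c = "cW * (2 * C1) powr (n * p)"
  have c: "0 < ?c" using cW_pos C1_ge_1 by simp
  have sum_le: "(\<integral>\<^sup>+y. emeasure (wt t) (qball d y (\<rho> y)) \<partial>count_space X) \<le> ennreal (W t ?B / 2)"
  proof -
    let ?I = "\<lambda>y. \<integral>\<^sup>+v\<in>qball d y (R / 2 ^ k y). ennreal (D R v) \<partial>\<mu>"
    have "ennreal (\<beta> * (b / t)) * (\<integral>\<^sup>+y. emeasure (wt t) (qball d y (\<rho> y)) \<partial>count_space X)
        = (\<integral>\<^sup>+y. ennreal (\<beta> * (b / t)) * emeasure (wt t) (qball d y (\<rho> y)) \<partial>count_space X)"
      by (simp add: nn_integral_cmult)
    also have "\<dots> \<le> (\<integral>\<^sup>+y. ennreal ?c * ?I y \<partial>count_space X)"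
    proof (rule nn_integral_mono)
      fix y assume "y \<in> space (count_space X)"
      then have y: "y \<in> S" using X by auto
      have "ennreal (\<beta> * (b / t)) * emeasure (wt t) (qball d y (\<rho> y)) = ennreal (\<beta> * (b / t) * W t (qball d y (\<rho> y)))"
        using emeasure_wt_ball[OF t \<rho>(1)[OF y] ball_sets subset_refl] K \<beta>_pos \<beta>K
        by (simp add: ennreal_mult'[symmetric])
      also have "\<dots> \<le> ennreal (\<beta> * (b / t) * (?c * W t (qball d y (R / 2 ^ k y))))"
        using K \<beta>_pos t R C1_ge_1 unfolding \<rho>_def by (intro ennreal_leI mult_left_mono W_doubling) auto
      also have "\<dots> = ennreal ?c * ennreal (\<beta> * (b / t) * W t (qball d y (R / 2 ^ k y)))"
        using c K \<beta>_pos \<beta>K by (simp add: ennreal_mult'[symmetric] mult_ac)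
      also have "\<dots> \<le> ennreal ?c * ?I y"
        using kbad[OF y] by (intro mult_left_mono) (auto simp: bad_def not_le intro: less_imp_le)
      finally show "ennreal (\<beta> * (b / t)) * emeasure (wt t) (qball d y (\<rho> y)) \<le> ennreal ?c * ?I y" .
    qed
    also have "\<dots> = ennreal ?c * osc R (\<Union>y\<in>X. qball d y (R / 2 ^ k y))"
      by (simp add: nn_integral_cmult D_integral_UN[OF R X(1,3) ball_sets])
    also have "\<dots> \<le> ennreal ?c * osc R (qball d x (2 * C1 * R))"
      by (intro mult_left_mono D_integral_mono UN_least sub_double[OF t R adm XB ball_radius_bound[OF R]]) auto
    also have "\<dots> \<le> ennreal ?c * ennreal (c3 * (b / t * (c2 * W t (qball d x (2 * C1 * R)))))"
      by (intro mult_left_mono integral_double_ball t R adm) simp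
    also have "\<dots> \<le> ennreal ?c * ennreal (c3 * (b / t * (c2 * (?c * W t ?B))))"
      using c3_pos c2_pos K
      by (intro mult_left_mono ennreal_leI W_double_ball t R adm) auto
    also have "\<dots> = ennreal (c3 * c2 * cW * cW * ((2 * C1) powr (n * p) * (2 * C1) powr (n * p)) * (b / t) * W t ?B)"
      using c by (simp add: ennreal_mult'[symmetric] mult_ac)
    also have "\<dots> \<le> ennreal (c3 * c2 * cW * cW * (L powr (n * p) * L powr (n * p)) * (b / t) * W t ?B)"
      using c3_pos c2_pos cW_pos K L_ge(1) C1_ge_1 n_pos p_ge_1
      by (intro ennreal_leI mult_right_mono mult_left_mono mult_mono powr_mono2) auto
    \<comment> \<open>The factor 1/2 in the mass estimate comes from here: the second summand of
      \<beta> is twice the constant just reached.\<close>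
    also have "\<dots> \<le> ennreal (\<beta> / 2 * (b / t) * W t ?B)"
      using c3_pos c2_pos cW_pos K L_ge
      by (intro ennreal_leI mult_right_mono) (auto simp: \<beta>_def powr_mult)
    also have "\<dots> = ennreal (\<beta> * (b / t)) * ennreal (W t ?B / 2)"
      using K \<beta>_pos \<beta>K by (simp add: ennreal_mult'[symmetric])
    finally show ?thesis
      using K \<beta>_pos \<beta>K by (subst (asm) ennreal_mult_le_mult_iff) auto
  qed
  have off: "osc R (E - (\<Union>y\<in>X. Q y))
      \<le> ennreal (\<beta> * (b / t)) * emeasure (wt t) (E - (\<Union>y\<in>X. Q y))"
  proof -
    define E' where "E' = E - (\<Union>y\<in>X. Q y)"
    have E'[measurable]: "E' \<in> sets \<mu>" using E UQ by (auto simp: E'_def)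
    have w_ball: "(\<integral>\<^sup>+v\<in>A. ennreal (\<beta> * (b / t) * \<phi> v t) \<partial>\<mu>) = ennreal (\<beta> * (b / t)) * emeasure (wt t) A"
      if [measurable]: "A \<in> sets \<mu>" for A
    proof -
      have "ennreal (\<beta> * (b / t) * \<phi> v t) = ennreal (\<beta> * (b / t)) * ennreal (\<phi> v t)" for v
        using K \<beta>_pos phi_pos[OF t, of v] by (intro ennreal_mult) auto
      then have "(\<integral>\<^sup>+v\<in>A. ennreal (\<beta> * (b / t) * \<phi> v t) \<partial>\<mu>)
          = (\<integral>\<^sup>+v. ennreal (\<beta> * (b / t)) * (ennreal (\<phi> v t) * indicator A v) \<partial>\<mu>)"
        by (simp only: mult.assoc)
      also have "\<dots> = ennreal (\<beta> * (b / t)) * emeasure (wt t) A"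
        using t that by (simp add: nn_integral_cmult emeasure_wt phi_mass_def)
      finally show ?thesis .
    qed
    have "AE v in \<mu>. v \<in> E' \<longrightarrow> D R v \<le> \<beta> * (b / t) * \<phi> v t"
    proof (rule ball_domination_AE[where R=R and z=x and T=R])
      show "0 \<le> \<beta> * (b / t) * \<phi> v t" for v
        using \<beta>_pos K phi_pos[OF t, of v] by simp
      show "(\<integral>\<^sup>+v\<in>qball d y r. ennreal (\<beta> * (b / t) * \<phi> v t) \<partial>\<mu>) < \<infinity>" for y r
      proof -
        have "emeasure (wt t) (qball d y r) = ennreal (W t (qball d y r))"
          using qball_mono[of r "max r 1" y]
          by (intro emeasure_wt_ball[OF t, of "max r 1" _ y] ball_sets) auto
        then show ?thesis unfolding w_ball[OF ball_sets] by (simp add: ennreal_mult_less_top)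
      qed
      show "E' \<subseteq> ?B" using E by (auto simp: E'_def)
      show "osc R (qball d y (R / 2 ^ l))
          \<le> (\<integral>\<^sup>+v\<in>qball d y (R / 2 ^ l). ennreal (\<beta> * (b / t) * \<phi> v t) \<partial>\<mu>)" if "y \<in> E'" for y l
      proof -
        \<comment> \<open>The pieces cover the stopped points of \<open>E\<close>, so at a point
          outside them no scale was bad; this is the hypothesis of
          \<open>ball_domination_AE\<close>.\<close>
        have "y \<notin> S" using that X(4) by (auto simp: E'_def Q_def)
        then have "\<not> bad y l" using that by (auto simp: S_def E'_def)
        then show ?thesis
          unfolding w_ball[OF ball_sets]
          using emeasure_wt_ball[OF t _ ball_sets subset_refl, of "R / 2 ^ l" y] R K \<beta>_pos \<beta>K
          by (simp add: bad_def ennreal_mult'[symmetric])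
      qed
    qed (use R in auto)
    then have "osc R E' \<le> (\<integral>\<^sup>+v\<in>E'. ennreal (\<beta> * (b / t) * \<phi> v t) \<partial>\<mu>)"
      by (intro nn_integral_mono_AE) (auto elim!: eventually_mono simp: indicator_def intro!: ennreal_leI)
    then show ?thesis unfolding w_ball[OF E'] by (simp only: E'_def)
  qed
  have diff: "AE v in \<mu>. v \<in> qball d y (\<rho> y) \<longrightarrow> ennreal (D R v) \<le> ennreal (D (\<rho> y) v) +
      ennreal (c5 * (b / t) * (mean t y (\<rho> y) + mean t x R))"
    if "y \<in> X" for y
  proof -
    have y: "y \<in> S" "y \<in> ?B" using that X XB by auto
    let ?a1 = "b / t * (mean t y (\<rho> y))"
    let ?a2 = "b / t * (mean t x R)"
    have a: "0 \<le> ?a1" "0 \<le> ?a2" using K by auto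
    show ?thesis
      using D_compare[OF \<rho>(1)[OF y(1)] R]
    proof eventually_elim
      case (elim v)
      show ?case
      proof
        assume v: "v \<in> qball d y (\<rho> y)"
        have "J (\<rho> y) R v \<le> ennreal (c5a * (b / t) * (mean t y (\<rho> y)))"
          using kleast[of _ y] by (intro J_inner[OF t R adm y(2) _ \<rho>_def v]) (auto simp: bad_def)
        moreover have "J R (\<rho> y) v \<le> ennreal (c5b * (b / t) * (mean t x R))"
          using sub_double[OF t R adm y(2) \<rho>R[OF y(1)]] v
          by (intro J_outer[OF t R adm \<rho>(1)[OF y(1)] \<rho>R[OF y(1)]]) auto
        ultimately have "J (\<rho> y) R v + J R (\<rho> y) v \<le> ennreal (c5a * ?a1) + ennreal (c5b * ?a2)"
          by (auto intro!: add_mono simp: mult.assoc)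
        also have "\<dots> \<le> ennreal (c5 * ?a1) + ennreal (c5 * ?a2)"
          using c5_pos a by (intro add_mono ennreal_leI mult_right_mono) (auto simp: c5_def)
        also have "\<dots> = ennreal (c5 * ?a1 + c5 * ?a2)"
          by (intro ennreal_plus[symmetric] mult_nonneg_nonneg[OF c5_pos(3)] a)
        also have "c5 * ?a1 + c5 * ?a2 = c5 * (b / t) * (mean t y (\<rho> y) + mean t x R)"
          by (simp add: algebra_simps)
        finally show "ennreal (D R v) \<le> ennreal (D (\<rho> y) v) +
            ennreal (c5 * (b / t) * (mean t y (\<rho> y) + mean t x R))"
          using elim by (auto simp: add.assoc intro: order_trans add_left_mono)
      qed
    qed
  qed
  show ?thesis
  proof (intro exI[of _ X] exI[of _ \<rho>] exI[of _ Q] conjI ballI)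
    fix y assume "y \<in> X"
    then have y: "y \<in> S" "y \<in> ?B" using X XB by auto
    show "0 < \<rho> y" by (rule \<rho>(1)[OF y(1)])
    show "qball d y (2 * C1 * \<rho> y) \<subseteq> qball d x (2 * C1 * R)"
      by (rule sub_double[OF t R adm y(2) \<rho>(2)[OF y(1)]])
    show "Q y \<in> sets \<mu>" "Q y \<subseteq> E" using X E by (auto simp: Q_def)
    show "Q y \<subseteq> qball d y (\<rho> y)" using X(7) by (auto simp: Q_def \<rho>_def)
    show "AE v in \<mu>. v \<in> qball d y (\<rho> y) \<longrightarrow> ennreal (D R v) \<le> ennreal (D (\<rho> y) v) +
      ennreal (c5 * (b / t) * (mean t y (\<rho> y) + mean t x R))"
      by (rule diff[OF \<open>y \<in> X\<close>])
  next
    show "disjoint_family_on Q X"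
      using X(5) by (fastforce simp: Q_def disjoint_family_on_def)
  qed (use X(1) sum_le off in auto)
qed

text \<open>The sequences \<open>s\<close> and \<open>\<delta>\<close> are left free, one pair for
  each generation, so that they can be chosen after the iteration. Terms with \<open>s j\<close>
  multiply masses of stopping balls and gain \<open>(1/2) ^ j\<close>; terms with
  \<open>\<delta> j\<close> multiply masses of disjoint pieces of \<open>E\<close> and gain
  nothing.\<close>

lemma iterated_estimate:
  fixes s \<delta> :: "nat \<Rightarrow> real"
  assumes t: "0 < t" and nonneg: "\<And>j. 0 \<le> s j" "\<And>j. 0 \<le> \<delta> j"
    and comp: "\<And>j x r E. 0 < r \<Longrightarrow> E \<in> sets \<mu> \<Longrightarrow> E \<subseteq> qball d x r \<Longrightarrow>
      mean t x r * measure \<mu> E \<le> s j * W t (qball d x r) + \<delta> j * W t E"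
    and "0 < R" "t * N x (2 * C1 * R) \<le> 1" "E \<in> sets \<mu>" "E \<subseteq> qball d x R"
  shows "osc R E \<le> ennreal (b / t * ((\<beta> + (\<Sum>j<k. 2 * c5 * \<delta> j)) * W t E +
    ((\<Sum>j<k. 2 * c5 * s j * (1/2) ^ j) + c2 * (1/2) ^ k) * W t (qball d x R)))"
  using assms(2-)
proof (induction k arbitrary: s \<delta> x R E)
  case 0
  have sub: "qball d x R \<subseteq> qball d x (2 * C1 * R)"
    using 0 C1_ge_1 by (intro qball_mono) (simp add: mult_le_cancel_right1)
  have "osc R E \<le> osc R (qball d x R)"
    using 0 by (intro D_integral_mono)
  also have "\<dots> \<le> ennreal (b * N x R)" using 0 by (intro D_oscillation)
  also have "\<dots> \<le> ennreal (b / t * (c2 * W t (qball d x R)))"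
    using 0 t sub by (intro ennreal_leI adm_mass[of t R x]) auto
  also have "\<dots> \<le> ennreal (b / t * (\<beta> * W t E + c2 * W t (qball d x R)))"
    using b_pos t \<beta>_pos by (intro ennreal_leI mult_left_mono) auto
  finally show ?case by simp
next
  case (Suc k)
  let ?B = "qball d x R" and ?K = "b / t"
  have K: "0 < ?K" "0 < b" "0 < t" using b_pos t by auto
  note R = \<open>0 < R\<close> and E = \<open>E \<in> sets \<mu>\<close> \<open>E \<subseteq> qball d x R\<close> and adm = \<open>t * N x (2 * C1 * R) \<le> 1\<close>
  from stopping_step[OF t R adm E] obtain X \<rho> Q where X: "countable X"
      and \<rho>_all: "\<forall>y\<in>X. 0 < \<rho> y \<and> qball d y (2 * C1 * \<rho> y) \<subseteq> qball d x (2 * C1 * R)"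
      and disj: "disjoint_family_on Q X"
      and Q_all: "\<forall>y\<in>X. Q y \<in> sets \<mu> \<and> Q y \<subseteq> E \<and> Q y \<subseteq> qball d y (\<rho> y)"
      and half: "(\<integral>\<^sup>+y. emeasure (wt t) (qball d y (\<rho> y)) \<partial>count_space X) \<le> ennreal (W t ?B / 2)"
      and off: "osc R (E - (\<Union>y\<in>X. Q y))
        \<le> ennreal (\<beta> * ?K) * emeasure (wt t) (E - (\<Union>y\<in>X. Q y))"
      and diff_all: "\<forall>y\<in>X. AE v in \<mu>. v \<in> qball d y (\<rho> y) \<longrightarrow> ennreal (D R v) \<le> ennreal (D (\<rho> y) v) +
        ennreal (c5 * ?K * (mean t y (\<rho> y) + mean t x R))"
    by (elim exE conjE)
  note X = X disj half off
  note \<rho> = bspec[OF \<rho>_all] and Q = bspec[OF Q_all] and diff = bspec[OF diff_all]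
  define U where "U = (\<Union>y\<in>X. Q y)"
  have U: "U \<in> sets \<mu>" "U \<subseteq> E"
    unfolding U_def using X Q by (auto intro!: sets.countable_UN')
  define \<Delta> where "\<Delta> = \<beta> + (\<Sum>j<k. 2 * c5 * \<delta> (Suc j))"
  define \<Sigma> where "\<Sigma> = (\<Sum>j<k. 2 * c5 * s (Suc j) * (1/2) ^ j) + c2 * (1/2) ^ k"
  have nn: "0 \<le> \<Delta>" "0 \<le> \<Sigma>"
    using \<beta>_pos c5_pos c2_pos Suc.prems(1,2) by (auto simp: \<Delta>_def \<Sigma>_def intro!: add_nonneg_nonneg sum_nonneg)
  \<comment> \<open>\<open>a1\<close>, \<open>a2\<close> and \<open>a3\<close> are the factors of
    the mass of a piece, the mass of its stopping ball and the \<mu>-measure of the piece. Half of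
    \<open>a2\<close> disappears on summation; \<open>a3\<close> carries the average of the weight
    over the initial ball.\<close>
  define a1 where "a1 = ?K * (\<Delta> + c5 * \<delta> 0)"
  define a2 where "a2 = ?K * (\<Sigma> + c5 * s 0)"
  define a3 where "a3 = ?K * c5 * (mean t x R)"
  have a: "0 \<le> a1" "0 \<le> a2" "0 \<le> a3" "\<beta> * ?K \<le> a1"
  proof -
    show "0 \<le> a1" "0 \<le> a2" "0 \<le> a3"
      using nn K c5_pos Suc.prems(1,2)[of 0] by (auto simp: a1_def a2_def a3_def)
    have "\<beta> \<le> \<Delta> + c5 * \<delta> 0"
      using c5_pos Suc.prems(2) by (auto simp: \<Delta>_def intro!: add_nonneg_nonneg sum_nonneg)
    then have "?K * \<beta> \<le> ?K * (\<Delta> + c5 * \<delta> 0)" using K by (intro mult_left_mono) auto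
    then show "\<beta> * ?K \<le> a1" by (simp add: a1_def mult.commute)
  qed
  have fin_ball: "emeasure (wt t) A = ennreal (W t A)" if "A \<in> sets \<mu>" "A \<subseteq> ?B" for A
    by (rule emeasure_wt_ball[OF t R that])
  have fin_mu: "emeasure \<mu> A = ennreal (measure \<mu> A)" if "A \<in> sets \<mu>" "A \<subseteq> qball d y r" for A y r
  proof -
    have "emeasure \<mu> A \<le> emeasure \<mu> (qball d y r)" using that ball_sets by (intro emeasure_mono) auto
    also have "\<dots> < \<infinity>" by (rule ball_finite)
    finally show ?thesis by (simp add: emeasure_eq_ennreal_measure less_top[symmetric])
  qed
  have piece: "osc R (Q y) \<le> ennreal a1 * emeasure (wt t) (Q y) +
      ennreal a2 * emeasure (wt t) (qball d y (\<rho> y)) + ennreal a3 * emeasure \<mu> (Q y)" if y: "y \<in> X" for y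
  proof -
    let ?By = "qball d y (\<rho> y)"
    let ?c = "c5 * ?K * (mean t y (\<rho> y) + mean t x R)"
    have c: "0 \<le> ?c" using c5_pos K by simp
    have \<rho>y: "0 < \<rho> y" using \<rho>[OF y] by simp
    have Qs[measurable]: "Q y \<in> sets \<mu>" and QB: "Q y \<subseteq> ?By" using Q[OF y] by auto
    have [measurable]: "D (\<rho> y) \<in> borel_measurable \<mu>" by (rule D_measurable[OF \<rho>y])
    have "N y (2 * C1 * \<rho> y) \<le> N x (2 * C1 * R)"
      using \<rho>[OF y] R C1_ge_1 by (intro N_mono) auto
    then have adm': "t * N y (2 * C1 * \<rho> y) \<le> 1"
      using adm t by (meson less_imp_le mult_left_mono order_trans)
    have "osc R (Q y)
        \<le> (\<integral>\<^sup>+v. ennreal (D (\<rho> y) v) * indicator (Q y) v + ennreal ?c * indicator (Q y) v \<partial>\<mu>)"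
      using diff[OF y] QB
      by (intro nn_integral_mono_AE) (auto elim!: eventually_mono simp: indicator_def)
    also have "\<dots> = osc (\<rho> y) (Q y) + ennreal ?c * emeasure \<mu> (Q y)"
      by (simp add: nn_integral_add nn_integral_cmult_indicator)
    also have "\<dots> \<le> ennreal (?K * (\<Delta> * W t (Q y) + \<Sigma> * W t ?By)) + ennreal ?c * ennreal (measure \<mu> (Q y))"
    proof (rule add_mono)
      \<comment> \<open>The sequences are shifted by one, as the stopping balls are generation 0 of
        the remaining iteration.\<close>
      show "osc (\<rho> y) (Q y) \<le> ennreal (?K * (\<Delta> * W t (Q y) + \<Sigma> * W t ?By))"
        unfolding \<Delta>_def \<Sigma>_def
        by (rule Suc.IH[of "\<lambda>j. s (Suc j)" "\<lambda>j. \<delta> (Suc j)", OF _ _ _ \<rho>y adm' Qs QB])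
          (use Suc.prems in auto)
      show "ennreal ?c * emeasure \<mu> (Q y) \<le> ennreal ?c * ennreal (measure \<mu> (Q y))"
        using fin_mu[OF Qs QB] by simp
    qed
    also have "\<dots> = ennreal (?K * (\<Delta> * W t (Q y) + \<Sigma> * W t ?By) + ?c * measure \<mu> (Q y))"
      unfolding ennreal_mult[OF c measure_nonneg, symmetric]
      using c nn K c5_pos by (intro ennreal_plus[symmetric] mult_nonneg_nonneg add_nonneg_nonneg) auto
    also have "\<dots> \<le> ennreal (a1 * W t (Q y) + a2 * W t ?By + a3 * measure \<mu> (Q y))"
    proof (rule ennreal_leI)
      have "mean t y (\<rho> y) * measure \<mu> (Q y) \<le> s 0 * W t ?By + \<delta> 0 * W t (Q y)"
        by (rule Suc.prems(3)[OF \<rho>y Qs QB])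
      then have "c5 * ?K * (mean t y (\<rho> y) * measure \<mu> (Q y)) \<le> c5 * ?K * (s 0 * W t ?By + \<delta> 0 * W t (Q y))"
        using c5_pos K by (intro mult_left_mono) auto
      then show "?K * (\<Delta> * W t (Q y) + \<Sigma> * W t ?By) + ?c * measure \<mu> (Q y)
          \<le> a1 * W t (Q y) + a2 * W t ?By + a3 * measure \<mu> (Q y)"
        by (simp add: a1_def a2_def a3_def algebra_simps)
    qed
    also have "\<dots> = ennreal a1 * emeasure (wt t) (Q y) + ennreal a2 * emeasure (wt t) ?By + ennreal a3 * emeasure \<mu> (Q y)"
      using a emeasure_wt_ball[OF t \<rho>y Qs QB] emeasure_wt_ball[OF t \<rho>y ball_sets subset_refl, of y] fin_mu[OF Qs QB]
      by (simp add: ennreal_mult' ennreal_plus)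
    finally show ?thesis .
  qed
  have [measurable]: "D R \<in> borel_measurable \<mu>" "U \<in> sets \<mu>" "E \<in> sets \<mu>"
    using D_measurable R U E by auto
  have "osc R E
      = (\<integral>\<^sup>+v. ennreal (D R v) * indicator (E - U) v + ennreal (D R v) * indicator U v \<partial>\<mu>)"
    using U by (intro nn_integral_cong) (auto simp: indicator_def)
  also have "\<dots> = osc R (E - U) + osc R U"
    by (simp add: nn_integral_add)
  also have "osc R U = (\<integral>\<^sup>+y. osc R (Q y) \<partial>count_space X)"
    unfolding U_def using X Q R by (intro D_integral_UN) auto
  also have "\<dots> \<le> (\<integral>\<^sup>+y. ennreal a1 * emeasure (wt t) (Q y) +
      ennreal a2 * emeasure (wt t) (qball d y (\<rho> y)) + ennreal a3 * emeasure \<mu> (Q y) \<partial>count_space X)"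
    using piece by (intro nn_integral_mono) auto
  also have "\<dots> = ennreal a1 * (\<integral>\<^sup>+y. emeasure (wt t) (Q y) \<partial>count_space X) +
      ennreal a2 * (\<integral>\<^sup>+y. emeasure (wt t) (qball d y (\<rho> y)) \<partial>count_space X) +
      ennreal a3 * (\<integral>\<^sup>+y. emeasure \<mu> (Q y) \<partial>count_space X)"
    by (simp add: nn_integral_add nn_integral_cmult)
  also have "\<dots> \<le> ennreal a1 * emeasure (wt t) U + ennreal a2 * ennreal (W t ?B / 2) + ennreal a3 * emeasure \<mu> E"
    using X Q U E unfolding U_def
    by (intro add_mono mult_left_mono emeasure_disjoint_le) auto
  also have "osc R (E - U) \<le> ennreal a1 * emeasure (wt t) (E - U)"
    using a(4) by (intro order_trans[OF X(4)[folded U_def]] mult_right_mono ennreal_leI) auto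
  finally have "osc R E \<le> ennreal a1 * emeasure (wt t) (E - U) +
      (ennreal a1 * emeasure (wt t) U + ennreal a2 * ennreal (W t ?B / 2) + ennreal a3 * emeasure \<mu> E)"
    by (simp add: add_right_mono)
  also have "\<dots> = ennreal a1 * (emeasure (wt t) (E - U) + emeasure (wt t) U) +
      ennreal a2 * ennreal (W t ?B / 2) + ennreal a3 * emeasure \<mu> E"
    by (simp add: distrib_left add.assoc)
  also have "emeasure (wt t) (E - U) + emeasure (wt t) U = emeasure (wt t) E"
    using U E by (subst plus_emeasure) (auto intro!: arg_cong[where f="emeasure _"])
  also have "ennreal a1 * emeasure (wt t) E + ennreal a2 * ennreal (W t ?B / 2) + ennreal a3 * emeasure \<mu> E
      = ennreal (a1 * W t E + a2 * (W t ?B / 2) + a3 * measure \<mu> E)"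
    unfolding fin_ball[OF E] fin_mu[OF E] using a(1-3)
    by (simp add: ennreal_mult'[symmetric] ennreal_plus[symmetric] del: ennreal_plus times_divide_eq_right)
  also have "\<dots> \<le> ennreal (?K * ((\<Delta> + 2 * c5 * \<delta> 0) * W t E + (\<Sigma> / 2 + 2 * c5 * s 0) * W t ?B))"
  proof (rule ennreal_leI)
    \<comment> \<open>Second use of the comparison at index 0, now for the initial ball; the first
      was on the stopping balls. Together they account for the factor \<open>2 * c5\<close>.\<close>
    have "mean t x R * measure \<mu> E \<le> s 0 * W t ?B + \<delta> 0 * W t E"
      by (rule Suc.prems(3)[OF R E])
    then have "c5 * ?K * (mean t x R * measure \<mu> E) \<le> c5 * ?K * (s 0 * W t ?B + \<delta> 0 * W t E)"
      using c5_pos K by (intro mult_left_mono) auto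
    moreover have "0 \<le> ?K * c5 * s 0 * W t ?B" using K c5_pos Suc.prems(1)[of 0] by simp
    moreover have "k * (\<Delta> + c5 * \<delta> 0) * e + k * (\<Sigma> + c5 * s 0) * (w / 2) + c5 * k * z
        \<le> k * ((\<Delta> + 2 * c5 * \<delta> 0) * e + (\<Sigma> / 2 + 2 * c5 * s 0) * w)"
      if "c5 * k * z \<le> c5 * k * (s 0 * w + \<delta> 0 * e)" "0 \<le> k * c5 * s 0 * w" for k e w z
      using that by (simp add: algebra_simps)
    ultimately have "?K * (\<Delta> + c5 * \<delta> 0) * W t E + ?K * (\<Sigma> + c5 * s 0) * (W t ?B / 2) +
          c5 * ?K * (mean t x R * measure \<mu> E)
        \<le> ?K * ((\<Delta> + 2 * c5 * \<delta> 0) * W t E + (\<Sigma> / 2 + 2 * c5 * s 0) * W t ?B)"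
      by blast
    then show "a1 * W t E + a2 * (W t ?B / 2) + a3 * measure \<mu> E
        \<le> ?K * ((\<Delta> + 2 * c5 * \<delta> 0) * W t E + (\<Sigma> / 2 + 2 * c5 * s 0) * W t ?B)"
      unfolding a1_def a2_def a3_def by (simp only: mult.assoc mult.commute mult.left_commute)
  qed
  also have "\<Delta> + 2 * c5 * \<delta> 0 = \<beta> + (\<Sum>j<Suc k. 2 * c5 * \<delta> j)"
    by (simp add: \<Delta>_def sum.lessThan_Suc_shift del: sum.lessThan_Suc)
  also have "\<Sigma> / 2 + 2 * c5 * s 0 = (\<Sum>j<Suc k. 2 * c5 * s j * (1/2) ^ j) + c2 * (1/2) ^ Suc k"
    by (simp add: \<Sigma>_def sum.lessThan_Suc_shift sum_divide_distrib add_divide_distrib del: sum.lessThan_Suc)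
  finally show ?case .
qed

end

section \<open>Distributional estimates\<close>

lemma geometric_sum_le:
  fixes z :: real
  assumes "0 \<le> z" "z < 1"
  shows "(\<Sum>j<k. z ^ j) \<le> 1 / (1 - z)"
  using assms by (simp add: sum_gp_strict divide_right_mono)

text \<open>The number \<open>k\<close> of generations is taken proportional to \<open>u\<close>, as
  large as possible with the coefficient of \<open>w\<close> on the right at most
  \<open>u / 2\<close>; that term is absorbed. For small \<open>u\<close> the bound \<open>T\<close>
  suffices.\<close>

lemma exponential_decay:
  fixes \<beta> \<gamma> c T :: real
  assumes "0 \<le> \<beta>" "0 < \<gamma>" "0 \<le> c" "0 < T"
  shows "\<exists>C>0. \<exists>\<kappa>>0. \<forall>u>0. \<forall>w\<ge>0. w \<le> T \<longrightarrow>
    (\<forall>k::nat. u * w \<le> (\<beta> + \<gamma> * real k) * w + c * (1/2) ^ k) \<longrightarrow> w \<le> C * exp (- (\<kappa> * u))"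
proof -
  define \<kappa> where "\<kappa> = ln 2 / (2 * \<gamma>)"
  define U where "U = 2 + 2 * \<beta>"
  define E where "E = exp (ln 2 * (1 + \<beta> / \<gamma>))"
  define C where "C = T * exp (\<kappa> * U) + c * E"
  have \<kappa>: "0 < \<kappa>" using assms by (simp add: \<kappa>_def)
  have E: "0 < E" by (simp add: E_def)
  have C: "0 < C" using assms E by (simp add: C_def add_pos_nonneg)
  have "w \<le> C * exp (- (\<kappa> * u))"
    if u: "0 < u" and w: "0 \<le> w" "w \<le> T"
      and le: "\<forall>k::nat. u * w \<le> (\<beta> + \<gamma> * real k) * w + c * (1/2) ^ k" for u w
  proof (cases "u \<le> U")
    case True
    have "T * 1 \<le> T * exp (\<kappa> * (U - u))"
      using True \<kappa> assms(4) by (intro mult_left_mono) auto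
    then have "w \<le> T * exp (\<kappa> * (U - u))" using w by linarith
    also have "\<dots> = T * exp (\<kappa> * U) * exp (- (\<kappa> * u))"
      by (simp add: exp_add[symmetric] right_diff_distrib)
    also have "\<dots> \<le> C * exp (- (\<kappa> * u))"
      using assms E by (intro mult_right_mono) (auto simp: C_def)
    finally show ?thesis .
  next
    case False
    \<comment> \<open>Solves \<open>\<beta> + \<gamma> * v = u / 2\<close>; rounding down to an
      integer costs one generation, hence the summand 1 in the exponent of \<open>E\<close>.\<close>
    define v where "v = (u / 2 - \<beta>) / \<gamma>"
    have v: "0 \<le> v" using False assms by (simp add: v_def U_def)
    define k where "k = nat \<lfloor>v\<rfloor>"
    have k: "real k \<le> v" "v < real k + 1" using v by (auto simp: k_def)
    have "\<gamma> * real k \<le> \<gamma> * v" using k assms by (intro mult_left_mono) auto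
    then have "\<gamma> * real k \<le> u / 2 - \<beta>" using assms by (simp add: v_def)
    then have "(\<beta> + \<gamma> * real k) * w \<le> u / 2 * w" using w by (intro mult_right_mono) auto
    then have "u * w \<le> u / 2 * w + c * (1/2) ^ k" using le[rule_format, of k] by linarith
    moreover have "1 * w \<le> u / 2 * w" using False w assms(1) by (intro mult_right_mono) (auto simp: U_def)
    ultimately have "w \<le> c * (1/2) ^ k" by linarith
    also have "(1/2 :: real) ^ k = exp (- (ln 2 * real k))"
      by (simp add: exp_minus exp_of_nat2_mult power_one_over inverse_eq_divide)
    also have "c * exp (- (ln 2 * real k)) \<le> c * exp (ln 2 * (1 - v))"
      using k assms mult_left_mono[of v "real k + 1" "ln 2"]
      by (intro mult_left_mono) (auto simp: algebra_simps)
    also have "ln 2 * (1 - v) = ln 2 * (1 + \<beta> / \<gamma>) + - (\<kappa> * u)"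
      using assms by (simp add: v_def \<kappa>_def field_simps)
    also have "c * exp (ln 2 * (1 + \<beta> / \<gamma>) + - (\<kappa> * u)) = c * E * exp (- (\<kappa> * u))"
      unfolding E_def exp_add by simp
    also have "\<dots> \<le> C * exp (- (\<kappa> * u))"
      using assms by (intro mult_right_mono) (auto simp: C_def)
    finally show ?thesis .
  qed
  with C \<kappa> show ?thesis by blast
qed

text \<open>Optimise in \<sigma>: once \<open>a * \<sigma> powr (1 - p)\<close> is a quarter of
  \<open>u\<close>, half of the left side absorbs the coefficient of \<open>w\<close>, and
  \<open>\<sigma> / u\<close> has the order of \<open>u\<close> to the power -p/(p-1).\<close>

lemma power_decay:
  fixes \<beta> a c T p :: real
  assumes "0 \<le> \<beta>" "0 < a" "0 < c" "0 < T" "1 < p"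
  shows "\<exists>C>0. \<forall>u>0. \<forall>w\<ge>0. w \<le> T \<longrightarrow>
    (\<forall>\<sigma>>0. u * w \<le> (\<beta> + a * \<sigma> powr (1 - p)) * w + c * \<sigma>) \<longrightarrow> w \<le> C * u powr (- (p / (p - 1)))"
proof -
  define e where "e = 1 / (p - 1)"
  have e: "0 < e" "p / (p - 1) = 1 + e" "e * (1 - p) = -1"
    using assms by (auto simp: e_def field_simps)
  define C where "C = T * (4 * \<beta>) powr (1 + e) + 2 * c * (4 * a) powr e"
  have C: "0 < C" using assms by (simp add: C_def add_nonneg_pos)
  have "w \<le> C * u powr (- (1 + e))"
    if u: "0 < u" and w: "0 \<le> w" "w \<le> T"
      and le: "\<forall>\<sigma>>0. u * w \<le> (\<beta> + a * \<sigma> powr (1 - p)) * w + c * \<sigma>" for u w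
  proof (cases "u < 4 * \<beta>")
    case True
    have "1 \<le> (4 * \<beta> / u) powr (1 + e)"
      using True u e by (intro ge_one_powr_ge_zero) auto
    then have "T * 1 \<le> T * (4 * \<beta> / u) powr (1 + e)"
      using assms(4) by (intro mult_left_mono) auto
    then have "w \<le> T * (4 * \<beta> / u) powr (1 + e)" using w by linarith
    also have "\<dots> = T * ((4 * \<beta>) powr (1 + e) / u powr (1 + e))"
      using u assms by (subst powr_divide) auto
    also have "\<dots> = T * (4 * \<beta>) powr (1 + e) * u powr (- (1 + e))"
      by (simp only: powr_minus divide_inverse mult.assoc)
    also have "\<dots> \<le> C * u powr (- (1 + e))"
      using assms by (intro mult_right_mono) (auto simp: C_def)
    finally show ?thesis .
  next
    case False
    define \<sigma> where "\<sigma> = (4 * a / u) powr e"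
    have \<sigma>: "0 < \<sigma>" using assms u by (simp add: \<sigma>_def)
    have "\<sigma> powr (1 - p) = (4 * a / u) powr (-1)"
      unfolding \<sigma>_def powr_powr e(3) ..
    also have "\<dots> = u / (4 * a)"
      using assms u by (simp add: powr_minus)
    finally have eq: "a * \<sigma> powr (1 - p) = u / 4" using assms by simp
    have "u * w \<le> (\<beta> + u / 4) * w + c * \<sigma>" using le[rule_format, OF \<sigma>] unfolding eq .
    also have "(\<beta> + u / 4) * w \<le> u / 2 * w"
      using False w by (intro mult_right_mono) auto
    finally have "u * w \<le> 2 * c * \<sigma>" by simp
    then have "w \<le> 2 * c * \<sigma> / u" using u by (simp add: field_simps)
    also have "\<dots> = 2 * c * ((4 * a) powr e / u powr e) / u"
      using assms u unfolding \<sigma>_def by (subst powr_divide) auto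
    also have "\<dots> = 2 * c * (4 * a) powr e * u powr (- (1 + e))"
      using u by (simp only: powr_minus powr_add) (simp add: field_simps)
    also have "\<dots> \<le> C * u powr (- (1 + e))"
      using assms by (intro mult_right_mono) (auto simp: C_def)
    finally show ?thesis .
  qed
  with C show ?thesis unfolding e(2) by blast
qed

section \<open>Absolute convergence of the operators\<close>

context kernel_space
begin

definition c7 :: real where "c7 = cN * (2 * C1) powr q"

lemma c7_pos: "0 < c7"
  using cN_pos C1_ge_1 by (simp add: c7_def)

text \<open>In the distance from \<open>x0\<close> the kernel decays with order \<open>M\<close>,
  while the reciprocal of the weight defining the function class decays at worst with order
  \<open>e + k\<close>, where \<open>k\<close> bounds the volume growth. So the kernel is dominated
  by that reciprocal.\<close>

lemma kernel_integrable:
  fixes f :: "'a \<Rightarrow> complex"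
  assumes t: "0 < t" and f[measurable]: "f \<in> borel_measurable \<mu>"
    and fin: "(\<integral>\<^sup>+z. ennreal (cmod (f z) /
      ((1 + d x0 z) powr e * vol x0 (1 + d x0 z))) \<partial>\<mu>) < \<infinity>"
    and growth: "\<And>l. 1 \<le> l \<Longrightarrow> vol x0 l \<le> C * l powr k" and "e + k \<le> M" "0 < C"
  shows "integrable \<mu> (\<lambda>z. a t x z * f z)"
proof (rule integrableI_bounded)
  have [measurable]: "(\<lambda>z. a t x z) \<in> borel_measurable \<mu>"
    using measurable_Pair2[OF a_measurable[OF t], of x] by (simp add: space_UNIV)
  show "(\<lambda>z. a t x z * f z) \<in> borel_measurable \<mu>" by measurable
  let ?Q = "\<lambda>z. cmod (f z) / ((1 + d x0 z) powr e * vol x0 (1 + d x0 z))"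
  define \<tau> where "\<tau> = t powr (1 / m)"
  have \<tau>: "0 < \<tau>" "\<tau> powr m = t" using t m_pos by (auto simp: \<tau>_def powr_powr)
  define V where "V = vol x \<tau>"
  have V: "0 < V" unfolding V_def by (rule measure_ball_pos[OF \<tau>(1)])
  \<comment> \<open>Absorbs the change of base point from \<open>x0\<close> to \<open>x\<close> and
    the scale: \<open>1 + d x0 z\<close> is at most \<open>A * (1 + d x z / \<tau>)\<close>.\<close>
  define A where "A = 1 + C1 * d x0 x + C1 * \<tau>"
  have A: "0 < A" using d_nonneg[of x0 x] C1_ge_1 \<tau> by (simp add: A_def add_pos_nonneg)
  define K where "K = A powr M * 2 powr M * cg / V * C"
  have K: "0 < K" using A cg_pos V assms by (simp add: K_def)
  have "cmod (a t x z * f z) \<le> K * ?Q z" for z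
  proof -
    let ?d = "1 + d x0 z" and ?s = "d x z / \<tau>"
    have s: "0 \<le> ?s" and d: "1 \<le> ?d" using d_nonneg \<tau> by auto
    have "?d \<le> 1 + C1 * (d x0 x + d x z)" using d_triangle[of x0 z x] by simp
    also have "\<dots> = 1 + C1 * d x0 x + C1 * \<tau> * ?s" using \<tau> by (simp add: algebra_simps)
    also have "\<dots> \<le> A + A * ?s"
    proof (rule add_mono)
      show "1 + C1 * d x0 x \<le> A" using C1_ge_1 \<tau> by (simp add: A_def)
      have "C1 * \<tau> \<le> A" using C1_ge_1 d_nonneg[of x0 x] by (simp add: A_def)
      then show "C1 * \<tau> * ?s \<le> A * ?s" using s by (intro mult_right_mono)
    qed
    also have "\<dots> = A * 1 + A * ?s" by simp
    also have "\<dots> \<le> A * max 1 ?s + A * max 1 ?s"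
      using A by (intro add_mono mult_left_mono) auto
    also have "\<dots> = A * (2 * max 1 ?s)" by simp
    finally have "?d powr M \<le> (A * (2 * max 1 ?s)) powr M"
      using d M_pos by (intro powr_mono2) auto
    then have dM: "?d powr M \<le> A powr M * 2 powr M * max 1 ?s powr M"
      using A by (simp add: powr_mult)
    have g: "max 1 ?s powr M * g (?s powr m) \<le> cg"
      using g_bounded[of "?s powr m"] g_decay[of ?s] by (cases "?s \<le> 1") (auto simp: max_def)
    have g0: "0 \<le> g (?s powr m)" by (rule g_nonneg) simp
    have "h_kernel d \<mu> m g t x z = g (?s powr m) / V"
      using \<tau> d_nonneg[of x z] by (simp add: h_kernel_def V_def \<tau>_def[symmetric] powr_divide)
    then have "?d powr M * cmod (a t x z) \<le> ?d powr M * (g (?s powr m) / V)"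
      using a_bound[OF t, of x z] by (intro mult_left_mono) auto
    also have "\<dots> \<le> A powr M * 2 powr M * max 1 ?s powr M * (g (?s powr m) / V)"
      using dM g0 V by (intro mult_right_mono) auto
    also have "\<dots> = A powr M * 2 powr M * (max 1 ?s powr M * g (?s powr m)) / V" by simp
    also have "\<dots> \<le> A powr M * 2 powr M * cg / V"
      using g V by (intro divide_right_mono mult_left_mono) auto
    finally have 1: "?d powr M * cmod (a t x z) \<le> A powr M * 2 powr M * cg / V" .
    have vol: "0 < measure \<mu> (qball d x0 ?d)" using d by (intro measure_ball_pos) auto
    have "?d powr e * measure \<mu> (qball d x0 ?d) \<le> ?d powr e * (C * ?d powr k)"
      using d by (intro mult_left_mono growth) auto
    also have "\<dots> = C * ?d powr (e + k)" by (simp add: powr_add)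
    also have "\<dots> \<le> C * ?d powr M" using d assms by (intro mult_left_mono powr_mono) auto
    finally have 2: "?d powr e * measure \<mu> (qball d x0 ?d) \<le> C * ?d powr M" .
    have "cmod (a t x z) * (?d powr e * measure \<mu> (qball d x0 ?d)) \<le> cmod (a t x z) * (C * ?d powr M)"
      using 2 by (intro mult_left_mono) auto
    also have "\<dots> \<le> K" using 1 assms(6) mult_left_mono[of "?d powr M * cmod (a t x z)" "A powr M * 2 powr M * cg / V" C]
      by (simp add: K_def mult_ac)
    finally have "cmod (a t x z) \<le> K / (?d powr e * measure \<mu> (qball d x0 ?d))"
      using vol d by (simp add: pos_le_divide_eq)
    then have "cmod (a t x z) * cmod (f z) \<le> K / (?d powr e * measure \<mu> (qball d x0 ?d)) * cmod (f z)"
      by (intro mult_right_mono) auto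
    then show ?thesis by (simp add: norm_mult)
  qed
  then have "(\<integral>\<^sup>+z. ennreal (norm (a t x z * f z)) \<partial>\<mu>) \<le> (\<integral>\<^sup>+z. ennreal K * ennreal (?Q z) \<partial>\<mu>)"
    using K by (intro nn_integral_mono) (simp add: ennreal_mult'[symmetric] ennreal_leI)
  also have "\<dots> \<le> ennreal K * (\<integral>\<^sup>+z. ennreal (?Q z) \<partial>\<mu>)"
  proof -
    \<comment> \<open>The volume is monotone in the radius, hence Borel; together with the
      measurability of the distance, whose sublevel sets are balls, this makes the weight of the
      class measurable.\<close>
    have mono: "(\<lambda>r. vol x0 r) \<in> borel_measurable borel"
      by (intro borel_measurable_mono monoI measure_mono_fmeasurable qball_mono ball_sets)
        (use ball_sets ball_finite in \<open>auto simp: fmeasurable_def\<close>)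
    have [measurable]: "(\<lambda>z. d x0 z) \<in> borel_measurable \<mu>"
    proof (rule borel_measurableI_less)
      fix r
      have "{z \<in> space \<mu>. d x0 z < r} = qball d x0 r"
        using d_sym by (auto simp: qball_def space_UNIV)
      then show "{z \<in> space \<mu>. d x0 z < r} \<in> sets \<mu>" using ball_sets by simp
    qed
    have [measurable]: "(\<lambda>z. vol x0 (1 + d x0 z)) \<in> borel_measurable \<mu>"
      using measurable_compose[OF _ mono, of "\<lambda>z. 1 + d x0 z" \<mu>] by simp
    show ?thesis by (subst nn_integral_cmult) auto
  qed
  also have "\<dots> < \<infinity>" using fin by (simp add: ennreal_mult_less_top)
  finally show "(\<integral>\<^sup>+z. ennreal (norm (a t x z * f z)) \<partial>\<mu>) < \<infinity>" .
qed

end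

section \<open>From oscillation integrals to masses of level sets\<close>

context bmo_function
begin

lemma mass_le_oscillation:
  assumes "0 < t" "E \<in> sets \<mu>" "0 < l" "\<And>y. y \<in> E \<Longrightarrow> l * \<phi> y t \<le> D R y"
  shows "ennreal l * phi_mass \<mu> \<phi> E t \<le> osc R E"
proof -
  have "ennreal l * phi_mass \<mu> \<phi> E t = (\<integral>\<^sup>+v. ennreal l * (ennreal (\<phi> v t) * indicator E v) \<partial>\<mu>)"
    unfolding phi_mass_def using phi_measurable[of t] assms by (subst nn_integral_cmult) auto
  also have "\<dots> \<le> osc R E"
    using assms(3,4) phi_pos[OF assms(1)]
    by (intro nn_integral_mono) (auto simp: indicator_def ennreal_mult'[symmetric] intro!: ennreal_leI)
  finally show ?thesis .
qed

text \<open>The iteration needs the level \<open>t\<close> of the double ball, whereas the level set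
  concerns the larger level \<open>t0\<close> of \<open>B\<close> itself. Weights increase with the
  level, and \<open>b / t\<close> exceeds \<open>b * N x R\<close> only by the doubling factor
  \<open>c7\<close>. The exponent \<open>p1\<close> is independent of the \<open>p\<close> used for
  the kernel bounds.\<close>

lemma level_estimate:
  fixes s :: "nat \<Rightarrow> real"
  assumes R: "0 < R" and p1: "1 \<le> p1" "0 < A1" and s: "\<And>j. 0 < s j"
    and comp: "\<And>t x r E. 0 < t \<Longrightarrow> 0 < r \<Longrightarrow> E \<in> sets \<mu> \<Longrightarrow> E \<subseteq> qball d x r \<Longrightarrow>
      W t (qball d x r) * (measure \<mu> E / vol x r) powr p1 \<le> A1 * W t E"
    and E: "E \<in> sets \<mu>" "E \<subseteq> qball d x R"
    and l: "0 < l" "\<And>y. y \<in> E \<Longrightarrow> l * \<phi> y (1 / N x R) \<le> D R y"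
  shows "l * W (1 / N x R) E \<le> c7 * b * N x R *
    ((\<beta> + (\<Sum>j<k. 2 * c5 * (A1 * s j powr (1 - p1)))) * W (1 / N x R) E +
     ((\<Sum>j<k. 2 * c5 * s j * (1/2) ^ j) + c2 * (1/2) ^ k) * (2 * cU))"
proof -
  let ?B = "qball d x R"
  define t where "t = 1 / N x (2 * C1 * R)"
  define t0 where "t0 = 1 / N x R"
  have N0: "0 < N x R" "0 < N x (2 * C1 * R)" using N_pos R C1_ge_1 by auto
  have R2: "R \<le> 2 * C1 * R" using R C1_ge_1 by (simp add: mult_le_cancel_right1)
  have NN: "N x R \<le> N x (2 * C1 * R)"
    using R R2 C1_ge_1 by (intro N_mono qball_mono) auto
  have t: "0 < t" "0 < t0" "t \<le> t0" using N0 NN by (auto simp: t_def t0_def frac_le)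
  have Wt: "W t A \<le> W t0 A" if "A \<in> sets \<mu>" "A \<subseteq> ?B" for A
    using W_le[OF t(2,1) R that, of 1] phi_mono[of t t0] t by simp
  define a1 where "a1 = \<beta> + (\<Sum>j<k. 2 * c5 * (A1 * s j powr (1 - p1)))"
  define a2 where "a2 = (\<Sum>j<k. 2 * c5 * s j * (1/2) ^ j) + c2 * (1/2) ^ k"
  have s0: "0 \<le> s j" for j using s[of j] by simp
  have a: "0 \<le> a1" "0 \<le> a2"
    using \<beta>_pos c5_pos c2_pos s0 p1 by (auto simp: a1_def a2_def intro!: add_nonneg_nonneg sum_nonneg)
  have "osc R E \<le> ennreal (b / t * (a1 * W t E + a2 * W t ?B))"
    unfolding a1_def a2_def
  proof (rule iterated_estimate[OF t(1)])
    show "0 \<le> s j" for j by (rule s0)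
    show "0 \<le> A1 * s j powr (1 - p1)" for j using p1 by simp
    show "0 < R" "t * N x (2 * C1 * R) \<le> 1" "E \<in> sets \<mu>" "E \<subseteq> ?B"
      using R N0 E by (auto simp: t_def)
    fix j x r F assume r: "0 < r" and F: "F \<in> sets \<mu>" "F \<subseteq> qball d x r"
    let ?w = "W t (qball d x r)" and ?m = "measure \<mu> F / vol x r"
    have m: "0 \<le> ?m" by simp
    show "?w / vol x r * measure \<mu> F \<le> s j * ?w + A1 * s j powr (1 - p1) * W t F"
    \<comment> \<open>A relative measure up to \<open>s j\<close> gives the first summand. If it is
      larger, write it as its power \<open>p1\<close> times its power \<open>1 - p1\<close>; the
      latter is at most \<open>s j powr (1 - p1)\<close>, and the former is handled by
      \<open>comp\<close>.\<close>
    proof (cases "?m \<le> s j")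
      case True
      then have "?w * ?m \<le> ?w * s j" by (intro mult_left_mono) auto
      moreover have "0 \<le> A1 * s j powr (1 - p1) * W t F" using p1 by simp
      ultimately show ?thesis by (simp add: mult.commute)
    next
      case False
      then have m0: "0 < ?m" using s[of j] by linarith
      have "?m = ?m powr p1 * ?m powr (1 - p1)"
        using m0 by (simp only: powr_add[symmetric]) simp
      also have "\<dots> \<le> ?m powr p1 * s j powr (1 - p1)"
        using False s[of j] p1 by (intro mult_left_mono powr_mono2') auto
      finally have "?w * ?m \<le> ?w * (?m powr p1 * s j powr (1 - p1))" by (intro mult_left_mono) auto
      also have "\<dots> = (?w * ?m powr p1) * s j powr (1 - p1)" by (simp only: mult.assoc)
      also have "\<dots> \<le> (A1 * W t F) * s j powr (1 - p1)"
        using comp[OF t(1) r F] by (intro mult_right_mono) auto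
      also have "\<dots> = A1 * s j powr (1 - p1) * W t F" by simp
      finally have "?w * ?m \<le> A1 * s j powr (1 - p1) * W t F" .
      moreover have "0 \<le> s j * ?w" using s0 by simp
      ultimately show ?thesis by simp
    qed
  qed
  also have "\<dots> \<le> ennreal (c7 * b * N x R * (a1 * W t0 E + a2 * (2 * cU)))"
  proof (intro ennreal_leI mult_mono add_mono)
    have "b / t = b * N x (2 * C1 * R)" by (simp add: t_def)
    also have "\<dots> \<le> b * (cN * (2 * C1) powr q * N x R)"
      using b_pos C1_ge_1 by (intro mult_left_mono N_doubling R) auto
    finally show "b / t \<le> c7 * b * N x R" by (simp add: c7_def mult_ac)
    show "W t E \<le> W t0 E" by (rule Wt[OF E])
    have "W t0 ?B \<le> 2 * cU" unfolding t0_def by (rule W_norm[OF R])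
    then show "W t ?B \<le> 2 * cU" using Wt[OF ball_sets subset_refl] by linarith
  qed (use a b_pos c7_pos N0 in auto)
  finally have up: "osc R E \<le> ennreal (c7 * b * N x R * (a1 * W t0 E + a2 * (2 * cU)))" .
  have "ennreal (l * W t0 E) = ennreal l * phi_mass \<mu> \<phi> E t0"
    using emeasure_wt_ball[OF t(2) R E] emeasure_wt[of t0 E] t E l by (simp add: ennreal_mult')
  also have "\<dots> \<le> osc R E"
    using l(2) unfolding t0_def[symmetric] by (rule mass_le_oscillation[OF t(2) E(1) l(1)])
  also note up
  finally show ?thesis
    using a c7_pos b_pos N0 cU_ge_1 unfolding t0_def a1_def[symmetric] a2_def[symmetric]
    by (subst (asm) ennreal_le_iff) auto
qed

end

section \<open>Muckenhoupt weights\<close>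

context doubling_space
begin

text \<open>This replaces the supremum over averages by an inequality between masses, where the dual
  weight no longer occurs. For \<open>p = 1\<close> the essential supremum bounds the weight below
  on the ball; for \<open>p > 1\<close> an elementary pointwise inequality with a free constant
  brings in the dual average.\<close>

lemma muckenhoupt_compare:
  assumes meas: "\<And>t. 0 < t \<Longrightarrow> (\<lambda>x. \<phi> x t) \<in> borel_measurable \<mu>"
    and pos: "\<And>x t. 0 < t \<Longrightarrow> 0 < \<phi> x t"
    and p: "1 \<le> p" "\<phi> \<in> muckenhoupt d \<mu> p"
  shows "\<exists>A>0. \<forall>t>0. \<forall>x. \<forall>r>0. phi_mass \<mu> \<phi> (qball d x r) t < \<infinity> \<and>
    (\<forall>E\<in>sets \<mu>. E \<subseteq> qball d x r \<longrightarrow>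
      enn2real (phi_mass \<mu> \<phi> (qball d x r) t) * (measure \<mu> E / vol x r) powr p
      \<le> A * enn2real (phi_mass \<mu> \<phi> E t))"
proof -
  define dual where "dual t B = (if p = 1
      then esssup (restrict_space \<mu> B) (\<lambda>y. inverse (ennreal (\<phi> y t)))
      else enn_powr (average \<mu> B (\<lambda>y. enn_powr (inverse (ennreal (\<phi> y t))) (1 / (p - 1)))) (p - 1))" for t B
  define S where "S = (SUP t\<in>{0<..}. SUP (x, r)\<in>UNIV \<times> {0<..}.
    average \<mu> (qball d x r) (\<lambda>y. ennreal (\<phi> y t)) * dual t (qball d x r))"
  have "S < \<infinity>"
    using p(2) by (cases "p = 1") (simp_all add: muckenhoupt_def S_def dual_def)
  define K where "K = enn2real S"
  have S: "S = ennreal K" using \<open>S < \<infinity>\<close> by (simp add: K_def)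
  have K: "0 \<le> K" by (simp add: K_def)
  \<comment> \<open>Large enough for both cases of the exponent; the summand 1 keeps it
    positive.\<close>
  define A where "A = 2 powr p * K + K + 1"
  have A: "0 < A" "K \<le> A" "2 powr p * K \<le> A" using K by (auto simp: A_def add_nonneg_pos)
  have "phi_mass \<mu> \<phi> (qball d x r) t < \<infinity> \<and>
    (\<forall>E\<in>sets \<mu>. E \<subseteq> qball d x r \<longrightarrow>
      enn2real (phi_mass \<mu> \<phi> (qball d x r) t) * (measure \<mu> E / vol x r) powr p
      \<le> A * enn2real (phi_mass \<mu> \<phi> E t))" if t: "0 < t" and r: "0 < r" for t x r
  proof -
    let ?B = "qball d x r"
    define v where "v = measure \<mu> ?B"
    define I where "I = phi_mass \<mu> \<phi> ?B t"
    have [measurable]: "(\<lambda>x. \<phi> x t) \<in> borel_measurable \<mu>" "?B \<in> sets \<mu>"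
      using meas[OF t] ball_sets by auto
    have v: "0 < v" "emeasure \<mu> ?B = ennreal v"
      unfolding v_def using measure_ball_pos[OF r] emeasure_ball by auto
    have avg: "average \<mu> ?B F = (\<integral>\<^sup>+y\<in>?B. F y \<partial>\<mu>) / ennreal v" for F
      by (simp add: average_def v)
    have "average \<mu> ?B (\<lambda>y. ennreal (\<phi> y t)) * dual t ?B \<le> S"
      unfolding S_def using t r by (intro SUP_upper2[of t] SUP_upper2[of "(x, r)"]) auto
    then have prod: "I / ennreal v * dual t ?B \<le> ennreal K"
      unfolding avg I_def phi_mass_def S .
    have I0: "I \<noteq> 0"
      unfolding I_def phi_mass_def using pos[OF t]
      by (intro ball_integral_neq_0 r) (auto simp: ennreal_eq_0_iff not_le)
    have Iv: "I / ennreal v \<noteq> 0" using I0 by (simp add: ennreal_divide_eq_0_iff)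
    \<comment> \<open>In \<open>ennreal\<close> a product of 0 and infinity is 0, so the bound on
      the product yields finiteness of the mass only after the dual factor is known to be nonzero,
      and conversely.\<close>
    have dual0: "dual t ?B \<noteq> 0"
    proof (cases "p = 1")
      case True
      have "dual t ?B \<noteq> 0"
      proof
        assume "dual t ?B = 0"
        then have "AE y in restrict_space \<mu> ?B. inverse (ennreal (\<phi> y t)) \<le> 0"
          using esssup_AE[where M = "restrict_space \<mu> ?B" and f = "\<lambda>y. inverse (ennreal (\<phi> y t))"] True
          by (simp add: dual_def)
        then have "AE y in \<mu>. y \<in> ?B \<longrightarrow> inverse (ennreal (\<phi> y t)) \<le> 0"
          by (simp add: AE_restrict_space_iff space_UNIV)
        then have "AE y in \<mu>. y \<notin> ?B" by eventually_elim auto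
        then have "emeasure \<mu> ?B = 0"
          by (subst (asm) AE_iff_measurable[OF ball_sets]) (auto simp: space_UNIV)
        then show False using v by simp
      qed
      then show ?thesis .
    next
      case False
      let ?h = "\<lambda>y. enn_powr (inverse (ennreal (\<phi> y t))) (1 / (p - 1))"
      have "?h y = ennreal (\<phi> y t powr (- (1 / (p - 1))))" for y
        using pos[OF t, of y] by (simp add: enn_powr_def inverse_ennreal powr_minus inverse_powr)
      then have "(\<integral>\<^sup>+y\<in>?B. ?h y \<partial>\<mu>) \<noteq> 0"
        using pos[OF t] by (intro ball_integral_neq_0 r) (auto simp: ennreal_eq_0_iff not_le less_imp_neq[symmetric])
      then have "average \<mu> ?B ?h \<noteq> 0" by (simp add: avg ennreal_divide_eq_0_iff)
      then show ?thesis
        using False by (auto simp: dual_def enn_powr_def ennreal_eq_0_iff enn2real_eq_0_iff top_unique)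
    qed
    have "I \<noteq> \<infinity>"
      using prod dual0 by (auto simp: ennreal_top_divide ennreal_top_mult top_unique)
    then obtain i where i: "I = ennreal i" "0 < i"
      using I0 by (cases I) (auto simp: ennreal_eq_0_iff not_le)
    have "dual t ?B \<noteq> \<infinity>"
      using prod Iv by (auto simp: ennreal_mult_top top_unique)
    then obtain e where e: "dual t ?B = ennreal e" "0 < e"
      using dual0 by (cases "dual t ?B") (auto simp: ennreal_eq_0_iff not_le)
    have ie: "i / v * e \<le> K"
      using prod i e v K by (simp add: divide_ennreal ennreal_mult'[symmetric])
    have cmp: "i * (measure \<mu> E / v) powr p \<le> A * enn2real (phi_mass \<mu> \<phi> E t)"
      if E[measurable]: "E \<in> sets \<mu>" and EB: "E \<subseteq> ?B" for E
    proof -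
      have "phi_mass \<mu> \<phi> E t \<le> I"
        unfolding I_def phi_mass_def using EB by (intro nn_integral_mono) (auto simp: indicator_def)
      then obtain w where w: "phi_mass \<mu> \<phi> E t = ennreal w" "0 \<le> w"
        using i by (cases "phi_mass \<mu> \<phi> E t") (auto simp: top_unique)
      define \<epsilon> where "\<epsilon> = measure \<mu> E"
      have "emeasure \<mu> E \<le> emeasure \<mu> ?B" using EB by (intro emeasure_mono) auto
      then have \<epsilon>: "emeasure \<mu> E = ennreal \<epsilon>"
        unfolding \<epsilon>_def using v by (intro emeasure_eq_ennreal_measure) (auto simp: top_unique)
      have int_w: "(\<integral>\<^sup>+y. ennreal c * (ennreal (\<phi> y t) * indicator E y) \<partial>\<mu>) = ennreal (c * w)" if "0 \<le> c" for c
        using w that by (subst nn_integral_cmult) (auto simp: phi_mass_def ennreal_mult')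
      show ?thesis
      proof (cases "p = 1")
        case True
        have "AE y in restrict_space \<mu> ?B. inverse (ennreal (\<phi> y t)) \<le> ennreal e"
          using esssup_AE[where M = "restrict_space \<mu> ?B" and f = "\<lambda>y. inverse (ennreal (\<phi> y t))"] True e
          by (simp add: dual_def)
        then have "AE y in \<mu>. y \<in> ?B \<longrightarrow> inverse (ennreal (\<phi> y t)) \<le> ennreal e"
          by (simp add: AE_restrict_space_iff space_UNIV)
        then have "AE y in \<mu>. indicator E y \<le> ennreal e * (ennreal (\<phi> y t) * indicator E y)"
        proof eventually_elim
          case (elim y)
          show ?case
          proof (cases "y \<in> E")
            case True
            then have "inverse (\<phi> y t) \<le> e"
              using elim EB pos[OF t, of y] e by (auto simp: inverse_ennreal)
            then have "1 \<le> e * \<phi> y t" using pos[OF t, of y] by (simp add: field_simps)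
            then have "ennreal 1 \<le> ennreal (e * \<phi> y t)" by (rule ennreal_leI)
            then show ?thesis
              using True e by (simp add: ennreal_mult')
          qed simp
        qed
        then have "(\<integral>\<^sup>+y. indicator E y \<partial>\<mu>) \<le> (\<integral>\<^sup>+y. ennreal e * (ennreal (\<phi> y t) * indicator E y) \<partial>\<mu>)"
          by (rule nn_integral_mono_AE)
        then have "\<epsilon> \<le> e * w" using \<epsilon> e w int_w[of e] by simp
        then have "i / v * \<epsilon> \<le> i / v * (e * w)" using i v by (intro mult_left_mono) auto
        also have "\<dots> = i / v * e * w" by simp
        also have "\<dots> \<le> A * w" using ie A w by (intro mult_right_mono) auto
        finally show ?thesis
          using True w v unfolding \<epsilon>_def by simp
      next
        case False
        then have p1: "1 < p" using p by simp
        define u where "u = 1 / (p - 1)"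
        have u: "0 < u" "u * (p - 1) = 1" using p1 by (auto simp: u_def)
        have h: "enn_powr (inverse (ennreal (\<phi> y t))) u = ennreal (\<phi> y t powr (- u))" for y
          using pos[OF t, of y] by (simp add: enn_powr_def inverse_ennreal powr_minus inverse_powr)
        define s where "s = (\<integral>\<^sup>+y\<in>?B. ennreal (\<phi> y t powr (- u)) \<partial>\<mu>)"
        have e_eq: "enn_powr (s / ennreal v) (p - 1) = ennreal e"
          using e(1) False by (simp add: dual_def avg u_def[symmetric] h s_def)
        then have "s \<noteq> \<infinity>" by (auto simp: enn_powr_def ennreal_top_divide)
        moreover have "s \<noteq> 0"
          unfolding s_def using pos[OF t]
          by (intro ball_integral_neq_0 r) (auto simp: ennreal_eq_0_iff not_le less_imp_neq[symmetric])
        ultimately obtain s' where s': "s = ennreal s'" "0 < s'"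
          by (cases s) (auto simp: ennreal_eq_0_iff not_le)
        have es: "e = (s' / v) powr (p - 1)"
          using e_eq s' v e by (simp add: enn_powr_def divide_ennreal)
        show ?thesis
        proof (cases "\<epsilon> = 0")
          case True
          then show ?thesis using w A by (simp add: \<epsilon>_def[symmetric])
        next
          case False
          then have \<epsilon>0: "0 < \<epsilon>" by (simp add: \<epsilon>_def less_le)
          define c where "c = (2 * s' / \<epsilon>) powr (p - 1)"
          have c: "0 < c" using s' \<epsilon>0 by (simp add: c_def)
          have "c powr (- u) = (2 * s' / \<epsilon>) powr (- 1)"
            unfolding c_def powr_powr using u by (simp add: mult.commute)
          also have "\<dots> = \<epsilon> / (2 * s')" using s' \<epsilon>0 by (simp add: powr_minus)
          finally have cu: "c powr (- u) * s' = \<epsilon> / 2" using s' by simp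
          (* replaces Hoelder's inequality; c is chosen so that the dual term integrates to half of \<mu>(E) *)
          have pw: "1 \<le> c * \<phi> y t + c powr (- u) * \<phi> y t powr (- u)" for y
          proof (cases "1 \<le> c * \<phi> y t")
            case True
            then show ?thesis by (simp add: add_increasing2)
          next
            case False
            have z: "0 < c * \<phi> y t" using c pos[OF t, of y] by simp
            have "1 \<le> (c * \<phi> y t) powr (- u)"
              using powr_mono2'[of "- u" "c * \<phi> y t" 1] z False u by simp
            also have "\<dots> = c powr (- u) * \<phi> y t powr (- u)"
              by (rule powr_mult)
            finally show ?thesis using z by linarith
          qed
          have "ennreal \<epsilon> = (\<integral>\<^sup>+y. indicator E y \<partial>\<mu>)" using \<epsilon> by simp
          also have "\<dots> \<le> (\<integral>\<^sup>+y. ennreal c * (ennreal (\<phi> y t) * indicator E y) +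
              ennreal (c powr (- u)) * (ennreal (\<phi> y t powr (- u)) * indicator ?B y) \<partial>\<mu>)"
          proof (rule nn_integral_mono)
            fix y
            show "indicator E y \<le> ennreal c * (ennreal (\<phi> y t) * indicator E y) +
              ennreal (c powr (- u)) * (ennreal (\<phi> y t powr (- u)) * indicator ?B y)"
            proof (cases "y \<in> E")
              case True
              have "ennreal 1 \<le> ennreal (c * \<phi> y t + c powr (- u) * \<phi> y t powr (- u))"
                by (rule ennreal_leI[OF pw])
              also have "\<dots> = ennreal c * ennreal (\<phi> y t) + ennreal (c powr (- u)) * ennreal (\<phi> y t powr (- u))"
                using c pos[OF t, of y] by (simp add: ennreal_mult' ennreal_plus)
              finally show ?thesis using True EB by auto
            qed simp
          qed
          also have "\<dots> = (\<integral>\<^sup>+y. ennreal c * (ennreal (\<phi> y t) * indicator E y) \<partial>\<mu>) +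
              (\<integral>\<^sup>+y. ennreal (c powr (- u)) * (ennreal (\<phi> y t powr (- u)) * indicator ?B y) \<partial>\<mu>)"
            by (rule nn_integral_add) measurable
          also have "\<dots> = ennreal (c * w) + ennreal (c powr (- u)) * s"
            unfolding int_w[OF less_imp_le[OF c]] s_def by (subst nn_integral_cmult) auto
          also have "\<dots> = ennreal (c * w + \<epsilon> / 2)"
            using c w cu s' \<epsilon>0 by (simp add: ennreal_mult'[symmetric] ennreal_plus[symmetric] del: ennreal_plus)
          finally have "\<epsilon> \<le> c * w + \<epsilon> / 2"
            using c w \<epsilon>0 by (subst (asm) ennreal_le_iff) auto
          then have ecw: "\<epsilon> \<le> 2 * c * w" by simp
          \<comment> \<open>One factor is bounded by \<open>ecw\<close>; in the others \<epsilon>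
            cancels against the \<epsilon> in \<open>c\<close>, which leaves the dual factor
            \<open>e\<close> times \<open>2 powr (p - 1)\<close>.\<close>
          have "(\<epsilon> / v) powr p = (\<epsilon> / v) powr (p - 1) * (\<epsilon> / v)"
            using \<epsilon>0 v powr_add[of "\<epsilon> / v" "p - 1" 1] by simp
          also have "\<dots> \<le> (\<epsilon> / v) powr (p - 1) * (2 * c * w / v)"
            using ecw v by (intro mult_left_mono divide_right_mono) auto
          also have "\<dots> = ((\<epsilon> / v) powr (p - 1) * c) * (2 * w / v)" by simp
          also have "(\<epsilon> / v) powr (p - 1) * c = (\<epsilon> / v * (2 * s' / \<epsilon>)) powr (p - 1)"
            unfolding c_def by (rule powr_mult[symmetric])
          also have "\<epsilon> / v * (2 * s' / \<epsilon>) = 2 * (s' / v)" using \<epsilon>0 by simp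
          also have "(2 * (s' / v)) powr (p - 1) = 2 powr (p - 1) * e"
            unfolding es by (rule powr_mult)
          finally have "i * (\<epsilon> / v) powr p \<le> i * (2 powr (p - 1) * e * (2 * w / v))"
            using i by (intro mult_left_mono) auto
          also have "\<dots> = (2 powr (p - 1) * 2) * (i / v * e) * w" by simp
          also have "2 powr (p - 1) * 2 = (2::real) powr p" by (simp add: powr_diff)
          also have "2 powr p * (i / v * e) * w \<le> A * w"
          proof (intro mult_right_mono w)
            have "2 powr p * (i / v * e) \<le> 2 powr p * K" using ie by (intro mult_left_mono) auto
            then show "2 powr p * (i / v * e) \<le> A" using A by linarith
          qed
          finally show ?thesis using w by (simp add: \<epsilon>_def)
        qed
      qed
    qed
    show ?thesis
      using cmp i by (auto simp: I_def[symmetric] v_def[symmetric])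
  qed
  with A show ?thesis by blast
qed

end

section \<open>Extraction of the structure constants\<close>

lemma homogeneous_cond_D:
  assumes "homogeneous_space d \<mu>"
  shows "\<exists>n. cond_D d \<mu> n"
proof -
  have sets: "qball d x r \<in> sets \<mu>" and fin: "emeasure \<mu> (qball d x r) < \<infinity>" if "0 < r" for x r
    using assms that by (auto simp: homogeneous_space_def)
  obtain C2 where C2: "1 \<le> C2" "\<And>x r. 0 < r \<Longrightarrow>
      emeasure \<mu> (qball d x (2 * r)) \<le> ennreal C2 * emeasure \<mu> (qball d x r)"
    using assms unfolding homogeneous_space_def by blast
  have em: "emeasure \<mu> (qball d x r) = ennreal (measure \<mu> (qball d x r))" if "0 < r" for x r
    using fin[OF that] by (simp add: emeasure_eq_ennreal_measure less_top[symmetric])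
  have double: "measure \<mu> (qball d x (2 * r)) \<le> C2 * measure \<mu> (qball d x r)" if "0 < r" for x r
    using C2(2)[OF that, of x] C2(1) em[of r x] em[of "2 * r" x] that by (simp add: ennreal_mult'[symmetric])
  have pow: "measure \<mu> (qball d x (2 ^ k * r)) \<le> C2 ^ k * measure \<mu> (qball d x r)" if "0 < r" for x r k
  proof (induction k)
    case (Suc k)
    have "measure \<mu> (qball d x (2 ^ Suc k * r)) \<le> C2 * measure \<mu> (qball d x (2 ^ k * r))"
      using double[of "2 ^ k * r" x] that by (simp add: mult.assoc)
    also have "\<dots> \<le> C2 * (C2 ^ k * measure \<mu> (qball d x r))"
      using Suc C2(1) by (intro mult_left_mono) auto
    finally show ?case by simp
  qed simp
  \<comment> \<open>The summand 1 makes the exponent positive even for doubling constant 1.\<close>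
  define n where "n = log 2 C2 + 1"
  have n: "0 < n" using C2(1) by (simp add: n_def add_nonneg_pos zero_le_log_cancel_iff)
  have "measure \<mu> (qball d x (l * r)) \<le> C2 * l powr n * measure \<mu> (qball d x r)"
    if "0 < r" "1 \<le> l" for x r l
  proof -
    define k where "k = nat \<lceil>log 2 l\<rceil>"
    have l0: "0 \<le> log 2 l" using that by simp
    have k: "log 2 l \<le> real k" "real k \<le> log 2 l + 1"
      using l0 by (auto simp: k_def)
    have "l = 2 powr log 2 l" using that by simp
    also have "\<dots> \<le> 2 powr real k" using k by (intro powr_mono) auto
    finally have lk: "l \<le> 2 ^ k" by (simp add: powr_realpow)
    then have lr: "l * r \<le> 2 ^ k * r" using that by (intro mult_right_mono) auto
    have "qball d x u \<subseteq> qball d x v" if "u \<le> v" for u v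
      using that by (auto simp: qball_def)
    from this[OF lr] have "measure \<mu> (qball d x (l * r)) \<le> measure \<mu> (qball d x (2 ^ k * r))"
      using that sets fin
      by (intro measure_mono_fmeasurable) (auto simp: fmeasurable_def)
    also have "\<dots> \<le> C2 ^ k * measure \<mu> (qball d x r)" by (rule pow[OF that(1)])
    also have "\<dots> \<le> C2 * l powr n * measure \<mu> (qball d x r)"
    proof (rule mult_right_mono)
      have "C2 ^ k = C2 powr real k" using C2(1) by (simp add: powr_realpow)
      also have "\<dots> \<le> C2 powr (log 2 l + 1)" using k C2(1) by (intro powr_mono) auto
      also have "\<dots> = C2 * C2 powr (log 2 l)" using C2(1) by (simp add: powr_add)
      also have "C2 powr (log 2 l) = l powr (log 2 C2)"
        using C2(1) that by (simp add: powr_def log_def)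
      also have "\<dots> \<le> l powr n" using that by (intro powr_mono) (auto simp: n_def)
      finally show "C2 ^ k \<le> C2 * l powr n" using C2(1) by (simp add: mult_left_mono)
    qed simp
    finally show ?thesis .
  qed
  then show ?thesis using n unfolding cond_D_def by blast
qed

lemma homogeneous_doubling_space:
  assumes h: "homogeneous_space d \<mu>" and n: "cond_D d \<mu> n"
  shows "\<exists>C1 cD. doubling_space d \<mu> C1 cD n"
proof -
  have q: "quasi_metric d" using h by (simp only: homogeneous_space_def)
  have qm: "0 \<le> d x y" "d x y = 0 \<longleftrightarrow> x = y" "d x y = d y x" for x y
    using q by (simp_all only: quasi_metric_def)
  obtain C1 where C1: "1 \<le> C1" "\<forall>x y z. d x y \<le> C1 * (d x z + d z y)"
    using q unfolding quasi_metric_def by (elim conjE exE)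
  have balls: "qball d x r \<in> sets \<mu>" "0 < emeasure \<mu> (qball d x r)" "emeasure \<mu> (qball d x r) < \<infinity>"
    if "0 < r" for x r
    using h that by (auto simp: homogeneous_space_def)
  have empty: "qball d x r = {}" if "\<not> 0 < r" for x r
    using that qm(1)[of _ x] unfolding qball_def
    by (metis (mono_tags, lifting) Collect_empty_eq order_le_less_trans)
  obtain C where C: "\<And>x r l. 0 < r \<Longrightarrow> 1 \<le> l \<Longrightarrow>
      measure \<mu> (qball d x (l * r)) \<le> C * l powr n * measure \<mu> (qball d x r)"
    using n unfolding cond_D_def by blast
  have "doubling_space d \<mu> C1 (max 1 C) n"
  proof
    show "qball d x r \<in> sets \<mu>" "emeasure \<mu> (qball d x r) < \<infinity>" for x r
      using balls[of r x] empty[of r x] by (cases "0 < r"; simp)+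
    show "measure \<mu> (qball d x (l * r)) \<le> max 1 C * l powr n * measure \<mu> (qball d x r)"
      if "0 < r" "1 \<le> l" for x r l
      by (rule order_trans[OF C[OF that]]) (intro mult_right_mono, auto)
  qed (use h qm C1 balls n in \<open>auto simp: homogeneous_space_def cond_D_def\<close>)
  then show ?thesis by blast
qed

lemma deg_n_nonneg: "homogeneous_space d \<mu> \<Longrightarrow> 0 \<le> deg_n d \<mu>"
  unfolding deg_n_def using homogeneous_cond_D[of d \<mu>]
  by (intro cInf_greatest) (auto simp: cond_D_def)

text \<open>Serves to deduce \<open>deg_n * p_index / i_index < M\<close> from the lower bound for
  \<open>M\<close>. The exponent 0 always satisfies \<open>cond_R\<close>, so the supremum is over a
  nonempty set.\<close>

lemma deg_alpha_le_deg_n: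
  assumes "homogeneous_space d \<mu>"
  shows "deg_alpha d \<mu> \<le> deg_n d \<mu>"
proof -
  obtain k C1 cD where "doubling_space d \<mu> C1 cD k"
    using homogeneous_cond_D[OF assms] homogeneous_doubling_space[OF assms] by blast
  then interpret doubling_space d \<mu> C1 cD k .
  have "cond_R d \<mu> 0"
    unfolding cond_R_def
  proof (intro conjI allI impI exI[of _ 1])
    show "0 \<le> n" if "cond_D d \<mu> n" for n using that by (simp add: cond_D_def)
    fix x r l assume "0 < r \<and> ereal r < 2 * qdiam d \<and> 1 \<le> l \<and> ereal l < 2 * qdiam d / ereal r"
    then have "r \<le> l * r" "1 \<le> l" by auto
    then show "inverse 1 * l powr 0 * measure \<mu> (qball d x r) \<le> measure \<mu> (qball d x (l * r))"
      using ball_sets ball_finite measure_mono_fmeasurable[OF qball_mono[of r "l * r" x]]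
      by (simp add: fmeasurable_def)
  qed auto
  then have "{\<alpha>. cond_R d \<mu> \<alpha>} \<noteq> {}" by blast
  moreover have "{n. cond_D d \<mu> n} \<noteq> {}" using homogeneous_cond_D[OF assms] by blast
  moreover have "\<alpha> \<le> n" if "cond_R d \<mu> \<alpha>" "cond_D d \<mu> n" for \<alpha> n
    using that unfolding cond_R_def by blast
  ultimately show ?thesis
    unfolding deg_alpha_def deg_n_def by (blast intro!: cSup_least cInf_greatest)
qed

text \<open>Going from 1 down to \<open>s\<close> by lower type and back by upper type 1 costs
  \<open>K * s powr (p - 1)\<close>, which must be at least 1 and would tend to 0 with
  \<open>s\<close> if \<open>p > 1\<close>. The set defining \<open>i_index\<close> is thus bounded,
  and its supremum is meaningful.\<close>

lemma lower_type_le_1: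
  assumes pos: "\<And>x t. 0 < t \<Longrightarrow> 0 < \<phi> x t" and "upper_type \<phi> 1" "lower_type \<phi> p"
  shows "p \<le> 1"
proof (rule ccontr)
  assume "\<not> p \<le> 1"
  obtain C where C: "\<And>x t s. 0 \<le> t \<Longrightarrow> 1 \<le> s \<Longrightarrow> \<phi> x (s * t) \<le> C * s powr 1 * \<phi> x t"
    using assms unfolding upper_type_def by blast
  obtain C' where C': "\<And>x t s. 0 \<le> t \<Longrightarrow> s \<in> {0<..<1} \<Longrightarrow> \<phi> x (s * t) \<le> C' * s powr p * \<phi> x t"
    using assms unfolding lower_type_def by blast
  define K where "K = max 1 C * max 1 C'"
  have K: "0 < K" by (simp add: K_def)
  have bound: "1 \<le> K * s powr (p - 1)" if s: "0 < s" "s < 1" for s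
  proof -
    fix x
    have "\<phi> x 1 = \<phi> x (inverse s * s)" using s by simp
    also have "\<dots> \<le> C * inverse s powr 1 * \<phi> x s" using s by (intro C) (auto simp: one_le_inverse)
    also have "\<dots> \<le> max 1 C * inverse s * \<phi> x s"
      using s pos[of s x] by (intro mult_right_mono) auto
    also have "\<phi> x s \<le> C' * s powr p * \<phi> x 1" using C'[of 1 s x] s by simp
    also have "\<dots> \<le> max 1 C' * s powr p * \<phi> x 1"
      using pos[of 1 x] by (intro mult_right_mono) auto
    finally have "\<phi> x 1 \<le> max 1 C * inverse s * (max 1 C' * s powr p * \<phi> x 1)"
      using s by (simp add: mult_left_mono)
    also have "\<dots> = K * s powr (p - 1) * \<phi> x 1"
      using s by (simp add: K_def powr_diff divide_inverse)
    finally show ?thesis using pos[of 1 x] by simp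
  qed
  have "((\<lambda>s. K * s powr (p - 1)) \<longlongrightarrow> K * 0) (at_right 0)"
    using \<open>\<not> p \<le> 1\<close> by (intro tendsto_mult_left tendsto_powr'[THEN tendsto_eq_rhs])
      (auto intro!: tendsto_eq_intros eventually_at_right_less[THEN eventually_mono])
  then have "\<forall>\<^sub>F s in at_right 0. K * s powr (p - 1) < 1"
    by (intro order_tendstoD(2)) auto
  moreover have "\<forall>\<^sub>F s in at_right (0::real). 0 < s \<and> s < 1"
    by (intro eventually_at_right_real[THEN eventually_mono, of 0 1]) auto
  ultimately have "\<forall>\<^sub>F s in at_right (0::real). False"
    by eventually_elim (use bound in fastforce)
  then show False by simp
qed

text \<open>The indices are infima and a supremum that need not be attained. As the bound on
  \<open>M\<close> is strict, each can be moved by a small \<epsilon> to an attained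
  exponent.\<close>

lemma exponents_exist:
  assumes h: "homogeneous_space d \<mu>" and gf: "growth_function d \<mu> \<phi>"
    and M: "deg_n d \<mu> * (1 + p_index d \<mu> \<phi> / i_index \<phi>) - deg_alpha d \<mu> < M"
  shows "\<exists>n p i. cond_D d \<mu> n \<and> 1 \<le> p \<and> \<phi> \<in> muckenhoupt d \<mu> p \<and> 0 < i \<and> i \<le> 1 \<and>
    lower_type \<phi> i \<and> n * p / i < M"
proof -
  let ?n = "deg_n d \<mu>" and ?p = "p_index d \<mu> \<phi>" and ?i = "i_index \<phi>"
  define Sn where "Sn = {n. cond_D d \<mu> n}"
  define Sp where "Sp = {p. 1 \<le> p \<and> \<phi> \<in> muckenhoupt d \<mu> p}"
  define Si where "Si = {p. 0 < p \<and> lower_type \<phi> p}"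
  have pos: "0 < \<phi> x t" if "0 < t" for x t
    using gf that by (simp add: growth_function_def orlicz_function_def)
  have up: "upper_type \<phi> 1" using gf by (simp add: growth_function_def)
  have Si1: "i \<le> 1" if "i \<in> Si" for i
    using lower_type_le_1[of \<phi> i] pos up that by (simp add: Si_def)
  obtain i1 where i1: "i1 \<in> Si"
    using gf by (auto simp: growth_function_def Si_def)
  have bdd: "bdd_above Si" using Si1 by (auto simp: bdd_above_def)
  have "Sn \<noteq> {}" using homogeneous_cond_D[OF h] by (auto simp: Sn_def)
  have "Sp \<noteq> {}" using gf by (auto simp: growth_function_def Sp_def)
  have n0: "0 \<le> ?n" by (rule deg_n_nonneg[OF h])
  have p0: "1 \<le> ?p"
    unfolding p_index_def Sp_def[symmetric] using \<open>Sp \<noteq> {}\<close>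
    by (intro cInf_greatest) (auto simp: Sp_def)
  have "i1 \<le> ?i" unfolding i_index_def Si_def[symmetric] by (rule cSup_upper[OF i1 bdd])
  then have i0: "0 < ?i" using i1 by (simp add: Si_def)
  have "?n * ?p / ?i < M"
    using M deg_alpha_le_deg_n[OF h] by (simp add: algebra_simps)
  moreover have "((\<lambda>\<epsilon>. (?n + \<epsilon>) * (?p + \<epsilon>) / (?i - \<epsilon>)) \<longlongrightarrow> (?n + 0) * (?p + 0) / (?i - 0)) (at_right 0)"
    using i0 by (intro tendsto_intros) auto
  ultimately have "\<forall>\<^sub>F \<epsilon> in at_right 0. (?n + \<epsilon>) * (?p + \<epsilon>) / (?i - \<epsilon>) < M"
    by (intro order_tendstoD(2)[where y = "(?n + 0) * (?p + 0) / (?i - 0)"]) auto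
  moreover have "\<forall>\<^sub>F \<epsilon> in at_right 0. \<epsilon> \<in> {0<..<?i}"
    using i0 by (rule eventually_at_right_real)
  ultimately have "\<forall>\<^sub>F \<epsilon> in at_right 0. (?n + \<epsilon>) * (?p + \<epsilon>) / (?i - \<epsilon>) < M \<and> \<epsilon> \<in> {0<..<?i}"
    by (rule eventually_conj)
  then obtain \<epsilon> where \<epsilon>: "(?n + \<epsilon>) * (?p + \<epsilon>) / (?i - \<epsilon>) < M" "0 < \<epsilon>" "\<epsilon> < ?i"
    using eventually_happens'[OF trivial_limit_at_right_real] by fastforce
  obtain n where n: "n \<in> Sn" "n < ?n + \<epsilon>"
    using cInf_lessD[OF \<open>Sn \<noteq> {}\<close>, of "?n + \<epsilon>"] \<epsilon> by (auto simp: deg_n_def Sn_def)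
  obtain p where p: "p \<in> Sp" "p < ?p + \<epsilon>"
    using cInf_lessD[OF \<open>Sp \<noteq> {}\<close>, of "?p + \<epsilon>"] \<epsilon> by (auto simp: p_index_def Sp_def)
  have "Si \<noteq> {}" using i1 by blast
  then obtain i where i: "i \<in> Si" "?i - \<epsilon> < i"
    using less_cSupD[of Si "?i - \<epsilon>"] \<epsilon> by (auto simp: i_index_def Si_def)
  have "n * p / i \<le> (?n + \<epsilon>) * (?p + \<epsilon>) / (?i - \<epsilon>)"
    using n p i \<epsilon> n0 p0 by (intro frac_le mult_mono) (auto simp: Sn_def Sp_def cond_D_def)
  then show ?thesis
    using \<epsilon>(1) n p i Si1[OF i(1)]
    by (intro exI[of _ n] exI[of _ p] exI[of _ i]) (auto simp: Sn_def Sp_def Si_def)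
qed

lemma kernel_space_exists:
  assumes h: "homogeneous_space d \<mu>" and gf: "growth_function d \<mu> \<phi>"
    and A: "approx_identity d \<mu> \<phi> M m g a"
  shows "\<exists>C1 cD n cU cL iL cA p cg. kernel_space d \<mu> C1 cD n \<phi> cU cL iL cA p m M cg g a"
proof -
  have "deg_n d \<mu> * (1 + p_index d \<mu> \<phi> / i_index \<phi>) - deg_alpha d \<mu> < M"
    using A by (simp add: approx_identity_def)
  from exponents_exist[OF h gf this] obtain n p i where e: "cond_D d \<mu> n" "1 \<le> p"
      "\<phi> \<in> muckenhoupt d \<mu> p" "0 < i" "i \<le> 1" "lower_type \<phi> i" "n * p / i < M"
    by blast
  obtain C1 cD where ds: "doubling_space d \<mu> C1 cD n"
    using homogeneous_doubling_space[OF h e(1)] by blast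
  interpret doubling_space d \<mu> C1 cD n by (rule ds)
  have orl: "mono_on {0..} (\<phi> x)" "\<phi> x 0 = 0" "0 < t \<Longrightarrow> 0 < \<phi> x t" for x t
    using gf by (auto simp: growth_function_def orlicz_function_def)
  have meas: "(\<lambda>x. \<phi> x t) \<in> borel_measurable \<mu>" if "0 \<le> t" for t
    using gf that by (simp add: growth_function_def)
  have nonneg: "0 \<le> \<phi> x t" if "0 \<le> t" for x t
    using orl(2)[of x] orl(3)[of t x] that by (cases "t = 0") auto
  obtain CU where CU: "\<And>x t s. 0 \<le> t \<Longrightarrow> 1 \<le> s \<Longrightarrow> \<phi> x (s * t) \<le> CU * s powr 1 * \<phi> x t"
    using gf unfolding growth_function_def upper_type_def by blast
  obtain CL where CL: "\<And>x t s. 0 \<le> t \<Longrightarrow> s \<in> {0<..<1} \<Longrightarrow> \<phi> x (s * t) \<le> CL * s powr i * \<phi> x t"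
    using e(6) unfolding lower_type_def by blast
  obtain cA where cA: "0 < cA" "\<forall>t>0. \<forall>x. \<forall>r>0. phi_mass \<mu> \<phi> (qball d x r) t < \<infinity> \<and>
    (\<forall>E\<in>sets \<mu>. E \<subseteq> qball d x r \<longrightarrow>
      enn2real (phi_mass \<mu> \<phi> (qball d x r) t) * (measure \<mu> E / measure \<mu> (qball d x r)) powr p
      \<le> cA * enn2real (phi_mass \<mu> \<phi> E t))"
    using muckenhoupt_compare[OF meas[OF less_imp_le] orl(3) e(2,3)] by blast
  have gs: "growth_space d \<mu> C1 cD n \<phi> (max 1 CU) (max 1 CL) i cA p"
  proof (intro growth_space.intro growth_space_axioms.intro ds)
    show "\<phi> x s \<le> \<phi> x t" if "0 \<le> s" "s \<le> t" for x s t
      using that by (intro mono_onD[OF orl(1)]) auto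
    show "\<phi> x (s * t) \<le> max 1 CU * s * \<phi> x t" if "0 \<le> t" "1 \<le> s" for x s t
    proof -
      have "CU * s * \<phi> x t \<le> max 1 CU * s * \<phi> x t"
        using that nonneg[of t x] by (intro mult_right_mono) auto
      moreover have "\<phi> x (s * t) \<le> CU * s * \<phi> x t" using CU[OF that, of x] that by simp
      ultimately show ?thesis by linarith
    qed
    show "\<phi> x (s * t) \<le> max 1 CL * s powr i * \<phi> x t" if "0 \<le> t" "0 < s" "s \<le> 1" for x s t
    proof (cases "s = 1")
      case True
      have "1 * \<phi> x t \<le> max 1 CL * \<phi> x t" using that nonneg[of t x] by (intro mult_right_mono) auto
      then show ?thesis using True by simp
    next
      case False
      have "CL * s powr i * \<phi> x t \<le> max 1 CL * s powr i * \<phi> x t"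
        using that nonneg[of t x] by (intro mult_right_mono) auto
      moreover have "\<phi> x (s * t) \<le> CL * s powr i * \<phi> x t" using CL[of t s x] that False by simp
      ultimately show ?thesis by linarith
    qed
  qed (use orl meas e cA in auto)
  interpret growth_space d \<mu> C1 cD n \<phi> "max 1 CU" "max 1 CL" i cA p by (rule gs)
  have g: "0 < g s" if "0 \<le> s" for s using A that by (simp add: approx_identity_def)
  have "bounded (g ` {0..})" using A by (simp add: approx_identity_def)
  then obtain G where G: "\<And>s. 0 \<le> s \<Longrightarrow> g s \<le> G"
    unfolding bounded_iff by (metis abs_le_D1 atLeast_iff imageI real_norm_def)
  have "((\<lambda>s. s powr M * g (s powr m)) \<longlongrightarrow> 0) at_top" using A by (simp add: approx_identity_def)
  then have "\<forall>\<^sub>F s in at_top. s powr M * g (s powr m) < 1" by (rule order_tendstoD(2)) simp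
  then obtain S where S: "\<And>s. S \<le> s \<Longrightarrow> s powr M * g (s powr m) < 1"
    by (auto simp: eventually_at_top_linorder)
  \<comment> \<open>Covers \<open>g\<close> itself, the range beyond \<open>S\<close>, where the
    product is below 1, and the range up to \<open>S\<close>, where it is at most
    \<open>max 0 S powr M * G\<close>.\<close>
  define cg where "cg = 1 + G + max 0 S powr M * G"
  have G0: "0 < G" using G[of 0] g[of 0] by simp
  have MG: "0 \<le> max 0 S powr M * G" using G0 by simp
  have M0: "0 < M" using e(7) q_pos by (simp add: q_def)
  have "kernel_space d \<mu> C1 cD n \<phi> (max 1 CU) (max 1 CL) i cA p m M cg g a"
  proof (intro kernel_space.intro kernel_space_axioms.intro gs)
    show "0 < m" "0 < t \<Longrightarrow> (\<lambda>(x, y). a t x y) \<in> borel_measurable (\<mu> \<Otimes>\<^sub>M \<mu>)"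
      "0 < t \<Longrightarrow> cmod (a t x y) \<le> h_kernel d \<mu> m g t x y" for t x y
      using A by (simp_all add: approx_identity_def)
    show "q < M" using e(7) by (simp add: q_def)
    show "0 < cg" using G0 by (simp add: cg_def add_pos_nonneg)
    show "0 \<le> g s" if "0 \<le> s" for s using g[OF that] by simp
    show "g s \<le> cg" if "0 \<le> s" for s
      unfolding cg_def using G[OF that] MG by linarith
    show "s powr M * g (s powr m) \<le> cg" if "0 < s" for s
    proof (cases "S \<le> s")
      case True
      then show ?thesis unfolding cg_def using S[OF True] G0 MG by linarith
    next
      case False
      have "s powr M * g (s powr m) \<le> max 0 S powr M * G"
        using False that M0 G G0 g[of "s powr m"] by (intro mult_mono powr_mono2) auto
      then show ?thesis using G0 by (simp add: cg_def)
    qed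
  qed
  then show ?thesis by blast
qed

text \<open>The substance is convergence of the kernel integrals: the restriction on the class
  parameter \<gamma> leaves room for an admissible volume exponent \<open>k\<close>, chosen
  separately from the \<open>n\<close> of the locale.\<close>

lemma (in kernel_space) bmo_functionI:
  assumes h: "homogeneous_space d \<mu>" and A: "assumption_A d \<mu> \<phi> M m g a"
    and f: "f \<in> bmo_space d \<mu> \<phi> M m a" and b: "0 < b" "bmo_norm d \<mu> \<phi> m a f \<le> ennreal b"
  shows "bmo_function d \<mu> C1 cD n \<phi> cU cL iL cA p m M cg g a f b"
proof -
  have fM: "f \<in> M_class d \<mu> \<phi> M" using f by (simp add: bmo_space_def)
  let ?e0 = "deg_n d \<mu> * p_index d \<mu> \<phi> / i_index \<phi> - deg_alpha d \<mu>"
  obtain x0 \<gamma> where \<gamma>: "\<gamma> < M - deg_n d \<mu> * (1 + p_index d \<mu> \<phi> / i_index \<phi>) + deg_alpha d \<mu>"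
    and f': "f \<in> M_class_at d \<mu> \<phi> x0 \<gamma>"
    using fM by (auto simp: M_class_def)
  have f_meas: "f \<in> borel_measurable \<mu>" using f' by (simp add: M_class_at_def)
  have less: "Inf {n. cond_D d \<mu> n} < M - (?e0 + \<gamma>)"
    using \<gamma> by (simp add: deg_n_def[symmetric] algebra_simps)
  have "{n. cond_D d \<mu> n} \<noteq> {}" using homogeneous_cond_D[OF h] by blast
  from cInf_lessD[OF this less] obtain k where k: "cond_D d \<mu> k" "k < M - (?e0 + \<gamma>)"
    by auto
  obtain C where C: "\<And>x r l. 0 < r \<Longrightarrow> 1 \<le> l \<Longrightarrow>
      measure \<mu> (qball d x (l * r)) \<le> C * l powr k * measure \<mu> (qball d x r)"
    using k(1) unfolding cond_D_def by blast
  define C' where "C' = max 1 C * measure \<mu> (qball d x0 1)"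
  have C': "0 < C'" using measure_ball_pos[of 1 x0] by (simp add: C'_def)
  have growth: "measure \<mu> (qball d x0 l) \<le> C' * l powr k" if "1 \<le> l" for l
  proof -
    have "measure \<mu> (qball d x0 l) \<le> C * (l powr k * measure \<mu> (qball d x0 1))"
      using C[of 1 l x0] that by (simp add: mult.assoc)
    also have "\<dots> \<le> max 1 C * (l powr k * measure \<mu> (qball d x0 1))"
      by (intro mult_right_mono) auto
    finally show ?thesis by (simp add: C'_def mult_ac)
  qed
  show ?thesis
  proof (intro bmo_function.intro bmo_function_axioms.intro kernel_space_axioms)
    show "f \<in> borel_measurable \<mu>" "0 < b" by fact+
    show "AE x in \<mu>. A_op \<mu> a t (A_op \<mu> a s f) x = A_op \<mu> a (t + s) f x" if "0 < s" "0 < t" for s t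
      using A fM that by (simp add: assumption_A_def)
    show "integrable \<mu> (\<lambda>y. a t x y * f y)" if "0 < t" for t x
      using that f_meas _ growth _ C'
    proof (rule kernel_integrable)
      show "(\<integral>\<^sup>+z. ennreal (cmod (f z) / ((1 + d x0 z) powr (?e0 + \<gamma>) *
          measure \<mu> (qball d x0 (1 + d x0 z)))) \<partial>\<mu>) < \<infinity>"
        using f' by (simp add: M_class_at_def)
      show "?e0 + \<gamma> + k \<le> M" using k(2) by simp
    qed
    show "(\<integral>\<^sup>+y\<in>qball d x r. ennreal (cmod (f y - A_op \<mu> a (r powr m) f y)) \<partial>\<mu>) \<le> ennreal (b * N x r)"
      if r: "0 < r" for x r
    proof -
      let ?X = "\<integral>\<^sup>+y\<in>qball d x r. ennreal (cmod (f y - A_op \<mu> a (r powr m) f y)) \<partial>\<mu>"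
      have N: "0 < N x r" by (rule N_pos[OF r])
      have "?X / luxemburg_norm \<mu> \<phi> (indicator (qball d x r)) \<le> bmo_norm d \<mu> \<phi> m a f"
        unfolding bmo_norm_def using r by (intro SUP_upper2[of "(x, r)"]) auto
      then have "?X / ennreal (N x r) \<le> ennreal b"
        using b(2) luxemburg_N[OF r, of x] by simp
      then have "?X / ennreal (N x r) * ennreal (N x r) \<le> ennreal b * ennreal (N x r)"
        by (rule mult_right_mono) simp
      moreover have "?X / ennreal (N x r) * ennreal (N x r) = ?X"
        using N by (simp add: ennreal_divide_times)
      ultimately show ?thesis using b N by (simp add: ennreal_mult'')
    qed
  qed
qed

section \<open>Level sets, and the choice of parameters for the two decay laws\<close>

context bmo_function
begin

lemma osc_set_props:
  fixes x :: 'a and r l :: real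
  assumes r: "0 < r" and l: "0 < l"
  defines "E \<equiv> osc_set d \<mu> \<phi> m a f x r l"
  shows "E \<in> sets \<mu>" "E \<subseteq> qball d x r" "\<And>y. y \<in> E \<Longrightarrow> l * \<phi> y (1 / N x r) \<le> D r y"
    "phi_mass \<mu> \<phi> E (1 / N x r) = ennreal (W (1 / N x r) E)" "W (1 / N x r) E \<le> 2 * cU"
proof -
  let ?t = "1 / N x r"
  have t: "0 < ?t" using N_pos[OF r] by simp
  have E: "E = {y \<in> qball d x r. l < D r y / \<phi> y ?t}"
    by (auto simp: E_def osc_set_def D_def N_def inverse_eq_divide)
  have [measurable]: "D r \<in> borel_measurable \<mu>" "(\<lambda>y. \<phi> y ?t) \<in> borel_measurable \<mu>" "qball d x r \<in> sets \<mu>"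
    using D_measurable[OF r] phi_measurable[of ?t] t ball_sets by auto
  have "E = {y \<in> space \<mu>. y \<in> qball d x r \<and> l < D r y / \<phi> y ?t}" by (auto simp: E space_UNIV)
  then show Es: "E \<in> sets \<mu>" by simp
  show sub: "E \<subseteq> qball d x r" by (auto simp: E)
  show "l * \<phi> y ?t \<le> D r y" if "y \<in> E" for y
    using that phi_pos[OF t, of y] by (auto simp: E pos_less_divide_eq)
  show "phi_mass \<mu> \<phi> E ?t = ennreal (W ?t E)"
    using emeasure_wt_ball[OF t r Es sub] emeasure_wt[of ?t E] t Es by simp
  have "W ?t E \<le> W ?t (qball d x r)"
    by (rule W_mono[OF t r Es ball_sets sub subset_refl])
  also have "\<dots> \<le> 2 * cU" by (rule W_norm[OF r])
  finally show "W ?t E \<le> 2 * cU" .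
qed

lemma osc_set_null:
  assumes r: "0 < r" and l: "0 < l" and zero: "bmo_norm d \<mu> \<phi> m a f = 0"
  shows "phi_mass \<mu> \<phi> (osc_set d \<mu> \<phi> m a f x r l) (1 / N x r) = 0"
proof -
  let ?E = "osc_set d \<mu> \<phi> m a f x r l" and ?X = "\<integral>\<^sup>+v\<in>qball d x r. ennreal (D r v) \<partial>\<mu>"
  have N: "0 < N x r" by (rule N_pos[OF r])
  have "?X / luxemburg_norm \<mu> \<phi> (indicator (qball d x r)) \<le> bmo_norm d \<mu> \<phi> m a f"
    unfolding bmo_norm_def D_def using r by (intro SUP_upper2[of "(x, r)"]) auto
  then have "?X = 0"
    using zero luxemburg_N[OF r, of x] by (simp add: ennreal_divide_eq_0_iff)
  moreover have "ennreal l * phi_mass \<mu> \<phi> ?E (1 / N x r) \<le> osc r ?E"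
    using N osc_set_props[OF r l] by (intro mass_le_oscillation l) auto
  moreover have "osc r ?E \<le> ?X"
    by (intro D_integral_mono osc_set_props[OF r l])
  ultimately have "ennreal l * phi_mass \<mu> \<phi> ?E (1 / N x r) = 0" by simp
  then show ?thesis using l by (simp add: ennreal_eq_0_iff)
qed

end

context kernel_space
begin

text \<open>The analogue of \<open>mass_compare\<close> for an exponent other than the
  \<open>p\<close> of the locale, which is tied to the condition \<open>q < M\<close>.\<close>

definition comparable :: "real \<Rightarrow> real \<Rightarrow> bool" where
  "comparable p1 A \<longleftrightarrow> (\<forall>t>0. \<forall>x. \<forall>r>0. \<forall>E\<in>sets \<mu>. E \<subseteq> qball d x r \<longrightarrow>
      W t (qball d x r) * (measure \<mu> E / measure \<mu> (qball d x r)) powr p1 \<le> A * W t E)"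

lemma muckenhoupt_comparable:
  assumes "1 \<le> p1" "\<phi> \<in> muckenhoupt d \<mu> p1"
  shows "\<exists>A>0. comparable p1 A"
proof -
  obtain A where A: "0 < A" "\<forall>t>0. \<forall>x. \<forall>r>0. phi_mass \<mu> \<phi> (qball d x r) t < \<infinity> \<and>
    (\<forall>E\<in>sets \<mu>. E \<subseteq> qball d x r \<longrightarrow>
      enn2real (phi_mass \<mu> \<phi> (qball d x r) t) * (measure \<mu> E / measure \<mu> (qball d x r)) powr p1
      \<le> A * enn2real (phi_mass \<mu> \<phi> E t))"
    using muckenhoupt_compare[OF phi_measurable[OF less_imp_le] phi_pos assms] by blast
  then have "comparable p1 A"
    unfolding comparable_def measure_def by (simp add: emeasure_wt ball_sets)
  then show ?thesis using A(1) by blast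
qed

text \<open>Separates norm 0, where the level set is null, from positive norm, where the norm itself
  serves as \<open>b\<close>. The locale constants do not depend on \<open>f\<close>, so bounds in
  terms of them are uniform.\<close>

lemma osc_set_bound:
  assumes h: "homogeneous_space d \<mu>" and A: "assumption_A d \<mu> \<phi> M m g a"
    and f: "f \<in> bmo_space d \<mu> \<phi> M m a" and r: "0 < r" and l: "0 < l"
    and bound: "\<And>b. bmo_function d \<mu> C1 cD n \<phi> cU cL iL cA p m M cg g a f b \<Longrightarrow>
      W (1 / N x r) (osc_set d \<mu> \<phi> m a f x r l) \<le> \<Phi> b"
  shows "phi_mass \<mu> \<phi> (osc_set d \<mu> \<phi> m a f x r l) (1 / N x r)
    \<le> ennreal (if bmo_norm d \<mu> \<phi> m a f = 0 then 0 else \<Phi> (enn2real (bmo_norm d \<mu> \<phi> m a f)))"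
proof (cases "bmo_norm d \<mu> \<phi> m a f = 0")
  case True
  interpret bmo_function d \<mu> C1 cD n \<phi> cU cL iL cA p m M cg g a f 1
    using True by (intro bmo_functionI[OF h A f]) auto
  show ?thesis using osc_set_null[OF r l True, of x] True by simp
next
  case False
  have "bmo_norm d \<mu> \<phi> m a f < \<infinity>" using f by (simp add: bmo_space_def)
  then have bf: "bmo_function d \<mu> C1 cD n \<phi> cU cL iL cA p m M cg g a f (enn2real (bmo_norm d \<mu> \<phi> m a f))"
    using False
    by (intro bmo_functionI[OF h A f]) (auto simp: enn2real_positive_iff zero_less_iff_neq_zero)
  then interpret bmo_function d \<mu> C1 cD n \<phi> cU cL iL cA p m M cg g a f "enn2real (bmo_norm d \<mu> \<phi> m a f)" .
  show ?thesis
    using False bound[OF bf] osc_set_props(4)[OF r l, of x] by (simp add: ennreal_leI)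
qed

text \<open>For exponent 1 the power of s in front of w(E) disappears, so s may be as small as
  desired: all \<open>s j\<close> equal \<open>(1/2) ^ k\<close>. The terms with w(E) then grow
  linearly in \<open>k\<close>, the remaining ones decay like \<open>(1/2) ^ k\<close>, and
  \<open>exponential_decay\<close> applies.\<close>

lemma exponential_bound:
  assumes h: "homogeneous_space d \<mu>" and A: "assumption_A d \<mu> \<phi> M m g a"
    and mu: "\<phi> \<in> muckenhoupt d \<mu> 1"
  shows "\<exists>c1>0. \<exists>c2>0. \<forall>f\<in>bmo_space d \<mu> \<phi> M m a. \<forall>x. \<forall>r>0. \<forall>l>0.
    phi_mass \<mu> \<phi> (osc_set d \<mu> \<phi> m a f x r l) (1 / N x r)
    \<le> ennreal (if bmo_norm d \<mu> \<phi> m a f = 0 then 0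
        else c1 * exp (- (c2 * l / (N x r * enn2real (bmo_norm d \<mu> \<phi> m a f)))))"
proof -
  obtain A1 where A1: "0 < A1" "comparable 1 A1"
    using muckenhoupt_comparable[OF order_refl mu] by blast
  \<comment> \<open>The summand 1 ensures positivity, since \<open>c5\<close> is only known to be
    nonnegative.\<close>
  define \<gamma> where "\<gamma> = 2 * c5 * A1 + 1"
  define c where "c = (4 * c5 + c2) * (2 * cU)"
  have \<gamma>: "0 < \<gamma>" "0 \<le> c" using c5_pos A1 c2_pos cU_ge_1 by (auto simp: \<gamma>_def c_def add_nonneg_pos)
  obtain K \<kappa> where K: "0 < K" "0 < \<kappa>" and decay: "\<forall>u>0. \<forall>w\<ge>0. w \<le> 2 * cU \<longrightarrow>
    (\<forall>k::nat. u * w \<le> (\<beta> + \<gamma> * real k) * w + c * (1/2) ^ k) \<longrightarrow> w \<le> K * exp (- (\<kappa> * u))"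
    using exponential_decay[of \<beta> \<gamma> c "2 * cU"] \<beta>_pos \<gamma> cU_ge_1 by auto
  show ?thesis
  proof (rule exI[of _ K], rule conjI[OF K(1)], rule exI[of _ "\<kappa> / c7"], intro conjI ballI allI impI)
    show "0 < \<kappa> / c7" using K c7_pos by auto
    fix f x and r l :: real assume f: "f \<in> bmo_space d \<mu> \<phi> M m a" and r: "0 < r" and l: "0 < l"
    let ?E = "osc_set d \<mu> \<phi> m a f x r l" and ?t = "1 / N x r"
    show "phi_mass \<mu> \<phi> ?E ?t \<le> ennreal (if bmo_norm d \<mu> \<phi> m a f = 0 then 0
        else K * exp (- (\<kappa> / c7 * l / (N x r * enn2real (bmo_norm d \<mu> \<phi> m a f)))))"
    proof (rule osc_set_bound[OF h A f r l, where \<Phi> = "\<lambda>b. K * exp (- (\<kappa> / c7 * l / (N x r * b)))"])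
      fix b assume "bmo_function d \<mu> C1 cD n \<phi> cU cL iL cA p m M cg g a f b"
      then interpret bmo_function d \<mu> C1 cD n \<phi> cU cL iL cA p m M cg g a f b .
      note b = b_pos
      note E = osc_set_props[OF r l, where x = x]
      have N: "0 < N x r" by (rule N_pos[OF r])
      define u where "u = l / (c7 * b * N x r)"
      have u: "0 < u" using l c7_pos b N by (simp add: u_def)
      have "u * W ?t ?E \<le> (\<beta> + \<gamma> * real k) * W ?t ?E + c * (1/2) ^ k" for k :: nat
      proof -
        have "(\<Sum>j<k. 2 * c5 * (1/2) ^ k * (1/2) ^ j) = 2 * c5 * (1/2) ^ k * (\<Sum>j<k. (1/2::real) ^ j)"
          by (simp add: sum_distrib_left)
        also have "\<dots> \<le> 2 * c5 * (1/2) ^ k * 2"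
          using geometric_sum_le[of "1/2" k] c5_pos by (intro mult_left_mono) auto
        finally have sum: "(\<Sum>j<k. 2 * c5 * (1/2) ^ k * (1/2) ^ j) + c2 * (1/2) ^ k \<le> (4 * c5 + c2) * (1/2) ^ k"
          by (simp add: algebra_simps)
        have "l * W ?t ?E \<le> c7 * b * N x r * ((\<beta> + (\<Sum>j<k. 2 * c5 * (A1 * ((1/2) ^ k) powr (1 - 1)))) * W ?t ?E +
            ((\<Sum>j<k. 2 * c5 * (1/2) ^ k * (1/2) ^ j) + c2 * (1/2) ^ k) * (2 * cU))"
          using A1 l E(3) unfolding comparable_def
          by (intro level_estimate[OF r order_refl A1(1) _ _ E(1,2)]) auto
        then have "u * W ?t ?E \<le> (\<beta> + (\<Sum>j<k. 2 * c5 * (A1 * ((1/2) ^ k) powr (1 - 1)))) * W ?t ?E +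
            ((\<Sum>j<k. 2 * c5 * (1/2) ^ k * (1/2) ^ j) + c2 * (1/2) ^ k) * (2 * cU)"
          using c7_pos b N by (simp add: u_def pos_divide_le_eq mult.commute)
        also have "\<dots> \<le> (\<beta> + \<gamma> * real k) * W ?t ?E + ((4 * c5 + c2) * (1/2) ^ k) * (2 * cU)"
          using sum cU_ge_1 by (intro add_mono mult_right_mono) (auto simp: \<gamma>_def algebra_simps)
        finally show ?thesis by (simp only: c_def mult.assoc mult.commute mult.left_commute)
      qed
      then have "W ?t ?E \<le> K * exp (- (\<kappa> * u))"
        using decay u E(5) by simp
      also have "\<kappa> * u = \<kappa> / c7 * l / (N x r * b)"
        by (simp add: u_def mult_ac)
      finally show "W ?t ?E \<le> K * exp (- (\<kappa> / c7 * l / (N x r * b)))" .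
    qed
  qed
qed

text \<open>Here \<open>s j\<close> is geometric with a ratio strictly between 1 and 2: below 2 so
  that the halving of mass wins, above 1 so that the powers \<open>s j powr (1 - p1)\<close> are
  summable. Both sums are then bounded independently of the number of generations.\<close>

lemma power_bound:
  assumes h: "homogeneous_space d \<mu>" and A: "assumption_A d \<mu> \<phi> M m g a"
    and p1: "1 < p1" and mu: "\<phi> \<in> muckenhoupt d \<mu> p1"
  shows "\<exists>b1>0. \<exists>b2>0. \<forall>f\<in>bmo_space d \<mu> \<phi> M m a. \<forall>x. \<forall>r>0. \<forall>l>0.
    phi_mass \<mu> \<phi> (osc_set d \<mu> \<phi> m a f x r l) (1 / N x r)
    \<le> ennreal (if bmo_norm d \<mu> \<phi> m a f = 0 then 0
        else b1 * min 1 (b2 * (l * enn2real (phi_mass \<mu> \<phi> (qball d x r) (1 / N x r))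
          / (N x r * enn2real (bmo_norm d \<mu> \<phi> m a f))) powr (- (p1 / (p1 - 1)))))"
proof -
  obtain A1 where A1: "0 < A1" "comparable p1 A1"
    using muckenhoupt_comparable[OF less_imp_le[OF p1] mu] by blast
  define \<theta> where "\<theta> = (3/2::real) powr (1 - p1)"
  have \<theta>: "0 < \<theta>" "\<theta> < 1" using p1 powr_less_one[of "3/2" "1 - p1"] by (auto simp: \<theta>_def)
  define a1 where "a1 = 2 * c5 * A1 / (1 - \<theta>) + 1"
  define c where "c = (8 * c5 + c2) * (2 * cU)"
  have ac: "0 < a1" "0 < c"
    using c5_pos A1 c2_pos cU_ge_1 \<theta> by (auto simp: a1_def c_def add_nonneg_pos)
  obtain K where K: "0 < K" and decay: "\<forall>u>0. \<forall>w\<ge>0. w \<le> 2 * cU \<longrightarrow>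
    (\<forall>\<sigma>>0. u * w \<le> (\<beta> + a1 * \<sigma> powr (1 - p1)) * w + c * \<sigma>) \<longrightarrow> w \<le> K * u powr (- (p1 / (p1 - 1)))"
    using power_decay[of \<beta> a1 c "2 * cU" p1] \<beta>_pos ac cU_ge_1 p1 by auto
  let ?P = "p1 / (p1 - 1)"
  have P: "0 < ?P" using p1 by simp
  \<comment> \<open>Includes the price of expressing \<open>u\<close> through the quotient in the
    statement, namely the bound \<open>2 * cU\<close> for the mass of the ball; dividing by
    \<open>2 * cU\<close> makes room for the outer constant, which also serves the branch 1 of the
    minimum.\<close>
  define b2 where "b2 = K * (2 * cU * c7) powr ?P / (2 * cU)"
  have cU2: "0 < 2 * cU" using cU_ge_1 by simp
  have b2: "0 < b2" using K cU_ge_1 c7_pos by (simp add: b2_def)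
  show ?thesis
  proof (rule exI[of _ "2 * cU"], rule conjI[OF cU2], rule exI[of _ b2], intro conjI ballI allI impI)
    show "0 < b2" by (rule b2)
    fix f x and r l :: real assume f: "f \<in> bmo_space d \<mu> \<phi> M m a" and r: "0 < r" and l: "0 < l"
    let ?E = "osc_set d \<mu> \<phi> m a f x r l" and ?t = "1 / N x r"
    let ?WB = "enn2real (phi_mass \<mu> \<phi> (qball d x r) ?t)"
    show "phi_mass \<mu> \<phi> ?E ?t \<le> ennreal (if bmo_norm d \<mu> \<phi> m a f = 0 then 0
        else 2 * cU * min 1 (b2 * (l * ?WB / (N x r * enn2real (bmo_norm d \<mu> \<phi> m a f))) powr (- ?P)))"
    proof (rule osc_set_bound[OF h A f r l,
          where \<Phi> = "\<lambda>b. 2 * cU * min 1 (b2 * (l * ?WB / (N x r * b)) powr (- ?P))"])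
      fix b assume "bmo_function d \<mu> C1 cD n \<phi> cU cL iL cA p m M cg g a f b"
      then interpret bmo_function d \<mu> C1 cD n \<phi> cU cL iL cA p m M cg g a f b .
      note b = b_pos
      note E = osc_set_props[OF r l, where x = x]
      have N: "0 < N x r" by (rule N_pos[OF r])
      define u where "u = l / (c7 * b * N x r)"
      have u: "0 < u" using l c7_pos b N by (simp add: u_def)
      have "u * W ?t ?E \<le> (\<beta> + a1 * \<sigma> powr (1 - p1)) * W ?t ?E + c * \<sigma>" if \<sigma>: "0 < \<sigma>" for \<sigma>
      proof -
        \<comment> \<open>Enough generations that the remainder \<open>c2 * (1/2) ^ k\<close> is
          also of the order of \<sigma>.\<close>
        obtain k where k: "(1/2::real) ^ k < \<sigma>" using real_arch_pow_inv[OF \<sigma>, of "1/2"] by auto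
        define s where "s j = \<sigma> * (3/2) ^ j" for j :: nat
        have "(\<Sum>j<k. 2 * c5 * s j * (1/2) ^ j) = 2 * c5 * \<sigma> * (\<Sum>j<k. (3/4::real) ^ j)"
          by (simp add: sum_distrib_left s_def mult.assoc power_mult_distrib[symmetric])
        also have "\<dots> \<le> 2 * c5 * \<sigma> * 4"
          using geometric_sum_le[of "3/4" k] c5_pos \<sigma> by (intro mult_left_mono) auto
        finally have "(\<Sum>j<k. 2 * c5 * s j * (1/2) ^ j) \<le> 8 * c5 * \<sigma>" by simp
        moreover have "c2 * (1/2) ^ k \<le> c2 * \<sigma>" using k c2_pos by (intro mult_left_mono) auto
        ultimately have sum1: "(\<Sum>j<k. 2 * c5 * s j * (1/2) ^ j) + c2 * (1/2) ^ k \<le> (8 * c5 + c2) * \<sigma>"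
          by (simp add: distrib_right)
        have "(\<Sum>j<k. 2 * c5 * (A1 * s j powr (1 - p1))) = 2 * c5 * A1 * \<sigma> powr (1 - p1) * (\<Sum>j<k. \<theta> ^ j)"
          by (simp add: sum_distrib_left s_def powr_mult power_powr_commute \<theta>_def mult.assoc)
        also have "\<dots> \<le> 2 * c5 * A1 * \<sigma> powr (1 - p1) * (1 / (1 - \<theta>))"
          using geometric_sum_le[of \<theta> k] \<theta> c5_pos A1 by (intro mult_left_mono) auto
        also have "\<dots> \<le> a1 * \<sigma> powr (1 - p1)" by (simp add: a1_def distrib_right)
        finally have sum2: "(\<Sum>j<k. 2 * c5 * (A1 * s j powr (1 - p1))) \<le> a1 * \<sigma> powr (1 - p1)" .
        have "l * W ?t ?E \<le> c7 * b * N x r * ((\<beta> + (\<Sum>j<k. 2 * c5 * (A1 * s j powr (1 - p1)))) * W ?t ?E +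
            ((\<Sum>j<k. 2 * c5 * s j * (1/2) ^ j) + c2 * (1/2) ^ k) * (2 * cU))"
          using A1 l E(3) p1 \<sigma> unfolding comparable_def
          by (intro level_estimate[OF r _ A1(1) _ _ E(1,2)]) (auto simp: s_def)
        then have "u * W ?t ?E \<le> (\<beta> + (\<Sum>j<k. 2 * c5 * (A1 * s j powr (1 - p1)))) * W ?t ?E +
            ((\<Sum>j<k. 2 * c5 * s j * (1/2) ^ j) + c2 * (1/2) ^ k) * (2 * cU)"
          using c7_pos b N by (simp add: u_def pos_divide_le_eq mult.commute)
        also have "\<dots> \<le> (\<beta> + a1 * \<sigma> powr (1 - p1)) * W ?t ?E + ((8 * c5 + c2) * \<sigma>) * (2 * cU)"
          using sum1 sum2 cU_ge_1 by (intro add_mono mult_right_mono add_left_mono) auto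
        finally show ?thesis by (simp only: c_def mult.assoc mult.commute mult.left_commute)
      qed
      then have bound: "W ?t ?E \<le> K * u powr (- ?P)"
        using decay u E(5) by simp
      have t: "0 < ?t" using N by simp
      have WB: "?WB = W ?t (qball d x r)"
        using emeasure_wt[of ?t "qball d x r"] t ball_sets by (simp add: measure_def)
      have WB0: "0 < W ?t (qball d x r)" by (rule W_ball_pos[OF t r])
      \<comment> \<open>The exponent is negative, so replacing the mass of the ball by its upper
        bound \<open>2 * cU\<close> only lowers the power.\<close>
      have "K * u powr (- ?P) = 2 * cU * (b2 * (2 * cU * c7 * u) powr (- ?P))"
        using K cU_ge_1 c7_pos u by (simp add: b2_def powr_mult powr_minus field_simps)
      also have "\<dots> \<le> 2 * cU * (b2 * (l * ?WB / (N x r * b)) powr (- ?P))"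
      proof (intro mult_left_mono powr_mono2')
        show "0 < l * ?WB / (N x r * b)" using l WB WB0 N b by simp
        have "l * ?WB / (N x r * b) \<le> l * (2 * cU) / (N x r * b)"
          using W_norm(1)[OF r, of x] l N b unfolding WB by (intro divide_right_mono mult_left_mono) auto
        also have "\<dots> = 2 * cU * c7 * u" using c7_pos by (simp add: u_def mult_ac)
        finally show "l * ?WB / (N x r * b) \<le> 2 * cU * c7 * u" .
      qed (use P b2 cU_ge_1 in auto)
      finally show "W ?t ?E \<le> 2 * cU * min 1 (b2 * (l * ?WB / (N x r * b)) powr (- ?P))"
        using bound E(5) by (simp add: min_def)
    qed
  qed
qed

end

theorem theorem4p9:
  fixes d :: "'a \<Rightarrow> 'a \<Rightarrow> real" and \<mu> :: "'a measure" and \<phi> :: "'a \<Rightarrow> real \<Rightarrow> real"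
    and M m :: real and g :: "real \<Rightarrow> real" and a :: "real \<Rightarrow> 'a \<Rightarrow> 'a \<Rightarrow> complex"
  assumes "homogeneous_space d \<mu>"
    and "growth_function d \<mu> \<phi>"
    and "assumption_A d \<mu> \<phi> M m g a"
  shows "(\<phi> \<in> muckenhoupt d \<mu> 1 \<longrightarrow>
           (\<exists>c1>0. \<exists>c2>0. \<forall>f\<in>bmo_space d \<mu> \<phi> M m a. \<forall>x. \<forall>r>0. \<forall>l>0.
              phi_mass \<mu> \<phi> (osc_set d \<mu> \<phi> m a f x r l) (inverse (chi_norm \<mu> \<phi> (qball d x r)))
              \<le> ennreal (if bmo_norm d \<mu> \<phi> m a f = 0 then 0
                  else c1 * exp (- (c2 * l /
                    (chi_norm \<mu> \<phi> (qball d x r) * enn2real (bmo_norm d \<mu> \<phi> m a f)))))))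
       \<and> (\<forall>p1>1. \<phi> \<in> muckenhoupt d \<mu> p1 \<and>
             p_index d \<mu> \<phi> \<le> 1 + 1 / conj_exponent (r_index d \<mu> \<phi>) \<longrightarrow>
           (\<exists>b1>0. \<exists>b2>0. \<forall>f\<in>bmo_space d \<mu> \<phi> M m a. \<forall>x. \<forall>r>0. \<forall>l>0.
              phi_mass \<mu> \<phi> (osc_set d \<mu> \<phi> m a f x r l) (inverse (chi_norm \<mu> \<phi> (qball d x r)))
              \<le> ennreal (if bmo_norm d \<mu> \<phi> m a f = 0 then 0
                  else b1 * min 1 (b2 *
                    (l * enn2real (phi_mass \<mu> \<phi> (qball d x r) (inverse (chi_norm \<mu> \<phi> (qball d x r))))
                     / (chi_norm \<mu> \<phi> (qball d x r) * enn2real (bmo_norm d \<mu> \<phi> m a f)))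
                    powr (- conj_exponent (ereal p1))))))"
proof -
  have A: "approx_identity d \<mu> \<phi> M m g a"
    using assms(3) by (simp add: assumption_A_def)
  obtain C1 cD n cU cL iL cA p cg where
    "kernel_space d \<mu> C1 cD n \<phi> cU cL iL cA p m M cg g a"
    using kernel_space_exists[OF assms(1,2) A] by (elim exE)
  then interpret kernel_space d \<mu> C1 cD n \<phi> cU cL iL cA p m M cg g a .
  have conj: "conj_exponent (ereal p1) = p1 / (p1 - 1)" for p1
    by (simp add: conj_exponent_def)
  show ?thesis
    unfolding N_def[symmetric] inverse_eq_divide conj
    by (intro conjI allI impI exponential_bound[OF assms(1,3)] power_bound[OF assms(1,3)]) simp_all
qed

end
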